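(* Let $\{\alpha_i\}_{i\in\mathbb{N}}$ be a sequence with values in $(2/5,1/2)$, let $\{\varepsilon_i\}_{i\in\mathbb{N}}$ be a sequence with values in $(0,\varepsilon]$ for some small positive $\varepsilon$, and let $\{q_i\}_{i\in\mathbb{N}}$ be a sequence of positive integers. Then there exist a planar convex body $C$ and an increasing sequence $\{N_i\}_{i\in\mathbb{N}}\subset\mathbb{N}$ such that, for every $i\in\mathbb{N}$, $$N^{\alpha_i-\varepsilon_i}\leq\inf_{\#\mathcal{P}=N}\mathcal{D}_2(\mathcal{P},C)\leq N^{\alpha_i+\varepsilon_i}\quad\text{for every integer } N\in[N_i,N_i+q_i],$$ where the infimum is over all sets $\mathcal{P}\subset[0,1)^2$ of $N$ points.
   Context: A planar convex body is a compact convex subset of $\mathbb{R}^2$ with non-empty interior. Identify $[0,1)^2$ with the torus $\mathbb{T}^2=\mathbb{R}^2/\mathbb{Z}^2$. For a set $C\subset\mathbb{R}^2$ and a set $\mathcal{P}\subset[0,1)^2$ of $N$ points, the discrepancy is $\mathcal{D}(\mathcal{P},C)=\sum_{\mathbf{p}\in\mathcal{P}}\sum_{\mathbf{n}\in\mathbb{Z}^2}\mathbf{1}_C(\mathbf{p}+\mathbf{n})-N|C|$, where $|C|$ is Lebesgue measure. The homothetic quadratic discrepancy is $\mathcal{D}_2(\mathcal{P},C)=\int_0^1\int_{\mathbb{T}^2}|\mathcal{D}(\mathcal{P},\boldsymbol{\tau}+\delta C)|^2\,d\boldsymbol{\tau}\,d\delta$, with $d\boldsymbol{\tau}$ the normalized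 Haar measure on $\mathbb{T}^2$ and $d\delta$ Lebesgue measure on $[0,1]$. *)

theory Defs
  imports "HOL-Analysis.Analysis"
begin

definition planar_convex_body :: "(real \<times> real) set \<Rightarrow> bool" where
  "planar_convex_body C \<longleftrightarrow> compact C \<and> convex C \<and> interior C \<noteq> {}"

text \<open>Number of integer translates of p lying in C (finite for bounded C).\<close>
definition lattice_count :: "(real \<times> real) \<Rightarrow> (real \<times> real) set \<Rightarrow> nat" where
  "lattice_count p C = card {mn :: int \<times> int. p + (of_int (fst mn), of_int (snd mn)) \<in> C}"

definition discrepancy :: "(real \<times> real) set \<Rightarrow> (real \<times> real) set \<Rightarrow> real" where
  "discrepancy P C =
     (\<Sum>p\<in>P. real (lattice_count p C)) - real (card P) * measure lborel C"

definition homothetic_copy :: "(real \<times> real) \<Rightarrow> real \<Rightarrow> (real \<times> real) set \<Rightarrow> (real \<times> real) set" where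
  "homothetic_copy \<tau> \<delta> C = (\<lambda>x. \<tau> + \<delta> *\<^sub>R x) ` C"

text \<open>Homothetic quadratic discrepancy; the normalized Haar measure on the torus is
  Lebesgue measure on the fundamental domain [0,1)^2.\<close>
definition quad_discrepancy :: "(real \<times> real) set \<Rightarrow> (real \<times> real) set \<Rightarrow> real" where
  "quad_discrepancy P C =
     (LINT \<delta>:{0..1}|lborel.
        (LINT \<tau>:({0..<1} \<times> {0..<1})|lborel. (discrepancy P (homothetic_copy \<tau> \<delta> C))\<^sup>2))"

definition point_sets :: "nat \<Rightarrow> (real \<times> real) set set" where
  "point_sets N = {P. P \<subseteq> {0..<1} \<times> {0..<1} \<and> finite P \<and> card P = N}"

definition min_quad_discrepancy :: "(real \<times> real) set \<Rightarrow> nat \<Rightarrow> real" where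
  "min_quad_discrepancy C N = (INF P\<in>point_sets N. quad_discrepancy P C)"

end

theory Submission
  imports Defs
begin

text \<open>The minimal discrepancy at a fixed \<open>N\<close> is Lipschitz in the area of the body (for nested
  bodies), and it changes by a bounded amount per added point.  Hence it suffices to control it at a
  single, very large \<open>N\<^sub>i\<close> for each \<open>i\<close>, and any body extremely close to one with the right value at
  \<open>N\<^sub>i\<close> still has it.  Near every convex body there are, on the one hand, polygons whose slopes are so
  badly approximable at the scale of a square grid of \<open>N = h\<^sup>6\<close> points that the grid has discrepancy
  \<open>O(h)\<close>, giving \<open>O(N\<^sup>1\<^sup>/\<^sup>3)\<close>; on the other hand, there are bodies with an inner and an outer tangent
  ball at each boundary point, for which Fourier analysis in the manner of Cassels and Montgomery gives
  \<open>c N\<^sup>1\<^sup>/\<^sup>2\<close> from below.  Interpolating continuously between the two realizes \<open>N\<^sub>i\<close> raised to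
  \<open>\<alpha>\<^sub>i\<close> exactly.  Iterating with rapidly decreasing changes of area yields a decreasing sequence of
  bodies, whose intersection is \<open>C\<close>.\<close>

section \<open>Counting functions on the torus\<close>

text \<open>The obstacle is the order of quantifiers. The lower-bound constant of a round body
  depends on the radii of its tangent balls, which degenerate as the body approaches a polygon,
  while the grid-friendly polygon changes with \<open>h\<close>, its slopes being tuned to N = h^6.
  So the round body \<open>B\<close> is fixed before \<open>h\<close>, the directions of the polygon
  come from a net whose fineness \<open>b\<close> does not depend on \<open>h\<close>, and only then
  is \<open>h\<close> taken large: the polygon gives O(h^2), the round body at least a constant
  times h^3, and h^(6\<alpha>) lies between because 2 < 6\<alpha> < 3. The polygon is kept inside
  \<open>B\<close>, so that the bodies between them are nested and the area estimate applies. A ball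
  of radius 4 survives all steps. It gives width at least 8 in every direction, which ensures that,
  for each frequency, a fixed proportion of the dilation factors \<delta> yields a Fourier
  coefficient of the full expected size; this is where the averaging over \<delta> is used. The
  estimate for a change of area loses a factor N^2, which is harmless because the later losses of
  area are chosen after N.\<close>

definition int_vec :: "int \<times> int \<Rightarrow> real \<times> real" where
  "int_vec m = (of_int (fst m), of_int (snd m))"

abbreviation unit_sq :: "(real \<times> real) set" where
  "unit_sq \<equiv> {0..<1} \<times> {0..<1}"

definition int_box :: "nat \<Rightarrow> (int \<times> int) set" where
  "int_box K = {- int K..int K} \<times> {- int K..int K}"

text \<open>All dilates with factor in [0,1] are collected in one set of pairs (\<delta>, z). It is
  compact for compact \<open>C\<close>, so the counting function is jointly Borel in \<delta> and
  \<tau>, as the outer integral requires.\<close>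

definition dilates :: "(real \<times> real) set \<Rightarrow> (real \<times> real \<times> real) set" where
  "dilates C = (\<lambda>(\<delta>, c). (\<delta>, \<delta> *\<^sub>R c)) ` ({0..1} \<times> C)"

text \<open>The sum over all integer translates is cut to a box fixed by \<open>K\<close> alone. For
  a body in the ball of radius \<open>K\<close> and for p, \<tau> in the unit square nothing is
  lost, and a finite sum makes measurability and bounds immediate.\<close>

definition lcount :: "nat \<Rightarrow> (real \<times> real) set \<Rightarrow> real \<Rightarrow> real \<times> real \<Rightarrow> real \<times> real \<Rightarrow> real" where
  "lcount K C \<delta> p \<tau> = (\<Sum>m\<in>int_box (K + 1). indicator (dilates C) (\<delta>, p + int_vec m - \<tau>))"

text \<open>For such bodies and points, and \<delta> in [0,1], this is the discrepancy of \<tau> +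
  \<delta> C. The area is entered as \<delta>^2 |C|, which is visibly measurable in
  \<delta>.\<close>

definition disc :: "nat \<Rightarrow> (real \<times> real) set \<Rightarrow> (real \<times> real) set \<Rightarrow> real \<Rightarrow> real \<times> real \<Rightarrow> real" where
  "disc K P C \<delta> \<tau> = (\<Sum>p\<in>P. lcount K C \<delta> p \<tau>) - real (card P) * (\<delta>\<^sup>2 * measure lborel C)"

definition sq_disc :: "nat \<Rightarrow> (real \<times> real) set \<Rightarrow> (real \<times> real) set \<Rightarrow> real \<Rightarrow> real" where
  "sq_disc K P C \<delta> = (LINT \<tau>:unit_sq|lborel. (disc K P C \<delta> \<tau>)\<^sup>2)"

lemma int_vec_simps [simp]:
  "fst (int_vec m) = of_int (fst m)" "snd (int_vec m) = of_int (snd m)"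
  by (simp_all add: int_vec_def)

lemma inj_int_vec: "inj int_vec"
  by (auto simp: inj_def int_vec_def prod_eq_iff)

lemma finite_int_box [simp]: "finite (int_box K)"
  by (simp add: int_box_def)

lemma card_int_box: "card (int_box K) = (2 * K + 1)\<^sup>2"
proof -
  have "nat (2 * int K + 1) = 2 * K + 1" by simp
  then show ?thesis
    by (simp add: int_box_def card_cartesian_product power2_eq_square)
qed

lemma unit_sq_borel [measurable]: "unit_sq \<in> sets borel"
  by (intro borel_Times) auto

lemma lborel2_prod: "(lborel :: (real \<times> real) measure) = lborel \<Otimes>\<^sub>M lborel"
  by (rule lborel_prod[symmetric])

lemma emeasure_unit_sq: "emeasure lborel unit_sq = 1"
  by (simp add: lborel2_prod lborel.emeasure_pair_measure_Times)

lemma measure_unit_sq: "measure lborel unit_sq = 1"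
  by (simp add: measure_def emeasure_unit_sq)

lemma dilates_iff: "0 \<le> \<delta> \<Longrightarrow> \<delta> \<le> 1 \<Longrightarrow> (\<delta>, z) \<in> dilates C \<longleftrightarrow> z \<in> (*\<^sub>R) \<delta> ` C"
  by (auto simp: dilates_def)

lemma compact_dilates: "compact C \<Longrightarrow> compact (dilates C)"
  unfolding dilates_def
  by (intro compact_continuous_image compact_Times)
    (auto simp: case_prod_unfold intro!: continuous_intros)

lemma dilates_mono: "C \<subseteq> C' \<Longrightarrow> dilates C \<subseteq> dilates C'"
  unfolding dilates_def by (intro image_mono Sigma_mono) auto

lemma lcount_measurable:
  assumes "compact C"
  shows "(\<lambda>x. lcount K C (fst x) p (snd x)) \<in> borel_measurable borel"
proof -
  have [measurable]: "dilates C \<in> sets borel"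
    using assms compact_dilates by (simp add: compact_imp_closed)
  have "(\<lambda>x::real \<times> real \<times> real. (fst x, p + int_vec m - snd x)) \<in> borel \<rightarrow>\<^sub>M borel" for m
    by (intro borel_measurable_continuous_onI continuous_intros)
  then have "(\<lambda>x. indicat_real (dilates C) (fst x, p + int_vec m - snd x)) \<in> borel_measurable borel" for m
    by (rule measurable_compose) simp
  then show ?thesis
    unfolding lcount_def by (intro borel_measurable_sum)
qed

lemma disc_measurable:
  assumes "compact C"
  shows "(\<lambda>x. disc K P C (fst x) (snd x)) \<in> borel_measurable borel"
  unfolding disc_def
  by (intro borel_measurable_diff borel_measurable_sum lcount_measurable assms
      borel_measurable_continuous_onI continuous_intros)

lemma disc_measurable_snd:
  assumes "compact C"
  shows "disc K P C \<delta> \<in> borel_measurable borel"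
proof -
  have "(\<lambda>\<tau>. (\<delta>, \<tau>)) \<in> borel \<rightarrow>\<^sub>M (borel :: (real \<times> real \<times> real) measure)"
    by (intro borel_measurable_continuous_onI continuous_intros)
  from measurable_compose[OF this disc_measurable[OF assms, of K P]] show ?thesis
    by simp
qed

lemma lcount_measurable_snd:
  assumes "compact C"
  shows "lcount K C \<delta> p \<in> borel_measurable borel"
proof -
  have "(\<lambda>\<tau>. (\<delta>, \<tau>)) \<in> borel \<rightarrow>\<^sub>M (borel :: (real \<times> real \<times> real) measure)"
    by (intro borel_measurable_continuous_onI continuous_intros)
  from measurable_compose[OF this lcount_measurable[OF assms, of K p]] show ?thesis
    by simp
qed

text \<open>The coordinates of p - \<tau> are below 1 and those of \<delta> c at most
  \<open>K\<close> in absolute value, so those of m stay below \<open>K + 1\<close>.\<close>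

lemma int_box_sufficient:
  assumes C: "C \<subseteq> cball 0 (real K)" and \<delta>: "0 \<le> \<delta>" "\<delta> \<le> 1"
    and p: "p \<in> unit_sq" and t: "\<tau> \<in> unit_sq" and m: "p + int_vec m - \<tau> \<in> (*\<^sub>R) \<delta> ` C"
  shows "m \<in> int_box (K + 1)"
proof -
  obtain c where c: "c \<in> C" "p + int_vec m - \<tau> = \<delta> *\<^sub>R c" using m by auto
  have nc: "norm c \<le> real K" using C c by auto
  have "norm (\<delta> *\<^sub>R c) \<le> 1 * real K"
    unfolding norm_scaleR using \<delta> nc by (intro mult_mono) auto
  then have n: "norm (p + int_vec m - \<tau>) \<le> real K" using c by simp
  have "\<bar>fst (p + int_vec m - \<tau>)\<bar> \<le> real K"
    using norm_fst_le[of "fst (p + int_vec m - \<tau>)" "snd (p + int_vec m - \<tau>)"] n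
    by (simp only: prod.collapse real_norm_def)
  moreover have "\<bar>snd (p + int_vec m - \<tau>)\<bar> \<le> real K"
    using norm_snd_le[of "snd (p + int_vec m - \<tau>)" "fst (p + int_vec m - \<tau>)"] n
    by (simp only: prod.collapse real_norm_def)
  ultimately have "\<bar>real_of_int (fst m)\<bar> < real K + 1 \<and> \<bar>real_of_int (snd m)\<bar> < real K + 1"
    using p t by (auto simp: mem_Times_iff)
  then have "\<bar>fst m\<bar> \<le> int K + 1" "\<bar>snd m\<bar> \<le> int K + 1" by linarith+
  then show ?thesis by (auto simp: int_box_def mem_Times_iff)
qed

lemma lattice_count_eq:
  assumes C: "C \<subseteq> cball 0 (real K)" and \<delta>: "0 \<le> \<delta>" "\<delta> \<le> 1"
    and p: "p \<in> unit_sq" and t: "\<tau> \<in> unit_sq"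
  shows "real (lattice_count p (homothetic_copy \<tau> \<delta> C)) = lcount K C \<delta> p \<tau>"
proof -
  have *: "p + (of_int (fst mn), of_int (snd mn)) \<in> homothetic_copy \<tau> \<delta> C
      \<longleftrightarrow> p + int_vec mn - \<tau> \<in> (*\<^sub>R) \<delta> ` C" for mn
    unfolding homothetic_copy_def int_vec_def by (auto simp: image_iff algebra_simps)
  have "{mn. p + (of_int (fst mn), of_int (snd mn)) \<in> homothetic_copy \<tau> \<delta> C}
     = {m \<in> int_box (K + 1). (\<delta>, p + int_vec m - \<tau>) \<in> dilates C}"
    unfolding * using int_box_sufficient[OF C \<delta> p t] dilates_iff[OF \<delta>] by blast
  then show ?thesis
    unfolding lattice_count_def lcount_def indicator_def of_bool_def
    by (simp add: sum.If_cases Int_def)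
qed

lemma measure_dilate:
  assumes "compact (C :: (real \<times> real) set)"
  shows "measure lborel ((*\<^sub>R) \<delta> ` C) = \<delta>\<^sup>2 * measure lborel C"
proof -
  have [measurable]: "C \<in> sets borel" "(*\<^sub>R) \<delta> ` C \<in> sets borel"
    using assms by (auto intro!: borel_closed compact_imp_closed compact_scaling)
  show ?thesis
    using measure_lebesgue_affine[of \<delta> 0 C] by (simp add: measure_completion power2_eq_square)
qed

lemma measure_homothetic:
  assumes "compact C"
  shows "measure lborel (homothetic_copy \<tau> \<delta> C) = \<delta>\<^sup>2 * measure lborel C"
proof -
  have "compact ((\<lambda>x. \<delta> *\<^sub>R x + \<tau>) ` C)"
    using compact_affinity[of C \<tau> \<delta>] assms by (simp add: add.commute)
  then have [measurable]: "C \<in> sets borel" "(\<lambda>x. \<delta> *\<^sub>R x + \<tau>) ` C \<in> sets borel"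
    using assms by (auto intro!: borel_closed compact_imp_closed)
  show ?thesis
    using measure_lebesgue_affine[of \<delta> \<tau> C]
    by (simp add: measure_completion power2_eq_square homothetic_copy_def add.commute[of \<tau>])
qed

lemma discrepancy_eq_disc:
  assumes C: "compact C" "C \<subseteq> cball 0 (real K)" and \<delta>: "0 \<le> \<delta>" "\<delta> \<le> 1"
    and P: "P \<subseteq> unit_sq" and t: "\<tau> \<in> unit_sq"
  shows "discrepancy P (homothetic_copy \<tau> \<delta> C) = disc K P C \<delta> \<tau>"
proof -
  have "(\<Sum>p\<in>P. real (lattice_count p (homothetic_copy \<tau> \<delta> C))) = (\<Sum>p\<in>P. lcount K C \<delta> p \<tau>)"
    by (intro sum.cong refl lattice_count_eq C \<delta> t) (use P in auto)
  then show ?thesis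
    unfolding discrepancy_def disc_def by (simp add: measure_homothetic C)
qed

lemma quad_discrepancy_eq:
  assumes C: "compact C" "C \<subseteq> cball 0 (real K)" and P: "P \<subseteq> unit_sq"
  shows "quad_discrepancy P C = (LINT \<delta>:{0..1}|lborel. sq_disc K P C \<delta>)"
proof -
  have "(LINT \<tau>:unit_sq|lborel. (discrepancy P (homothetic_copy \<tau> \<delta> C))\<^sup>2) = sq_disc K P C \<delta>"
    if "\<delta> \<in> {0..1}" for \<delta>
    unfolding sq_disc_def
    by (rule set_lebesgue_integral_cong) (use that discrepancy_eq_disc[OF C _ _ P] in \<open>auto simp: unit_sq_borel\<close>)
  then show ?thesis
    unfolding quad_discrepancy_def by (intro set_lebesgue_integral_cong) auto
qed

section \<open>Uniform bounds and integrability\<close>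

definition count_bound :: "nat \<Rightarrow> real" where
  "count_bound K = (2 * real K + 3)\<^sup>2"

lemma lcount_bounds: "0 \<le> lcount K C \<delta> p \<tau>" "lcount K C \<delta> p \<tau> \<le> count_bound K"
proof -
  show "0 \<le> lcount K C \<delta> p \<tau>" unfolding lcount_def by (intro sum_nonneg) auto
  have "lcount K C \<delta> p \<tau> \<le> (\<Sum>m\<in>int_box (K + 1). 1)"
    unfolding lcount_def by (intro sum_mono) (auto simp: indicator_def)
  also have "\<dots> = count_bound K" by (simp add: card_int_box count_bound_def)
  finally show "lcount K C \<delta> p \<tau> \<le> count_bound K" .
qed

lemma measure_le_count_bound:
  assumes "compact (C :: (real \<times> real) set)" "C \<subseteq> cball 0 (real K)"
  shows "measure lborel C \<le> count_bound K"
proof -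
  let ?I = "{- real K..real K}"
  have "C \<subseteq> ?I \<times> ?I"
  proof
    fix c assume "c \<in> C"
    then have "norm c \<le> real K" using assms by auto
    then show "c \<in> ?I \<times> ?I"
      using norm_fst_le[of "fst c" "snd c"] norm_snd_le[of "snd c" "fst c"]
      by (auto simp: mem_Times_iff)
  qed
  moreover have "emeasure lborel (?I \<times> ?I) = ennreal (2 * real K) * ennreal (2 * real K)"
    by (simp add: lborel2_prod lborel.emeasure_pair_measure_Times)
  moreover have "?I \<times> ?I \<in> sets borel" by (intro borel_Times) auto
  ultimately have "measure lborel C \<le> measure lborel (?I \<times> ?I)"
    using assms by (intro measure_mono_fmeasurable fmeasurableI)
      (auto intro!: borel_closed compact_imp_closed simp: ennreal_mult_less_top)
  also have "\<dots> = (2 * real K) * (2 * real K)"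
    using \<open>emeasure lborel (?I \<times> ?I) = _\<close> by (simp add: measure_def enn2real_mult)
  also have "\<dots> \<le> count_bound K"
    unfolding count_bound_def power2_eq_square by (intro mult_mono) auto
  finally show ?thesis .
qed

lemma count_bound_ge_1: "1 \<le> count_bound K"
  unfolding count_bound_def by (simp add: power2_eq_square algebra_simps)

text \<open>Both terms lie between 0 and N times \<open>count_bound K\<close>: this is the number of
  lattice vectors in the box of \<open>lcount\<close>, and it also exceeds the area (2K)^2 of a
  square containing \<open>C\<close>.\<close>

lemma disc_bound:
  assumes C: "compact C" "C \<subseteq> cball 0 (real K)" and \<delta>: "0 \<le> \<delta>" "\<delta> \<le> 1"
  shows "\<bar>disc K P C \<delta> \<tau>\<bar> \<le> real (card P) * count_bound K"
proof -
  have "(\<Sum>p\<in>P. lcount K C \<delta> p \<tau>) \<le> real (card P) * count_bound K"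
    using sum_bounded_above[of P "\<lambda>p. lcount K C \<delta> p \<tau>" "count_bound K"] lcount_bounds(2) by auto
  moreover have "0 \<le> (\<Sum>p\<in>P. lcount K C \<delta> p \<tau>)"
    by (intro sum_nonneg lcount_bounds)
  moreover have "\<delta>\<^sup>2 * measure lborel C \<le> 1 * count_bound K"
    using \<delta> measure_le_count_bound[OF C] by (intro mult_mono) (auto simp: power_le_one)
  then have "real (card P) * (\<delta>\<^sup>2 * measure lborel C) \<le> real (card P) * count_bound K"
    by (intro mult_left_mono) auto
  moreover have "0 \<le> real (card P) * (\<delta>\<^sup>2 * measure lborel C)"
    by (intro mult_nonneg_nonneg) auto
  ultimately show ?thesis unfolding disc_def by linarith
qed

lemma set_integrable_bounded:
  fixes f :: "'a \<Rightarrow> 'b::{banach, second_countable_topology}"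
  assumes f: "f \<in> borel_measurable M" and A: "A \<in> sets M" "emeasure M A < \<infinity>"
    and b: "\<And>x. x \<in> A \<Longrightarrow> norm (f x) \<le> B"
  shows "set_integrable M A f"
  unfolding set_integrable_def
proof (rule Bochner_Integration.integrable_bound)
  show "integrable M (\<lambda>x. indicat_real A x *\<^sub>R \<bar>B\<bar>)"
    using A by (intro integrable_scaleR_left integrable_real_indicator) auto
  show "(\<lambda>x. indicat_real A x *\<^sub>R f x) \<in> borel_measurable M"
    using f A by measurable
  show "AE x in M. norm (indicat_real A x *\<^sub>R f x) \<le> norm (indicat_real A x *\<^sub>R \<bar>B\<bar>)"
    using b by (fastforce simp: indicator_def)
qed

lemma unit_sq_integrable:
  fixes f :: "real \<times> real \<Rightarrow> 'b::{banach, second_countable_topology}"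
  assumes "f \<in> borel_measurable borel" "\<And>x. x \<in> unit_sq \<Longrightarrow> norm (f x) \<le> B"
  shows "set_integrable lborel unit_sq f"
  by (rule set_integrable_bounded[where B = B])
    (use assms emeasure_unit_sq unit_sq_borel in auto)

lemma sq_disc_inner_integrable:
  assumes C: "compact C" "C \<subseteq> cball 0 (real K)" and \<delta>: "0 \<le> \<delta>" "\<delta> \<le> 1"
  shows "set_integrable lborel unit_sq (\<lambda>\<tau>. (disc K P C \<delta> \<tau>)\<^sup>2)"
proof (rule unit_sq_integrable)
  show "(\<lambda>\<tau>. (disc K P C \<delta> \<tau>)\<^sup>2) \<in> borel_measurable borel"
    by (intro borel_measurable_power disc_measurable_snd C)
  show "norm ((disc K P C \<delta> \<tau>)\<^sup>2) \<le> (real (card P) * count_bound K)\<^sup>2" for \<tau>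
    using disc_bound[OF C \<delta>, of P \<tau>] by (simp add: abs_le_square_iff[symmetric])
qed

lemma unit_sq_integral_const: "(LINT \<tau>:unit_sq|lborel. (c::real)) = c"
  unfolding set_lebesgue_integral_def using measure_unit_sq emeasure_unit_sq by simp

lemma sq_disc_bounds:
  assumes C: "compact C" "C \<subseteq> cball 0 (real K)" and \<delta>: "0 \<le> \<delta>" "\<delta> \<le> 1"
  shows "0 \<le> sq_disc K P C \<delta>" "sq_disc K P C \<delta> \<le> (real (card P) * count_bound K)\<^sup>2"
proof -
  show "0 \<le> sq_disc K P C \<delta>"
    unfolding sq_disc_def set_lebesgue_integral_def by (intro integral_nonneg_AE) auto
  have "sq_disc K P C \<delta> \<le> (LINT \<tau>:unit_sq|lborel. (real (card P) * count_bound K)\<^sup>2)"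
    unfolding sq_disc_def
  proof (rule set_integral_mono)
    show "set_integrable lborel unit_sq (\<lambda>\<tau>. (real (card P) * count_bound K)\<^sup>2)"
      by (rule unit_sq_integrable) auto
    show "(disc K P C \<delta> \<tau>)\<^sup>2 \<le> (real (card P) * count_bound K)\<^sup>2" for \<tau>
      using disc_bound[OF C \<delta>, of P \<tau>] by (simp add: abs_le_square_iff[symmetric])
  qed (rule sq_disc_inner_integrable[OF C \<delta>])
  then show "sq_disc K P C \<delta> \<le> (real (card P) * count_bound K)\<^sup>2"
    by (simp only: unit_sq_integral_const)
qed

lemma sq_disc_integrable:
  assumes C: "compact C" "C \<subseteq> cball 0 (real K)"
  shows "set_integrable lborel {0..1} (sq_disc K P C)"
proof (rule set_integrable_bounded)
  have "(\<lambda>x. (disc K P C (fst x) (snd x))\<^sup>2) \<in> borel_measurable borel"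
    by (intro borel_measurable_power disc_measurable C)
  then have [measurable]: "(\<lambda>(\<delta>, \<tau>). (disc K P C \<delta> \<tau>)\<^sup>2) \<in> borel_measurable (lborel \<Otimes>\<^sub>M lborel)"
    by (simp add: lborel_prod case_prod_unfold)
  have [measurable]: "unit_sq \<in> sets lborel" using unit_sq_borel by simp
  show "sq_disc K P C \<in> borel_measurable lborel"
    unfolding sq_disc_def set_lebesgue_integral_def by measurable
  show "norm (sq_disc K P C \<delta>) \<le> (real (card P) * count_bound K)\<^sup>2" if "\<delta> \<in> {0..1}" for \<delta>
    using sq_disc_bounds[OF C] that by auto
qed auto

lemma quad_discrepancy_nonneg: "0 \<le> quad_discrepancy P C"
  unfolding quad_discrepancy_def set_lebesgue_integral_def
  by (intro integral_nonneg_AE) (auto intro!: integral_nonneg_AE)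

text \<open>The pointwise bound is asked for \<delta> > 0 only: at \<delta> = 0 the body collapses
  to a point and the rescaling used for polygons breaks down, but a single \<delta> is a null
  set.\<close>

lemma quad_discrepancy_upper:
  assumes C: "compact C" "C \<subseteq> cball 0 (real K)" and P: "P \<subseteq> unit_sq"
    and b: "\<And>\<delta> \<tau>. 0 < \<delta> \<Longrightarrow> \<delta> \<le> 1 \<Longrightarrow> \<tau> \<in> unit_sq \<Longrightarrow> \<bar>discrepancy P (homothetic_copy \<tau> \<delta> C)\<bar> \<le> B"
  shows "quad_discrepancy P C \<le> B\<^sup>2"
proof -
  have "sq_disc K P C \<delta> \<le> B\<^sup>2" if \<delta>: "0 < \<delta>" "\<delta> \<le> 1" for \<delta>
  proof -
    have "sq_disc K P C \<delta> \<le> (LINT \<tau>:unit_sq|lborel. B\<^sup>2)"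
      unfolding sq_disc_def
    proof (rule set_integral_mono)
      show "set_integrable lborel unit_sq (\<lambda>\<tau>. B\<^sup>2)"
        by (rule unit_sq_integrable) auto
      show "(disc K P C \<delta> \<tau>)\<^sup>2 \<le> B\<^sup>2" if "\<tau> \<in> unit_sq" for \<tau>
        using b[OF \<delta> that] discrepancy_eq_disc[OF C _ _ P that, of \<delta>] \<delta>
        by (simp add: abs_le_square_iff[symmetric])
    qed (use sq_disc_inner_integrable[OF C, of \<delta>] \<delta> in auto)
    then show ?thesis by (simp only: unit_sq_integral_const)
  qed
  then have le: "indicat_real {0..1} \<delta> *\<^sub>R sq_disc K P C \<delta> \<le> indicat_real {0..1} \<delta> *\<^sub>R B\<^sup>2" if "\<delta> \<noteq> 0" for \<delta>
    using that by (cases "\<delta> \<in> {0..1}") auto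
  have "AE \<delta> in lborel. (\<delta>::real) \<noteq> 0" by (rule AE_lborel_singleton)
  then have "AE \<delta> in lborel. indicat_real {0..1} \<delta> *\<^sub>R sq_disc K P C \<delta> \<le> indicat_real {0..1} \<delta> *\<^sub>R B\<^sup>2"
    by (rule AE_mp) (intro AE_I2 impI le)
  then have "(LINT \<delta>:{0..1}|lborel. sq_disc K P C \<delta>) \<le> (LINT \<delta>:{0..1::real}|lborel. B\<^sup>2)"
    using sq_disc_integrable[OF C, of P] unfolding set_integrable_def set_lebesgue_integral_def
    by (intro integral_mono_AE) auto
  also have "\<dots> = B\<^sup>2" by (simp add: set_lebesgue_integral_def)
  finally show ?thesis using quad_discrepancy_eq[OF C P] by simp
qed

section \<open>Unfolding integrals over the torus\<close>

lemma integral_isometry_affine: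
  fixes f :: "real \<times> real \<Rightarrow> 'b::{banach, second_countable_topology}"
  assumes f: "f \<in> borel_measurable borel" and c: "\<bar>c\<bar> = 1"
  shows "(\<integral>x. f (t + c *\<^sub>R x) \<partial>lborel) = integral\<^sup>L lborel f"
    and "integrable lborel f \<Longrightarrow> integrable lborel (\<lambda>x. f (t + c *\<^sub>R x))"
proof -
  have m: "(\<lambda>x. t + c *\<^sub>R x) \<in> borel \<rightarrow>\<^sub>M borel"
    by (intro borel_measurable_continuous_onI continuous_intros)
  have "c \<noteq> 0" using c by auto
  then have eq: "(lborel :: (real \<times> real) measure) = distr lborel borel (\<lambda>x. t + c *\<^sub>R x)"
    using lborel_affine[of c t] c by (simp add: density_1)
  show "(\<integral>x. f (t + c *\<^sub>R x) \<partial>lborel) = integral\<^sup>L lborel f"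
    by (subst (2) eq) (use f m in \<open>simp add: integral_distr\<close>)
  assume "integrable lborel f"
  then have "integrable (distr lborel borel (\<lambda>x. t + c *\<^sub>R x)) f"
    using eq by simp
  then show "integrable lborel (\<lambda>x. f (t + c *\<^sub>R x))"
    using f m by (simp add: integrable_distr_eq)
qed

lemma int_translate_unit_sq:
  "z + int_vec m \<in> unit_sq \<longleftrightarrow> m = (- \<lfloor>fst z\<rfloor>, - \<lfloor>snd z\<rfloor>)"
  by (cases m; cases z) (simp add: int_vec_def; linarith)

text \<open>Integer translates of the unit square tile the plane, so summing over translates and
  integrating over one cell gives the integral over the plane. Banach-valued functions are allowed
  because the lemma serves both the indicator of a body and its complex exponential weights.\<close>

lemma unfold_integral:
  fixes f :: "real \<times> real \<Rightarrow> 'b::{banach, second_countable_topology}"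
  assumes f: "integrable lborel f" and s: "\<And>z. f z \<noteq> 0 \<Longrightarrow> norm z \<le> real K" and p: "p \<in> unit_sq"
  shows "(LINT \<tau>:unit_sq|lborel. (\<Sum>m\<in>int_box (K + 1). f (p + int_vec m - \<tau>))) = integral\<^sup>L lborel f"
proof -
  have fm: "f \<in> borel_measurable borel" using borel_measurable_integrable[OF f] by simp
  define g where "g z = f (p - z)" for z
  have gm: "g \<in> borel_measurable borel"
    unfolding g_def
    by (rule measurable_compose[OF _ fm]) (intro borel_measurable_continuous_onI continuous_intros)
  have gi: "integrable lborel g" and gI: "integral\<^sup>L lborel g = integral\<^sup>L lborel f"
    using integral_isometry_affine[OF fm, of "-1" p] f by (simp_all add: g_def[abs_def])
  have [measurable]: "unit_sq \<in> sets borel" by (rule unit_sq_borel)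
  \<comment> \<open>\<open>G m\<close> is \<open>g\<close> restricted to the cell that the
    translation by m carries onto the unit square; these cells partition the plane.\<close>
  define G where "G m z = indicat_real unit_sq (z + int_vec m) *\<^sub>R g z" for m z
  have "(\<lambda>z. indicat_real unit_sq (z + int_vec m)) \<in> borel_measurable borel" for m
    by measurable
  then have Gm: "G m \<in> borel_measurable borel" for m
    unfolding G_def using gm by (intro borel_measurable_scaleR)
  have Gi: "integrable lborel (G m)" for m
    by (rule Bochner_Integration.integrable_bound[OF gi])
      (use Gm in \<open>auto simp: G_def indicator_def\<close>)
  have eq: "indicat_real unit_sq \<tau> *\<^sub>R f (p + int_vec m - \<tau>) = G m (- int_vec m + 1 *\<^sub>R \<tau>)" for m \<tau>
    by (simp add: G_def g_def algebra_simps)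
  have si: "set_integrable lborel unit_sq (\<lambda>\<tau>. f (p + int_vec m - \<tau>))" for m
    unfolding set_integrable_def eq
    by (rule integral_isometry_affine(2)[OF Gm _ Gi]) simp
  have I: "(LINT \<tau>:unit_sq|lborel. f (p + int_vec m - \<tau>)) = integral\<^sup>L lborel (G m)" for m
    unfolding set_lebesgue_integral_def eq
    by (rule integral_isometry_affine(1)[OF Gm]) simp
  have sumG: "(\<Sum>m\<in>int_box (K + 1). G m z) = g z" for z
  proof (cases "g z = 0")
    case False
    define m where "m = (- \<lfloor>fst z\<rfloor>, - \<lfloor>snd z\<rfloor>)"
    have n: "norm (p - z) \<le> real K" using False s by (auto simp: g_def)
    have "\<bar>fst (p - z)\<bar> \<le> real K"
      using norm_fst_le[of "fst (p - z)" "snd (p - z)"] n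
      by (simp only: prod.collapse real_norm_def)
    moreover have "\<bar>snd (p - z)\<bar> \<le> real K"
      using norm_snd_le[of "snd (p - z)" "fst (p - z)"] n
      by (simp only: prod.collapse real_norm_def)
    \<comment> \<open>As p lies in the unit square, z may leave [-K, K] upwards by less than 1. This
      is the extra layer of \<open>int_box (K + 1)\<close>.\<close>
    ultimately have "- real K \<le> fst z" "fst z < real K + 1" "- real K \<le> snd z" "snd z < real K + 1"
      using p by (auto simp: mem_Times_iff)
    then have "- int K \<le> \<lfloor>fst z\<rfloor>" "\<lfloor>fst z\<rfloor> \<le> int K + 1" "- int K \<le> \<lfloor>snd z\<rfloor>" "\<lfloor>snd z\<rfloor> \<le> int K + 1"
      by (simp_all add: le_floor_iff floor_le_iff)
    then have mb: "m \<in> int_box (K + 1)" by (auto simp: m_def int_box_def)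
    have "G m' z = (if m' = m then g z else 0)" for m'
      by (simp add: G_def int_translate_unit_sq m_def indicator_def)
    then have "(\<Sum>m'\<in>int_box (K + 1). G m' z) = (\<Sum>m'\<in>int_box (K + 1). if m' = m then g z else 0)"
      by simp
    also have "\<dots> = g z" using mb by simp
    finally show ?thesis .
  qed (simp add: G_def)
  have "(LINT \<tau>:unit_sq|lborel. (\<Sum>m\<in>int_box (K + 1). f (p + int_vec m - \<tau>)))
      = (\<Sum>m\<in>int_box (K + 1). (LINT \<tau>:unit_sq|lborel. f (p + int_vec m - \<tau>)))"
    unfolding set_lebesgue_integral_def scaleR_sum_right
    by (rule Bochner_Integration.integral_sum) (use si in \<open>auto simp: set_integrable_def\<close>)
  also have "\<dots> = (\<integral>z. (\<Sum>m\<in>int_box (K + 1). G m z) \<partial>lborel)"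
    unfolding I by (rule Bochner_Integration.integral_sum[symmetric]) (rule Gi)
  also have "\<dots> = integral\<^sup>L lborel f" by (simp only: sumG gI)
  finally show "(LINT \<tau>:unit_sq|lborel. (\<Sum>m\<in>int_box (K + 1). f (p + int_vec m - \<tau>))) = integral\<^sup>L lborel f" .
qed

lemma compact_emeasure_finite: "compact (S :: (real \<times> real) set) \<Longrightarrow> emeasure lborel S < \<infinity>"
  using emeasure_bounded_finite compact_imp_bounded by blast

lemma dilate_norm_le:
  assumes C: "C \<subseteq> cball 0 (real K)" and \<delta>: "0 \<le> \<delta>" "\<delta> \<le> 1" and z: "z \<in> (*\<^sub>R) \<delta> ` C"
  shows "norm z \<le> real K"
proof -
  obtain c where c: "c \<in> C" "z = \<delta> *\<^sub>R c" using z by auto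
  have "\<delta> * norm c \<le> 1 * real K"
    using \<delta> C c by (intro mult_mono) auto
  then show ?thesis using c \<delta> by simp
qed

text \<open>Unfolding with the indicator of the dilate: the mean count over \<tau> is the area. So
  the area term in \<open>disc\<close> is exactly what makes its mean zero.\<close>

lemma lcount_integral:
  assumes C: "compact C" "C \<subseteq> cball 0 (real K)" and \<delta>: "0 \<le> \<delta>" "\<delta> \<le> 1" and p: "p \<in> unit_sq"
  shows "(LINT \<tau>:unit_sq|lborel. lcount K C \<delta> p \<tau>) = \<delta>\<^sup>2 * measure lborel C"
    and "set_integrable lborel unit_sq (lcount K C \<delta> p)"
proof -
  let ?S = "(*\<^sub>R) \<delta> ` C"
  have S: "compact ?S" using C by (simp add: compact_scaling)
  have "integrable lborel (indicat_real ?S)"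
    using S compact_emeasure_finite[OF S]
    by (intro integrable_real_indicator) (auto intro!: borel_closed compact_imp_closed)
  moreover have "norm z \<le> real K" if "indicat_real ?S z \<noteq> 0" for z
    using that dilate_norm_le[OF C(2) \<delta>] by (auto simp: indicator_def split: if_splits)
  moreover have "lcount K C \<delta> p \<tau> = (\<Sum>m\<in>int_box (K + 1). indicat_real ?S (p + int_vec m - \<tau>))" for \<tau>
    unfolding lcount_def by (intro sum.cong) (auto simp: indicator_def dilates_iff \<delta>)
  ultimately show "(LINT \<tau>:unit_sq|lborel. lcount K C \<delta> p \<tau>) = \<delta>\<^sup>2 * measure lborel C"
    using unfold_integral[of "indicat_real ?S" K p] p measure_dilate[OF C(1)] S
    by (simp add: borel_closed compact_imp_closed)
  show "set_integrable lborel unit_sq (lcount K C \<delta> p)"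
    by (rule unit_sq_integrable[where B = "count_bound K"])
      (use lcount_measurable_snd[OF C(1)] lcount_bounds in auto)
qed

section \<open>Dependence of the discrepancy on the body\<close>

lemma lcount_mono: "C \<subseteq> C' \<Longrightarrow> lcount K C \<delta> p \<tau> \<le> lcount K C' \<delta> p \<tau>"
  unfolding lcount_def by (intro sum_mono) (use dilates_mono in \<open>auto simp: indicator_def\<close>)

lemma unit_sq_integral_sum:
  assumes "\<And>p. p \<in> P \<Longrightarrow> set_integrable lborel unit_sq (f p :: real \<times> real \<Rightarrow> real)"
  shows "(LINT \<tau>:unit_sq|lborel. (\<Sum>p\<in>P. f p \<tau>)) = (\<Sum>p\<in>P. (LINT \<tau>:unit_sq|lborel. f p \<tau>))"
    and "set_integrable lborel unit_sq (\<lambda>\<tau>. \<Sum>p\<in>P. f p \<tau>)"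
  using assms unfolding set_lebesgue_integral_def set_integrable_def scaleR_sum_right
  by (auto intro!: Bochner_Integration.integral_sum Bochner_Integration.integrable_sum)

text \<open>For nested bodies the difference of the counts is nonnegative, so its L1 norm equals its
  mean, at most N times the difference of areas. The area terms contribute the same once more,
  whence the factor 2.\<close>

lemma disc_diff_L1:
  assumes C: "compact C" "C \<subseteq> cball 0 (real K)" and C': "compact C'" "C' \<subseteq> cball 0 (real K)"
    and CC': "C \<subseteq> C'" and \<delta>: "0 \<le> \<delta>" "\<delta> \<le> 1" and P: "P \<subseteq> unit_sq"
  shows "(LINT \<tau>:unit_sq|lborel. \<bar>disc K P C' \<delta> \<tau> - disc K P C \<delta> \<tau>\<bar>)
    \<le> 2 * real (card P) * (measure lborel C' - measure lborel C)"
proof -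
  let ?a = "\<delta>\<^sup>2 * (measure lborel C' - measure lborel C)"
  have mono: "measure lborel C \<le> measure lborel C'"
    using C C' CC' compact_emeasure_finite[OF C'(1)]
    by (intro measure_mono_fmeasurable fmeasurableI) (auto intro!: borel_closed compact_imp_closed)
  then have a: "0 \<le> ?a" "?a \<le> measure lborel C' - measure lborel C"
    using \<delta> by (auto intro!: mult_left_le_one_le simp: power_le_one)
  define f where "f p \<tau> = lcount K C' \<delta> p \<tau> - lcount K C \<delta> p \<tau>" for p \<tau>
  have fi: "set_integrable lborel unit_sq (f p)" if "p \<in> P" for p
    unfolding f_def using lcount_integral(2)[OF C \<delta>] lcount_integral(2)[OF C' \<delta>] that P
    by (intro set_integral_diff) auto
  have fI: "(LINT \<tau>:unit_sq|lborel. f p \<tau>) = ?a" if "p \<in> P" for p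
    unfolding f_def
    using set_integral_diff(2)[OF lcount_integral(2)[OF C' \<delta>] lcount_integral(2)[OF C \<delta>], of p p]
      lcount_integral(1)[OF C \<delta>, of p] lcount_integral(1)[OF C' \<delta>, of p] that P
    by (auto simp: algebra_simps)
  have f0: "0 \<le> f p \<tau>" for p \<tau> unfolding f_def using lcount_mono[OF CC'] by simp
  have ci: "set_integrable lborel unit_sq (\<lambda>\<tau>. real (card P) * ?a)"
    by (rule unit_sq_integrable[where B = "\<bar>real (card P) * ?a\<bar>"]) auto
  note Fi = unit_sq_integral_sum[of P f, OF fi]
  have "(LINT \<tau>:unit_sq|lborel. \<bar>disc K P C' \<delta> \<tau> - disc K P C \<delta> \<tau>\<bar>)
     \<le> (LINT \<tau>:unit_sq|lborel. (\<Sum>p\<in>P. f p \<tau>) + real (card P) * ?a)"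
  proof (rule set_integral_mono)
    show "set_integrable lborel unit_sq (\<lambda>\<tau>. \<bar>disc K P C' \<delta> \<tau> - disc K P C \<delta> \<tau>\<bar>)"
    proof (rule unit_sq_integrable)
      show "(\<lambda>\<tau>. \<bar>disc K P C' \<delta> \<tau> - disc K P C \<delta> \<tau>\<bar>) \<in> borel_measurable borel"
        by (intro borel_measurable_abs borel_measurable_diff disc_measurable_snd C C')
      show "norm \<bar>disc K P C' \<delta> \<tau> - disc K P C \<delta> \<tau>\<bar> \<le> 2 * (real (card P) * count_bound K)" for \<tau>
        using disc_bound[OF C \<delta>, of P \<tau>] disc_bound[OF C' \<delta>, of P \<tau>] by simp
    qed
    show "set_integrable lborel unit_sq (\<lambda>\<tau>. (\<Sum>p\<in>P. f p \<tau>) + real (card P) * ?a)"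
      by (intro set_integral_add Fi ci)
    fix \<tau>
    have "disc K P C' \<delta> \<tau> - disc K P C \<delta> \<tau> = (\<Sum>p\<in>P. f p \<tau>) - real (card P) * ?a"
      by (simp add: disc_def f_def sum_subtractf algebra_simps)
    moreover have "0 \<le> (\<Sum>p\<in>P. f p \<tau>)" by (intro sum_nonneg f0)
    moreover have "0 \<le> real (card P) * ?a" using a by (intro mult_nonneg_nonneg) auto
    ultimately show "\<bar>disc K P C' \<delta> \<tau> - disc K P C \<delta> \<tau>\<bar> \<le> (\<Sum>p\<in>P. f p \<tau>) + real (card P) * ?a"
      by linarith
  qed
  also have "\<dots> = real (card P) * ?a + real (card P) * ?a"
    by (simp only: set_integral_add(2)[OF Fi(2) ci] Fi(1) unit_sq_integral_const)
      (simp add: fI)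
  also have "\<dots> \<le> 2 * real (card P) * (measure lborel C' - measure lborel C)"
    using mult_left_mono[OF a(2), of "real (card P)"] by simp
  finally show ?thesis .
qed

text \<open>x^2 - y^2 = (x + y)(x - y), with the first factor bounded by 2 N
  \<open>count_bound K\<close> and the second estimated in L1.\<close>

lemma sq_disc_diff:
  assumes C: "compact C" "C \<subseteq> cball 0 (real K)" and C': "compact C'" "C' \<subseteq> cball 0 (real K)"
    and CC': "C \<subseteq> C'" and \<delta>: "0 \<le> \<delta>" "\<delta> \<le> 1" and P: "P \<subseteq> unit_sq"
  shows "\<bar>sq_disc K P C' \<delta> - sq_disc K P C \<delta>\<bar>
    \<le> 4 * (real (card P))\<^sup>2 * count_bound K * (measure lborel C' - measure lborel C)"
proof -
  let ?B = "2 * (real (card P) * count_bound K)"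
  let ?d = "\<lambda>\<tau>. \<bar>disc K P C' \<delta> \<tau> - disc K P C \<delta> \<tau>\<bar>"
  have B0: "0 \<le> ?B" using count_bound_ge_1[of K] by simp
  have di: "set_integrable lborel unit_sq ?d"
  proof (rule unit_sq_integrable)
    show "?d \<in> borel_measurable borel"
      by (intro borel_measurable_abs borel_measurable_diff disc_measurable_snd C C')
    show "norm (?d \<tau>) \<le> ?B" for \<tau>
      using disc_bound[OF C \<delta>, of P \<tau>] disc_bound[OF C' \<delta>, of P \<tau>] by simp
  qed
  note i1 = sq_disc_inner_integrable[OF C' \<delta>, of P] and i2 = sq_disc_inner_integrable[OF C \<delta>, of P]
  have pw: "\<bar>(disc K P C' \<delta> \<tau>)\<^sup>2 - (disc K P C \<delta> \<tau>)\<^sup>2\<bar> \<le> ?B * ?d \<tau>" for \<tau>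
  proof -
    have "\<bar>(disc K P C' \<delta> \<tau>)\<^sup>2 - (disc K P C \<delta> \<tau>)\<^sup>2\<bar>
        = \<bar>disc K P C' \<delta> \<tau> + disc K P C \<delta> \<tau>\<bar> * ?d \<tau>"
      by (simp add: power2_eq_square abs_mult[symmetric] algebra_simps)
    also have "\<dots> \<le> ?B * ?d \<tau>"
      using disc_bound[OF C \<delta>, of P \<tau>] disc_bound[OF C' \<delta>, of P \<tau>] by (intro mult_right_mono) auto
    finally show ?thesis .
  qed
  have "sq_disc K P C' \<delta> - sq_disc K P C \<delta>
      = (LINT \<tau>:unit_sq|lborel. (disc K P C' \<delta> \<tau>)\<^sup>2 - (disc K P C \<delta> \<tau>)\<^sup>2)"
    unfolding sq_disc_def using set_integral_diff(2)[OF i1 i2] by simp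
  also have "\<bar>\<dots>\<bar> \<le> (LINT \<tau>:unit_sq|lborel. \<bar>(disc K P C' \<delta> \<tau>)\<^sup>2 - (disc K P C \<delta> \<tau>)\<^sup>2\<bar>)"
    using set_integral_norm_bound[OF set_integral_diff(1)[OF i1 i2]] by simp
  also have "\<dots> \<le> (LINT \<tau>:unit_sq|lborel. ?B * ?d \<tau>)"
    by (intro set_integral_mono set_integrable_abs set_integral_diff i1 i2 set_integrable_mult_right di pw)
  also have "\<dots> = ?B * (LINT \<tau>:unit_sq|lborel. ?d \<tau>)" by simp
  also have "\<dots> \<le> ?B * (2 * real (card P) * (measure lborel C' - measure lborel C))"
    by (intro mult_left_mono disc_diff_L1 B0 C C' CC' \<delta> P)
  finally show ?thesis by (simp add: power2_eq_square algebra_simps)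
qed

lemma quad_discrepancy_diff:
  assumes C: "compact C" "C \<subseteq> cball 0 (real K)" and C': "compact C'" "C' \<subseteq> cball 0 (real K)"
    and CC': "C \<subseteq> C'" and P: "P \<subseteq> unit_sq"
  shows "\<bar>quad_discrepancy P C' - quad_discrepancy P C\<bar>
    \<le> 4 * (real (card P))\<^sup>2 * count_bound K * (measure lborel C' - measure lborel C)" (is "_ \<le> ?B")
proof -
  note i1 = sq_disc_integrable[OF C', of P] and i2 = sq_disc_integrable[OF C, of P]
  have "quad_discrepancy P C' - quad_discrepancy P C
     = (LINT \<delta>:{0..1}|lborel. sq_disc K P C' \<delta> - sq_disc K P C \<delta>)"
    using set_integral_diff(2)[OF i1 i2] by (simp add: quad_discrepancy_eq[OF C P] quad_discrepancy_eq[OF C' P])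
  also have "\<bar>\<dots>\<bar> \<le> (LINT \<delta>:{0..1}|lborel. \<bar>sq_disc K P C' \<delta> - sq_disc K P C \<delta>\<bar>)"
    using set_integral_norm_bound[OF set_integral_diff(1)[OF i1 i2]] by simp
  also have "\<dots> \<le> (LINT \<delta>:{0..1::real}|lborel. ?B)"
    by (intro set_integral_mono set_integrable_abs set_integral_diff i1 i2)
      (use sq_disc_diff[OF C C' CC' _ _ P] in \<open>auto simp: set_integrable_def\<close>)
  also have "\<dots> = ?B" by (simp add: set_lebesgue_integral_def)
  finally show ?thesis .
qed

section \<open>The minimum over point sets and the number of points\<close>

lemma point_sets_nonempty: "point_sets N \<noteq> {}"
proof -
  have "infinite {0..<1::real}" by (simp add: infinite_Ico)
  then obtain X where X: "X \<subseteq> {0..<1::real}" "finite X" "card X = N"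
    using infinite_arbitrarily_large by blast
  have "(\<lambda>x. (x, 0::real)) ` X \<in> point_sets N"
    unfolding point_sets_def using X by (auto simp: card_image inj_on_def)
  then show ?thesis by blast
qed

lemma bdd_below_quad: "bdd_below ((\<lambda>P. quad_discrepancy P C) ` A)"
  using quad_discrepancy_nonneg by (intro bdd_belowI2[where m = 0])

lemma min_quad_le: "P \<in> point_sets N \<Longrightarrow> min_quad_discrepancy C N \<le> quad_discrepancy P C"
  unfolding min_quad_discrepancy_def by (intro cINF_lower bdd_below_quad)

lemma min_quad_ge:
  "(\<And>P. P \<in> point_sets N \<Longrightarrow> B \<le> quad_discrepancy P C) \<Longrightarrow> B \<le> min_quad_discrepancy C N"
  unfolding min_quad_discrepancy_def by (intro cINF_greatest point_sets_nonempty)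

text \<open>The bound for a fixed point set does not involve its position, so it passes to the
  infima. It keeps the value at a fixed N stable under all later, much smaller losses of
  area.\<close>

lemma min_quad_diff:
  assumes C: "compact C" "C \<subseteq> cball 0 (real K)" and C': "compact C'" "C' \<subseteq> cball 0 (real K)"
    and CC': "C \<subseteq> C'"
  shows "\<bar>min_quad_discrepancy C' N - min_quad_discrepancy C N\<bar>
    \<le> 4 * (real N)\<^sup>2 * count_bound K * (measure lborel C' - measure lborel C)" (is "_ \<le> ?B")
proof -
  have b: "\<bar>quad_discrepancy P C' - quad_discrepancy P C\<bar> \<le> ?B" if "P \<in> point_sets N" for P
    using quad_discrepancy_diff[OF C C' CC', of P] that by (auto simp: point_sets_def)
  have "min_quad_discrepancy C N - ?B \<le> min_quad_discrepancy C' N"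
  proof (rule min_quad_ge)
    fix P assume P: "P \<in> point_sets N"
    show "min_quad_discrepancy C N - ?B \<le> quad_discrepancy P C'"
      using b[OF P] min_quad_le[OF P, of C] by linarith
  qed
  moreover have "min_quad_discrepancy C' N - ?B \<le> min_quad_discrepancy C N"
  proof (rule min_quad_ge)
    fix P assume P: "P \<in> point_sets N"
    show "min_quad_discrepancy C' N - ?B \<le> quad_discrepancy P C"
      using b[OF P] min_quad_le[OF P, of C'] by linarith
  qed
  ultimately show ?thesis by linarith
qed

lemma quad_discrepancy_triangle:
  assumes C: "compact C" "C \<subseteq> cball 0 (real K)" and P: "P \<subseteq> unit_sq" and P': "P' \<subseteq> unit_sq"
    and d: "\<And>\<delta> \<tau>. \<delta> \<in> {0..1} \<Longrightarrow> \<bar>disc K P C \<delta> \<tau> - disc K P' C \<delta> \<tau>\<bar> \<le> B"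
  shows "quad_discrepancy P C \<le> 2 * quad_discrepancy P' C + 2 * B\<^sup>2"
proof -
  have "sq_disc K P C \<delta> \<le> 2 * sq_disc K P' C \<delta> + 2 * B\<^sup>2" if \<delta>: "\<delta> \<in> {0..1}" for \<delta>
  proof -
    have \<delta>': "0 \<le> \<delta>" "\<delta> \<le> 1" using \<delta> by auto
    note i1 = sq_disc_inner_integrable[OF C \<delta>', of P] and i2 = sq_disc_inner_integrable[OF C \<delta>', of P']
    have ci: "set_integrable lborel unit_sq (\<lambda>\<tau>. 2 * B\<^sup>2)"
      by (rule unit_sq_integrable[where B = "2 * B\<^sup>2"]) auto
    have cj: "set_integrable lborel unit_sq (\<lambda>\<tau>. B\<^sup>2)"
      by (rule unit_sq_integrable[where B = "B\<^sup>2"]) auto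
    have "sq_disc K P C \<delta> \<le> (LINT \<tau>:unit_sq|lborel. 2 * (disc K P' C \<delta> \<tau>)\<^sup>2 + 2 * B\<^sup>2)"
      unfolding sq_disc_def
    proof (intro set_integral_mono set_integral_add set_integrable_mult_right i1 i2 cj)
      fix \<tau>
      have "(disc K P C \<delta> \<tau> - disc K P' C \<delta> \<tau>)\<^sup>2 \<le> B\<^sup>2"
        using d[OF \<delta>, of \<tau>] by (simp add: abs_le_square_iff[symmetric])
      \<comment> \<open>With x and y the two discrepancies, 2 y^2 + 2 (x - y)^2 - x^2 = (2 y -
        x)^2.\<close>
      moreover have "0 \<le> (2 * disc K P' C \<delta> \<tau> - disc K P C \<delta> \<tau>)\<^sup>2" by simp
      ultimately show "(disc K P C \<delta> \<tau>)\<^sup>2 \<le> 2 * (disc K P' C \<delta> \<tau>)\<^sup>2 + 2 * B\<^sup>2"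
        by (simp add: power2_eq_square algebra_simps)
    qed
    also have "\<dots> = 2 * sq_disc K P' C \<delta> + 2 * B\<^sup>2"
      by (simp only: set_integral_add(2)[OF set_integrable_mult_right[OF i2] ci]
          unit_sq_integral_const set_integral_mult_right sq_disc_def)
    finally show ?thesis .
  qed
  note pw = this
  have ci: "set_integrable lborel {0..1::real} (\<lambda>\<delta>. 2 * B\<^sup>2)"
    by (simp add: set_integrable_def)
  note i1 = sq_disc_integrable[OF C, of P] and i2 = sq_disc_integrable[OF C, of P']
  have "quad_discrepancy P C \<le> (LINT \<delta>:{0..1}|lborel. 2 * sq_disc K P' C \<delta> + 2 * B\<^sup>2)"
    unfolding quad_discrepancy_eq[OF C P]
    by (intro set_integral_mono set_integral_add set_integrable_mult_right i1 i2 ci pw)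
  also have "\<dots> = 2 * quad_discrepancy P' C + 2 * B\<^sup>2"
    unfolding quad_discrepancy_eq[OF C P'] set_integral_add(2)[OF set_integrable_mult_right[OF i2] ci]
    by (simp add: set_lebesgue_integral_def)
  finally show ?thesis .
qed

lemma disc_Diff:
  assumes "finite P'" "P \<subseteq> P'"
  shows "disc K P' C \<delta> \<tau> - disc K P C \<delta> \<tau> = disc K (P' - P) C \<delta> \<tau>"
proof -
  have "finite P" using assms finite_subset by blast
  moreover have "(\<Sum>p\<in>P'. lcount K C \<delta> p \<tau>) = (\<Sum>p\<in>P' - P. lcount K C \<delta> p \<tau>) + (\<Sum>p\<in>P. lcount K C \<delta> p \<tau>)"
    using assms by (simp add: sum.subset_diff)
  moreover have "real (card (P' - P)) = real (card P') - real (card P)"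
    using assms \<open>finite P\<close> card_mono[of P' P] by (simp add: card_Diff_subset)
  ultimately show ?thesis unfolding disc_def by (simp add: left_diff_distrib)
qed

lemma quad_discrepancy_add_points:
  assumes C: "compact C" "C \<subseteq> cball 0 (real K)" and P': "finite P'" "P' \<subseteq> unit_sq" and P: "P \<subseteq> P'"
    and q: "card P' - card P \<le> q"
  shows "quad_discrepancy P C \<le> 2 * quad_discrepancy P' C + 2 * (real q * count_bound K)\<^sup>2"
    and "quad_discrepancy P' C \<le> 2 * quad_discrepancy P C + 2 * (real q * count_bound K)\<^sup>2"
proof -
  have d: "\<bar>disc K P' C \<delta> \<tau> - disc K P C \<delta> \<tau>\<bar> \<le> real q * count_bound K" if "\<delta> \<in> {0..1}" for \<delta> \<tau>
  proof -
    have "\<bar>disc K (P' - P) C \<delta> \<tau>\<bar> \<le> real (card (P' - P)) * count_bound K"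
      using disc_bound[OF C] that by auto
    also have "\<dots> \<le> real q * count_bound K"
      using q P P' count_bound_ge_1[of K] finite_subset[OF P P'(1)]
      by (intro mult_right_mono) (auto simp: card_Diff_subset)
    finally show ?thesis unfolding disc_Diff[OF P'(1) P] .
  qed
  have PS: "P \<subseteq> unit_sq" using P P' by blast
  show "quad_discrepancy P C \<le> 2 * quad_discrepancy P' C + 2 * (real q * count_bound K)\<^sup>2"
    by (rule quad_discrepancy_triangle[OF C PS P'(2)]) (use d in \<open>simp add: abs_minus_commute\<close>)
  show "quad_discrepancy P' C \<le> 2 * quad_discrepancy P C + 2 * (real q * count_bound K)\<^sup>2"
    by (rule quad_discrepancy_triangle[OF C P'(2) PS]) (use d in simp)
qed

text \<open>A set of N' points contains one of N points, and a set of N points extends to N' by new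
  points placed anywhere. At most q points change, so apart from the factor 2 the cost does not
  depend on N, and a small power of N absorbs both.\<close>

lemma min_quad_add_points:
  assumes C: "compact C" "C \<subseteq> cball 0 (real K)" and N: "N \<le> N'" "N' \<le> N + q"
  shows "min_quad_discrepancy C N \<le> 2 * min_quad_discrepancy C N' + 2 * (real q * count_bound K)\<^sup>2"
    and "min_quad_discrepancy C N' \<le> 2 * min_quad_discrepancy C N + 2 * (real q * count_bound K)\<^sup>2"
proof -
  let ?e = "2 * (real q * count_bound K)\<^sup>2"
  have "(min_quad_discrepancy C N - ?e) / 2 \<le> min_quad_discrepancy C N'"
  proof (rule min_quad_ge)
    fix P' assume P': "P' \<in> point_sets N'"
    then have "N \<le> card P'" using N by (simp add: point_sets_def)
    then obtain P where P: "P \<subseteq> P'" "card P = N" "finite P"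
      using obtain_subset_with_card_n by metis
    then have "P \<in> point_sets N" using P' by (auto simp: point_sets_def)
    then have "min_quad_discrepancy C N \<le> quad_discrepancy P C" by (rule min_quad_le)
    also have "\<dots> \<le> 2 * quad_discrepancy P' C + ?e"
      by (rule quad_discrepancy_add_points[OF C]) (use P P' N in \<open>auto simp: point_sets_def\<close>)
    finally show "(min_quad_discrepancy C N - ?e) / 2 \<le> quad_discrepancy P' C" by simp
  qed
  then show "min_quad_discrepancy C N \<le> 2 * min_quad_discrepancy C N' + ?e" by simp
  have "(min_quad_discrepancy C N' - ?e) / 2 \<le> min_quad_discrepancy C N"
  proof (rule min_quad_ge)
    fix P assume P: "P \<in> point_sets N"
    then have fP: "finite P" "card P = N" "P \<subseteq> unit_sq" by (auto simp: point_sets_def)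
    have "infinite (unit_sq - P)"
    proof -
      have "infinite ((\<lambda>x. (x, 0::real)) ` {0..<1::real})"
        by (simp add: finite_image_iff inj_on_def infinite_Ico)
      moreover have "(\<lambda>x. (x, 0::real)) ` {0..<1::real} \<subseteq> unit_sq" by auto
      ultimately have "infinite unit_sq" using finite_subset by blast
      then show ?thesis using fP by simp
    qed
    then obtain X where X: "X \<subseteq> unit_sq - P" "finite X" "card X = N' - N"
      using infinite_arbitrarily_large by blast
    have c: "card (P \<union> X) = N'"
      using X fP N by (subst card_Un_disjoint) auto
    then have "P \<union> X \<in> point_sets N'" using X fP by (auto simp: point_sets_def)
    then have "min_quad_discrepancy C N' \<le> quad_discrepancy (P \<union> X) C" by (rule min_quad_le)
    also have "\<dots> \<le> 2 * quad_discrepancy P C + ?e"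
      by (rule quad_discrepancy_add_points[OF C]) (use X fP c N in auto)
    finally show "(min_quad_discrepancy C N' - ?e) / 2 \<le> quad_discrepancy P C" by simp
  qed
  then show "min_quad_discrepancy C N' \<le> 2 * min_quad_discrepancy C N + ?e" by simp
qed

section \<open>Floor sums along special slopes\<close>

text \<open>The sawtooth 1/2 - {x}, of period 1 and mean zero: the correction between a floor and
  its argument, centred.\<close>

definition rho :: "real \<Rightarrow> real" where
  "rho x = of_int \<lfloor>x\<rfloor> - x + 1 / 2"

lemma rho_bound: "\<bar>rho x\<bar> \<le> 1 / 2"
  unfolding rho_def abs_le_iff by linarith

lemma rho_add_int: "rho (x + of_int k) = rho x"
  by (simp add: rho_def)

lemma rho_add_nat: "rho (x + of_nat k) = rho x"
  using rho_add_int[of x "int k"] by simp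

text \<open>Hermite's identity for integers. Passing from N to N + 1 replaces the term N div h by (N
  + h) div h, which is larger by one.\<close>

lemma sum_div_shift:
  fixes N :: int
  assumes "h > 0"
  shows "(\<Sum>u<h. (N + int u) div int h) = N"
proof -
  have step: "(\<Sum>u<h. (N + 1 + int u) div int h) = (\<Sum>u<h. (N + int u) div int h) + 1" for N
  proof -
    have "(\<Sum>u<Suc h. (N + int u) div int h) = N div int h + (\<Sum>u<h. (N + int (Suc u)) div int h)"
      by (subst sum.lessThan_Suc_shift) simp
    then have "(\<Sum>u<h. (N + int u) div int h) + (N + int h) div int h
        = N div int h + (\<Sum>u<h. (N + 1 + int u) div int h)"
      by (simp add: algebra_simps)
    moreover have "(N + int h) div int h = N div int h + 1" using assms by simp
    ultimately show ?thesis by simp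
  qed
  show ?thesis
  proof (induction N rule: int_induct[where k = 0])
    case base
    have "int u div int h = 0" if "u < h" for u using that by (simp flip: of_nat_div)
    then show ?case by simp
  next
    case (step1 i)
    then show ?case using step[of i] by simp
  next
    case (step2 i)
    then show ?case using step[of "i - 1"] by simp
  qed
qed

text \<open>The distribution relation of the sawtooth, equivalent to Hermite's identity for floors.
  It is the source of all cancellation in the floor sums: h equally spaced arguments contribute no
  more than a single value of \<open>rho\<close>.\<close>

lemma rho_hermite:
  assumes "h > 0"
  shows "(\<Sum>u<h. rho (x + real u / real h)) = rho (real h * x)"
proof -
  have fl: "\<lfloor>x + real u / real h\<rfloor> = (\<lfloor>real h * x\<rfloor> + int u) div int h" for u
  proof -
    have "x + real u / real h = (real h * x + of_int (int u)) / real_of_int (int h)"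
      using assms by (simp add: field_simps)
    then show ?thesis using floor_divide_real_eq_div[of "int h" "real h * x + of_int (int u)"] by simp
  qed
  have "(\<Sum>u<h. rho (x + real u / real h))
     = of_int (\<Sum>u<h. (\<lfloor>real h * x\<rfloor> + int u) div int h) - real h * x - (\<Sum>u<h. real u) / real h + real h / 2"
    unfolding rho_def fl by (simp add: sum.distrib sum_subtractf sum_divide_distrib)
  also have "(\<Sum>u<h. real u) = real h * (real h - 1) / 2"
    by (induction h) (auto simp: field_simps)
  finally have "(\<Sum>u<h. rho (x + real u / real h))
     = of_int \<lfloor>real h * x\<rfloor> - real h * x - real h * (real h - 1) / 2 / real h + real h / 2"
    by (simp only: sum_div_shift[OF assms])
  also have "real h * (real h - 1) / 2 / real h = (real h - 1) / 2" using assms by simp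
  finally show ?thesis by (simp add: rho_def field_simps)
qed

definition rho_sum :: "real \<Rightarrow> real \<Rightarrow> nat \<Rightarrow> real" where
  "rho_sum \<theta> c n = (\<Sum>i<n. rho (\<theta> * real i + c))"

lemma rho_sum_add: "rho_sum \<theta> c (m + n) = rho_sum \<theta> c m + rho_sum \<theta> (c + \<theta> * real m) n"
  by (induction n) (simp_all add: rho_sum_def algebra_simps)

lemma rho_sum_trivial: "\<bar>rho_sum \<theta> c n\<bar> \<le> real n / 2"
proof -
  have "\<bar>rho_sum \<theta> c n\<bar> \<le> (\<Sum>i<n. \<bar>rho (\<theta> * real i + c)\<bar>)"
    unfolding rho_sum_def by (rule sum_abs)
  also have "\<dots> \<le> (\<Sum>i<n. 1 / 2)" by (intro sum_mono rho_bound)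
  finally show ?thesis by simp
qed

lemma rho_sum_blocks:
  assumes "\<And>c. \<bar>rho_sum \<theta> c q\<bar> \<le> E"
  shows "\<bar>rho_sum \<theta> c (k * q)\<bar> \<le> real k * E"
proof (induction k arbitrary: c)
  case 0
  show ?case by (simp add: rho_sum_def)
next
  case (Suc k)
  have "rho_sum \<theta> c (Suc k * q) = rho_sum \<theta> c q + rho_sum \<theta> (c + \<theta> * real q) (k * q)"
    using rho_sum_add[of \<theta> c q "k * q"] by simp
  then show ?case using assms[of c] Suc[of "c + \<theta> * real q"] by (simp add: algebra_simps)
qed

text \<open>Equal to 1/h + 1/h^2. For up to h steps it behaves like 1/h, so its multiples are nearly
  equally spaced modulo 1; over h^2 steps they run through all multiples of 1/h^2, since h + 1 and
  h^2 are coprime.\<close>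

definition theta :: "nat \<Rightarrow> real" where
  "theta h = (real h + 1) / (real h)\<^sup>2"

text \<open>For i < h the argument exceeds c + i/h by at most 1/h, so its floor lies between those
  at c + i/h and at (c + 1/h) + i/h. \<open>rho_hermite\<close> sums either side to one value of
  \<open>rho\<close>, at most 1/2 in size; the h corrections 1/h add 1.\<close>

lemma rho_sum_theta_short:
  assumes h: "h > 0"
  shows "\<bar>rho_sum (theta h) c h\<bar> \<le> 3 / 2"
proof -
  have eq: "theta h * real i + c = (c + real i / real h) + real i / (real h)\<^sup>2" for i
    using h by (simp add: theta_def field_simps power2_eq_square)
  have t: "real i / (real h)\<^sup>2 \<le> 1 / real h" if "i < h" for i
    using that h by (simp add: field_simps power2_eq_square)
  have "rho (c + real i / real h) - 1 / real h \<le> rho (theta h * real i + c)" if "i < h" for i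
  proof -
    have "\<lfloor>c + real i / real h\<rfloor> \<le> \<lfloor>(c + real i / real h) + real i / (real h)\<^sup>2\<rfloor>"
      by (intro floor_mono) simp
    then show ?thesis unfolding rho_def eq using t[OF that] by simp
  qed
  then have "(\<Sum>i<h. rho (c + real i / real h) - 1 / real h) \<le> rho_sum (theta h) c h"
    unfolding rho_sum_def by (intro sum_mono) auto
  then have l: "rho (real h * c) - 1 \<le> rho_sum (theta h) c h"
    using h rho_hermite[OF h, of c] by (simp add: sum_subtractf)
  have "rho (theta h * real i + c) \<le> rho ((c + 1 / real h) + real i / real h) + 1 / real h" if "i < h" for i
  proof -
    have "\<lfloor>(c + real i / real h) + real i / (real h)\<^sup>2\<rfloor> \<le> \<lfloor>(c + 1 / real h) + real i / real h\<rfloor>"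
      using t[OF that] by (intro floor_mono) simp
    moreover have "0 \<le> real i / (real h)\<^sup>2" by simp
    ultimately show ?thesis unfolding rho_def eq by linarith
  qed
  then have "rho_sum (theta h) c h \<le> (\<Sum>i<h. rho ((c + 1 / real h) + real i / real h) + 1 / real h)"
    unfolding rho_sum_def by (intro sum_mono) auto
  then have u: "rho_sum (theta h) c h \<le> rho (real h * (c + 1 / real h)) + 1"
    using h rho_hermite[OF h, of "c + 1 / real h"] by (simp add: sum.distrib)
  show ?thesis
    using l u rho_bound[of "real h * c"] rho_bound[of "real h * (c + 1 / real h)"]
    unfolding abs_le_iff by linarith
qed

text \<open>A full period. For i = u h + t the product with \<open>theta h\<close> is u + u/h + t/h
  + t/h^2. The sum over u is a Hermite sum; it multiplies the argument by h, which leaves t + t/h,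
  so the sum over t is a Hermite sum as well.\<close>

lemma rho_sum_theta_square:
  assumes h: "h > 0"
  shows "\<bar>rho_sum (theta h) c (h * h)\<bar> \<le> 1 / 2"
proof -
  define y where "y t = c + real t / real h + real t / (real h)\<^sup>2" for t
  have eq: "rho (theta h * real (u * h + t) + c) = rho (y t + real u / real h)" for u t
  proof -
    have "theta h * real (u * h + t) + c = (y t + real u / real h) + real u"
      using h by (simp add: theta_def y_def field_simps power2_eq_square)
    then show ?thesis using rho_add_nat by metis
  qed
  have "rho_sum (theta h) c (h * h) = (\<Sum>u<h. \<Sum>i\<in>{u * h..<u * h + h}. rho (theta h * real i + c))"
    unfolding rho_sum_def by (rule sum.nat_group[symmetric])
  also have "\<dots> = (\<Sum>u<h. \<Sum>t<h. rho (y t + real u / real h))"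
  proof (rule sum.cong[OF refl])
    fix u
    have "(\<Sum>i\<in>{u * h..<u * h + h}. rho (theta h * real i + c)) = (\<Sum>t<h. rho (theta h * real (u * h + t) + c))"
      using sum.shift_bounds_nat_ivl[of "\<lambda>i. rho (theta h * real i + c)" 0 "u * h" h]
      by (simp add: lessThan_atLeast0 add.commute)
    then show "(\<Sum>i\<in>{u * h..<u * h + h}. rho (theta h * real i + c)) = (\<Sum>t<h. rho (y t + real u / real h))"
      by (simp only: eq)
  qed
  also have "\<dots> = (\<Sum>t<h. rho (real h * y t))"
    by (subst sum.swap) (simp add: rho_hermite[OF h])
  also have "\<dots> = (\<Sum>t<h. rho (real h * c + real t / real h))"
  proof (rule sum.cong[OF refl])
    fix t
    have "real h * y t = (real h * c + real t / real h) + real t"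
      using h by (simp add: y_def field_simps power2_eq_square)
    then show "rho (real h * y t) = rho (real h * c + real t / real h)"
      using rho_add_nat by metis
  qed
  also have "\<dots> = rho (real h * (real h * c))" by (rule rho_hermite[OF h])
  finally show ?thesis using rho_bound by metis
qed

text \<open>Write n = A h^2 + B h + s with B, s < h. The A full periods cost 1/2 each, the B blocks
  of length h cost 3/2 each, and the last s terms 1/2 each.\<close>

lemma rho_sum_theta:
  assumes h: "h > 0"
  shows "\<bar>rho_sum (theta h) c n\<bar> \<le> real n / (real h)\<^sup>2 + 2 * real h"
proof -
  define A r where "A = n div (h * h)" and "r = n mod (h * h)"
  define B s where "B = r div h" and "s = r mod h"
  have "r = B * h + s" by (simp only: B_def s_def div_mult_mod_eq)
  moreover have "n = A * (h * h) + r" by (simp only: A_def r_def div_mult_mod_eq)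
  ultimately have n: "n = A * (h * h) + (B * h + s)" by simp
  have "r < h * h" using h by (simp add: r_def)
  then have B: "B < h" by (simp add: B_def less_mult_imp_div_less)
  have s: "s < h" using h by (simp add: s_def)
  define c1 where "c1 = c + theta h * real (A * (h * h))"
  define c2 where "c2 = c1 + theta h * real (B * h)"
  have "rho_sum (theta h) c n
      = rho_sum (theta h) c (A * (h * h)) + (rho_sum (theta h) c1 (B * h) + rho_sum (theta h) c2 s)"
    unfolding n c1_def c2_def by (simp only: rho_sum_add)
  then have "\<bar>rho_sum (theta h) c n\<bar>
      \<le> \<bar>rho_sum (theta h) c (A * (h * h))\<bar> + \<bar>rho_sum (theta h) c1 (B * h)\<bar> + \<bar>rho_sum (theta h) c2 s\<bar>"
    by linarith
  also have "\<dots> \<le> real A * (1 / 2) + real B * (3 / 2) + real s / 2"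
    by (intro add_mono rho_sum_blocks rho_sum_trivial rho_sum_theta_square rho_sum_theta_short h)
  also have "\<dots> \<le> real A + 2 * real h"
    using B s by simp
  also have "real A \<le> real n / (real h)\<^sup>2"
  proof -
    have "real (A * (h * h)) \<le> real n" unfolding n by (intro of_nat_mono) simp
    then show ?thesis using h by (simp add: field_simps power2_eq_square)
  qed
  finally show ?thesis by simp
qed

text \<open>Along i = j b + t with t fixed the slope contributes a j + \<open>theta h\<close> * j,
  and \<open>rho\<close> does not see the integer a j. This leaves b sums of slope
  \<open>theta h\<close> with various constants, and fewer than b single terms.\<close>

lemma rho_sum_slope:
  fixes a :: int
  assumes h: "h > 0" and b: "b > 0"
  shows "\<bar>rho_sum ((of_int a + theta h) / real b) c n\<bar> \<le> real n / (real h)\<^sup>2 + 3 * real b * real h"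
proof -
  define s where "s = (of_int a + theta h) / real b"
  define q r where "q = n div b" and "r = n mod b"
  have n: "n = q * b + r" by (simp add: q_def r_def)
  have r: "r < b" using b by (simp add: r_def)
  have "rho_sum s c (q * b) = (\<Sum>j<q. \<Sum>i\<in>{j * b..<j * b + b}. rho (s * real i + c))"
    unfolding rho_sum_def by (rule sum.nat_group[symmetric])
  also have "\<dots> = (\<Sum>j<q. \<Sum>t<b. rho (theta h * real j + (c + s * real t)))"
  proof (rule sum.cong[OF refl])
    fix j
    have eq: "rho (s * real (j * b + t) + c) = rho (theta h * real j + (c + s * real t))" for t
    proof -
      have "s * real (j * b + t) + c = (theta h * real j + (c + s * real t)) + of_int (a * int j)"
        using b by (simp add: s_def field_simps)
      then show ?thesis using rho_add_int by metis
    qed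
    have "(\<Sum>i\<in>{j * b..<j * b + b}. rho (s * real i + c)) = (\<Sum>t<b. rho (s * real (j * b + t) + c))"
      using sum.shift_bounds_nat_ivl[of "\<lambda>i. rho (s * real i + c)" 0 "j * b" b]
      by (simp add: lessThan_atLeast0 add.commute)
    then show "(\<Sum>i\<in>{j * b..<j * b + b}. rho (s * real i + c))
        = (\<Sum>t<b. rho (theta h * real j + (c + s * real t)))"
      by (simp only: eq)
  qed
  also have "\<dots> = (\<Sum>t<b. rho_sum (theta h) (c + s * real t) q)"
    by (subst sum.swap) (simp add: rho_sum_def)
  finally have "\<bar>rho_sum s c (q * b)\<bar> \<le> (\<Sum>t<b. \<bar>rho_sum (theta h) (c + s * real t) q\<bar>)"
    by simp
  also have "\<dots> \<le> (\<Sum>t<b. real q / (real h)\<^sup>2 + 2 * real h)"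
    by (intro sum_mono rho_sum_theta h)
  also have "\<dots> = real (q * b) / (real h)\<^sup>2 + 2 * real b * real h"
    by (simp add: field_simps)
  finally have 1: "\<bar>rho_sum s c (q * b)\<bar> \<le> real (q * b) / (real h)\<^sup>2 + 2 * real b * real h" .
  have "\<bar>rho_sum s c n\<bar> \<le> \<bar>rho_sum s c (q * b)\<bar> + \<bar>rho_sum s (c + s * real (q * b)) r\<bar>"
    unfolding n by (subst rho_sum_add) (rule abs_triangle_ineq)
  also have "\<dots> \<le> (real (q * b) / (real h)\<^sup>2 + 2 * real b * real h) + real r / 2"
    by (intro add_mono 1 rho_sum_trivial)
  also have "\<dots> \<le> real n / (real h)\<^sup>2 + 3 * real b * real h"
  proof -
    have "real r / 2 \<le> real b * 1" using r by simp
    also have "\<dots> \<le> real b * real h" using h by (intro mult_left_mono) auto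
    finally have "real r / 2 \<le> real b * real h" .
    moreover have "real (q * b) / (real h)\<^sup>2 \<le> real n / (real h)\<^sup>2"
      unfolding n by (intro divide_right_mono) auto
    ultimately show ?thesis by simp
  qed
  finally show ?thesis unfolding s_def .
qed

lemma int_interval_param:
  fixes K :: "int set"
  assumes "finite K" and c: "\<And>x y z. x \<in> K \<Longrightarrow> y \<in> K \<Longrightarrow> x \<le> z \<Longrightarrow> z \<le> y \<Longrightarrow> z \<in> K"
  obtains k0 where "bij_betw (\<lambda>i. k0 + int i) {..<card K} K"
proof (cases "K = {}")
  case True
  then have "bij_betw (\<lambda>i. 0 + int i) {..<card K} K" by (simp add: bij_betw_def)
  then show ?thesis using that by blast
next
  case False
  have K: "K = {Min K..Max K}"
  proof
    show "K \<subseteq> {Min K..Max K}" using assms(1) by auto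
    show "{Min K..Max K} \<subseteq> K"
      using c[of "Min K" "Max K"] Min_in[OF assms(1) False] Max_in[OF assms(1) False] by auto
  qed
  define n where "n = card K"
  have "Min K \<le> Max K" using assms(1) False by (simp add: Min_le_iff)
  then have n: "int n = Max K - Min K + 1" unfolding n_def by (subst K) simp
  have "(\<lambda>i. Min K + int i) ` {..<n} = {Min K..Max K}"
  proof (intro equalityI subsetI)
    fix z assume z: "z \<in> {Min K..Max K}"
    then have "z = Min K + int (nat (z - Min K))" "nat (z - Min K) < n" using n by auto
    then show "z \<in> (\<lambda>i. Min K + int i) ` {..<n}" by blast
  qed (use n in auto)
  then have "bij_betw (\<lambda>i. Min K + int i) {..<card K} K"
    using K by (auto simp: bij_betw_def inj_on_def n_def)
  then show ?thesis using that by blast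
qed

lemma rho_sum_int_interval:
  fixes a :: int and K :: "int set"
  assumes h: "h > 0" and b: "b > 0" and K: "finite K"
    and c: "\<And>x y z. x \<in> K \<Longrightarrow> y \<in> K \<Longrightarrow> x \<le> z \<Longrightarrow> z \<le> y \<Longrightarrow> z \<in> K"
  shows "\<bar>\<Sum>k\<in>K. rho ((of_int a + theta h) / real b * of_int k + c)\<bar>
    \<le> real (card K) / (real h)\<^sup>2 + 3 * real b * real h"
proof -
  obtain k0 where k0: "bij_betw (\<lambda>i. k0 + int i) {..<card K} K"
    using int_interval_param[OF K c] .
  let ?s = "(of_int a + theta h) / real b"
  have "(\<Sum>k\<in>K. rho (?s * of_int k + c)) = (\<Sum>i<card K. rho (?s * of_int (k0 + int i) + c))"
    using sum.reindex_bij_betw[OF k0, of "\<lambda>k. rho (?s * of_int k + c)"] by simp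
  also have "\<dots> = rho_sum ?s (c + ?s * of_int k0) (card K)"
    unfolding rho_sum_def by (intro sum.cong refl arg_cong[of _ _ rho]) (simp add: distrib_left)
  finally show ?thesis using rho_sum_slope[OF h b] by simp
qed

text \<open>A pair \<open>(s, b)\<close> stands for the line \<open>y = s x + b\<close>.\<close>

definition env :: "(real \<times> real) set \<Rightarrow> real \<Rightarrow> real" where
  "env U x = Min ((\<lambda>l. fst l * x + snd l) ` U)"

lemma env_le: "finite U \<Longrightarrow> l \<in> U \<Longrightarrow> env U x \<le> fst l * x + snd l"
  unfolding env_def by (intro Min_le) auto

lemma env_attained: "finite U \<Longrightarrow> U \<noteq> {} \<Longrightarrow> \<exists>l\<in>U. env U x = fst l * x + snd l"
proof -
  assume "finite U" "U \<noteq> {}"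
  then have "env U x \<in> (\<lambda>l. fst l * x + snd l) ` U" unfolding env_def by (intro Min_in) auto
  then show ?thesis by blast
qed

lemma le_env_iff: "finite U \<Longrightarrow> U \<noteq> {} \<Longrightarrow> y \<le> env U x \<longleftrightarrow> (\<forall>l\<in>U. y \<le> fst l * x + snd l)"
  unfolding env_def by auto

lemma env_concave:
  assumes "finite U" "U \<noteq> {}"
  shows "concave_on UNIV (env U)"
  unfolding concave_on_iff
proof (intro conjI ballI allI impI)
  fix x y u v :: real
  assume uv: "0 \<le> u" "0 \<le> v" "u + v = 1"
  obtain l where l: "l \<in> U" "env U (u *\<^sub>R x + v *\<^sub>R y) = fst l * (u *\<^sub>R x + v *\<^sub>R y) + snd l"
    using env_attained[OF assms] by blast
  have "u * env U x + v * env U y \<le> u * (fst l * x + snd l) + v * (fst l * y + snd l)"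
    using uv by (intro add_mono mult_left_mono env_le assms l) auto
  also have "\<dots> = fst l * (u *\<^sub>R x + v *\<^sub>R y) + (u + v) * snd l" by (simp add: algebra_simps)
  finally show "u * env U x + v * env U y \<le> env U (u *\<^sub>R x + v *\<^sub>R y)" using l uv by simp
qed simp

lemma env_lipschitz:
  assumes U: "finite U" "U \<noteq> {}" and s: "\<And>l. l \<in> U \<Longrightarrow> \<bar>fst l\<bar> \<le> \<Lambda>"
  shows "\<bar>env U x - env U y\<bar> \<le> \<Lambda> * \<bar>x - y\<bar>"
proof -
  have *: "env U x - env U y \<le> \<Lambda> * \<bar>x - y\<bar>" for x y
  proof -
    obtain l where l: "l \<in> U" "env U y = fst l * y + snd l" using env_attained[OF U] by blast
    have "env U x - env U y \<le> fst l * (x - y)"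
      using env_le[OF U(1) l(1), of x] l(2) by (simp add: algebra_simps)
    also have "\<dots> \<le> \<bar>fst l\<bar> * \<bar>x - y\<bar>" by (metis abs_ge_self abs_mult)
    also have "\<dots> \<le> \<Lambda> * \<bar>x - y\<bar>" by (intro mult_right_mono s l) simp
    finally show ?thesis .
  qed
  show ?thesis using *[of x y] *[of y x] by (simp add: abs_minus_commute abs_le_iff)
qed

text \<open>Ties between minimizing lines are broken by the smaller slope, so that every line is
  selected on a set of consecutive integers.\<close>

lemma rho_sum_env:
  assumes U: "finite U" "U \<noteq> {}" and h: "h > 0" and b: "b > 0"
    and s: "\<And>l. l \<in> U \<Longrightarrow> \<exists>a::int. fst l = (of_int a + theta h) / real b"
    and K: "finite K" and c: "\<And>x y z. x \<in> K \<Longrightarrow> y \<in> K \<Longrightarrow> x \<le> z \<Longrightarrow> z \<le> y \<Longrightarrow> z \<in> K"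
  shows "\<bar>\<Sum>k\<in>K. rho (env U (of_int k))\<bar>
    \<le> real (card U) * (real (card K) / (real h)\<^sup>2 + 3 * real b * real h)" (is "_ \<le> real (card U) * ?E")
proof -
  define better where "better l l' x \<longleftrightarrow> fst l * x + snd l < fst l' * x + snd l'
      \<or> fst l * x + snd l = fst l' * x + snd l' \<and> fst l < fst l'" for l l' :: "real \<times> real" and x :: real
  define Kl where "Kl l = {k \<in> K. \<forall>l'\<in>U. l' \<noteq> l \<longrightarrow> better l l' (of_int k)}" for l
  have conv: "better l l' z" if "better l l' x" "better l l' y" "x \<le> z" "z \<le> y" for l l' x y z
  proof -
    consider "fst l < fst l'" | "fst l = fst l'" | "fst l > fst l'" by linarith
    then show ?thesis
    proof cases
      case 1
      have "(fst l' - fst l) * x \<le> (fst l' - fst l) * z" using 1 that by (intro mult_left_mono) auto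
      then have "fst l * z + snd l \<le> fst l' * z + snd l'"
        using that(1) by (auto simp: better_def algebra_simps)
      then show ?thesis using 1 by (auto simp: better_def)
    next
      case 2
      then show ?thesis using that(1) by (auto simp: better_def)
    next
      case 3
      have "(fst l - fst l') * z \<le> (fst l - fst l') * y" using 3 that by (intro mult_left_mono) auto
      then show ?thesis using 3 that(2) by (auto simp: better_def algebra_simps)
    qed
  qed
  have disj: "Kl l \<inter> Kl l' = {}" if "l \<in> U" "l' \<in> U" "l \<noteq> l'" for l l'
    using that unfolding Kl_def better_def by fastforce
  have val: "env U (of_int k) = fst l * of_int k + snd l" if "l \<in> U" "k \<in> Kl l" for l k
  proof (rule antisym[OF env_le])
    show "fst l * of_int k + snd l \<le> env U (of_int k)"
      unfolding le_env_iff[OF U] using that by (fastforce simp: Kl_def better_def)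
  qed (use U that in auto)
  have cover: "K = (\<Union>l\<in>U. Kl l)"
  proof (intro equalityI subsetI)
    fix k assume k: "k \<in> K"
    define W where "W = {l \<in> U. fst l * of_int k + snd l = env U (of_int k)}"
    obtain l0 where "l0 \<in> U" "env U (of_int k) = fst l0 * of_int k + snd l0"
      using env_attained[OF U] by blast
    then have "l0 \<in> W" by (simp add: W_def)
    then have W: "finite W" "W \<noteq> {}" using U by (auto simp: W_def)
    obtain l where l: "l \<in> W" "\<And>l'. l' \<in> W \<Longrightarrow> fst l \<le> fst l'"
      using arg_min_if_finite[OF W, of fst] by (metis not_less)
    have "better l l' (of_int k)" if "l' \<in> U" "l' \<noteq> l" for l'
    proof (cases "l' \<in> W")
      case True
      then have "fst l * of_int k + snd l = fst l' * of_int k + snd l'" using l(1) by (simp add: W_def)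
      moreover have "fst l \<noteq> fst l'" using calculation that(2) by (auto simp: prod_eq_iff)
      ultimately show ?thesis using l(2)[OF True] by (simp add: better_def)
    next
      case False
      then have "env U (of_int k) < fst l' * of_int k + snd l'"
        using env_le[OF U(1) that(1), of "of_int k"] that by (simp add: W_def order_less_le)
      then show ?thesis using l(1) by (simp add: W_def better_def)
    qed
    then have "k \<in> Kl l" using k by (simp add: Kl_def)
    then show "k \<in> (\<Union>l\<in>U. Kl l)" using l(1) by (auto simp: W_def)
  qed (auto simp: Kl_def)
  have fin: "finite (Kl l)" for l using K by (simp add: Kl_def)
  have "(\<Sum>k\<in>K. rho (env U (of_int k))) = (\<Sum>l\<in>U. \<Sum>k\<in>Kl l. rho (env U (of_int k)))"
    by (subst cover, rule sum.UNION_disjoint) (use U fin disj in auto)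
  also have "\<dots> = (\<Sum>l\<in>U. \<Sum>k\<in>Kl l. rho (fst l * of_int k + snd l))"
    by (intro sum.cong refl) (simp add: val)
  also have "\<bar>\<dots>\<bar> \<le> (\<Sum>l\<in>U. \<bar>\<Sum>k\<in>Kl l. rho (fst l * of_int k + snd l)\<bar>)" by (rule sum_abs)
  also have "\<dots> \<le> (\<Sum>l\<in>U. ?E)"
  proof (intro sum_mono)
    fix l assume l: "l \<in> U"
    then obtain a :: int where a: "fst l = (of_int a + theta h) / real b" using s by blast
    have "z \<in> Kl l" if "x \<in> Kl l" "y \<in> Kl l" "x \<le> z" "z \<le> y" for x y z
      using that c[of x y z] conv[of l _ "of_int x" "of_int y" "of_int z"] by (auto simp: Kl_def)
    then have "\<bar>\<Sum>k\<in>Kl l. rho (fst l * of_int k + snd l)\<bar>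
        \<le> real (card (Kl l)) / (real h)\<^sup>2 + 3 * real b * real h"
      unfolding a by (intro rho_sum_int_interval h b fin)
    also have "\<dots> \<le> ?E"
      using K by (intro add_right_mono divide_right_mono of_nat_mono card_mono) (auto simp: Kl_def)
    finally show "\<bar>\<Sum>k\<in>Kl l. rho (fst l * of_int k + snd l)\<bar> \<le> ?E" .
  qed
  finally show ?thesis by simp
qed

section \<open>Counting lattice points in polygons\<close>

text \<open>k is a convex combination of k - 1 and x, so beyond k the graph stays under the
  prolonged chord.\<close>

lemma concave_extrapolate:
  fixes c :: "real \<Rightarrow> real"
  assumes c: "concave_on UNIV c" and x: "k \<le> x"
  shows "c x \<le> c k + (x - k) * (c k - c (k - 1))"
proof -
  define t where "t = 1 / (x - k + 1)"
  have t: "0 \<le> t" "t \<le> 1" "t * (x - k + 1) = 1" using x by (auto simp: t_def)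
  have "(1 - t) * (k - 1) + t * x = (k - 1) + t * (x - k + 1)" by (simp add: algebra_simps)
  then have k: "(1 - t) *\<^sub>R (k - 1) + t *\<^sub>R x = k" using t by simp
  have "(1 - t) * c (k - 1) + t * c x \<le> c k"
    using concave_onD[OF c t(1,2), of "k - 1" x] k by simp
  then have "(x - k + 1) * ((1 - t) * c (k - 1) + t * c x) \<le> (x - k + 1) * c k"
    using x by (intro mult_left_mono) auto
  moreover have "(x - k + 1) * ((1 - t) * c (k - 1) + t * c x)
      = (x - k + 1) * c (k - 1) + (t * (x - k + 1)) * (c x - c (k - 1))"
    by (simp add: algebra_simps)
  ultimately show ?thesis unfolding t(3) by (simp add: algebra_simps)
qed

lemma concave_interpolate:
  fixes c :: "real \<Rightarrow> real"
  assumes c: "concave_on UNIV c" and x: "k \<le> x" "x \<le> k + 1"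
  shows "c k + (x - k) * (c (k + 1) - c k) \<le> c x"
proof -
  have "(1 - (x - k)) *\<^sub>R k + (x - k) *\<^sub>R (k + 1) = x" by (simp add: algebra_simps)
  then show ?thesis
    using concave_onD[OF c, of "x - k" k "k + 1"] x by (simp add: algebra_simps)
qed

lemma has_integral_affine_cell:
  fixes k :: real
  shows "((\<lambda>x. A + (x - k) * B) has_integral (A + B / 2)) {k..k + 1}"
proof -
  have "((\<lambda>x. A + (x - k) * B) has_integral
      (A * (k + 1) + (k + 1 - k)\<^sup>2 / 2 * B) - (A * k + (k - k)\<^sup>2 / 2 * B)) {k..k + 1}"
    by (rule fundamental_theorem_of_calculus)
      (auto intro!: derivative_eq_intros simp: has_real_derivative_iff_has_vector_derivative[symmetric])
  then show ?thesis by (simp add: algebra_simps)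
qed

text \<open>On each cell a concave function lies above its chord and below the prolongation of the
  preceding chord, so the trapezoid error is at most half the drop in slope. These drops telescope:
  only the slopes at the two ends matter, not the number of cells.\<close>

lemma trapezoid_sum:
  fixes c :: "real \<Rightarrow> real" and a :: real
  assumes c: "concave_on UNIV c" and cont: "continuous_on UNIV c"
  defines "T \<equiv> \<lambda>n. \<Sum>i<n. (c (a + real i) + c (a + real i + 1)) / 2"
  shows "T n \<le> integral {a..a + real n} c"
    and "integral {a..a + real n} c
      \<le> T n + ((c a - c (a - 1)) - (c (a + real n) - c (a + real n - 1))) / 2"
proof (induction n)
  case 0
  case 1 show ?case by (simp add: T_def)
  case 2 show ?case by (simp add: T_def)
next
  case (Suc n)
  define k where "k = a + real n"
  have int: "c integrable_on {x..y}" for x y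
    using cont by (intro integrable_continuous_interval continuous_on_subset[OF cont]) auto
  have split: "integral {a..a + real (Suc n)} c = integral {a..k} c + integral {k..k + 1} c"
    using Henstock_Kurzweil_Integration.integral_combine[OF _ _ int, of a k "k + 1"]
    by (simp add: k_def add.assoc add.commute[of 1])
  have "c k + (c (k + 1) - c k) / 2 \<le> integral {k..k + 1} c"
    using int by (intro has_integral_le[OF has_integral_affine_cell integrable_integral])
      (auto intro!: concave_interpolate[OF c])
  then have lo: "(c k + c (k + 1)) / 2 \<le> integral {k..k + 1} c" by (simp add: field_simps)
  have up: "integral {k..k + 1} c \<le> c k + (c k - c (k - 1)) / 2"
    using int by (intro has_integral_le[OF integrable_integral has_integral_affine_cell])
      (auto intro!: concave_extrapolate[OF c])
  have T: "T (Suc n) = T n + (c k + c (k + 1)) / 2" by (simp add: T_def k_def)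
  have k1: "a + real (Suc n) = k + 1" by (simp add: k_def)
  have IH: "T n \<le> integral {a..k} c"
    "integral {a..k} c \<le> T n + ((c a - c (a - 1)) - (c k - c (k - 1))) / 2"
    using Suc by (simp_all add: k_def)
  case 1 show ?case unfolding split T using IH lo by linarith
  case 2 show ?case unfolding split T unfolding k1 using IH up by (simp add: field_simps)
qed

lemma concave_nonneg_between:
  fixes c :: "real \<Rightarrow> real"
  assumes c: "concave_on UNIV c" and xy: "0 \<le> c x" "0 \<le> c y" "x \<le> z" "z \<le> y"
  shows "0 \<le> c z"
proof (cases "x = y")
  case False
  define t where "t = (z - x) / (y - x)"
  have t: "0 \<le> t" "t \<le> 1" using xy False by (auto simp: t_def field_simps)
  have "(1 - t) *\<^sub>R x + t *\<^sub>R y = x + t * (y - x)" by (simp add: algebra_simps)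
  also have "\<dots> = z" using False by (simp add: t_def)
  finally have "(1 - t) * c x + t * c y \<le> c z"
    using concave_onD[OF c t, of x y] by simp
  moreover have "0 \<le> (1 - t) * c x + t * c y"
    using t xy by (intro add_nonneg_nonneg mult_nonneg_nonneg) auto
  ultimately show ?thesis by linarith
qed (use xy in auto)

text \<open>The trapezoid error is at most \<Lambda>; beyond it only the first and last nonnegative
  values and the two boundary cells remain, each O(\<Lambda>). The error is thus independent of the
  length of the support, which for the rescaled grid grows like h^3.\<close>

lemma concave_sum_vs_integral:
  fixes c :: "real \<Rightarrow> real"
  assumes c: "concave_on UNIV c" and lip: "\<And>x y. \<bar>c x - c y\<bar> \<le> \<Lambda> * \<bar>x - y\<bar>"
    and supp: "\<And>x. 0 \<le> c x \<Longrightarrow> \<bar>x - x0\<bar> \<le> X"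
  defines "K \<equiv> {k::int. 0 \<le> c (of_int k)}"
  obtains I where "((\<lambda>x. max 0 (c x)) has_integral I) UNIV" "\<bar>(\<Sum>k\<in>K. c (of_int k)) - I\<bar> \<le> 4 * \<Lambda>"
proof -
  let ?G = "\<lambda>x. max 0 (c x)"
  have L0: "0 \<le> \<Lambda>" using lip[of 0 1] by simp
  have cont: "continuous_on UNIV c"
    by (rule lipschitz_on_continuous_on[of \<Lambda>], rule lipschitz_onI)
      (use lip L0 in \<open>auto simp: dist_real_def\<close>)
  have int: "?G integrable_on {x..y}" for x y
    by (intro integrable_continuous_interval continuous_intros continuous_on_subset[OF cont]) auto
  note qc = concave_nonneg_between[OF c]
  \<comment> \<open>If c is nonpositive at one end of a unit cell, the Lipschitz bound keeps it at
    most \<Lambda> on the whole cell.\<close>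
  have cell: "0 \<le> integral {m..m + 1} ?G" "integral {m..m + 1} ?G \<le> \<Lambda>"
    if m: "c m \<le> 0 \<or> c (m + 1) \<le> 0" for m
  proof -
    show "0 \<le> integral {m..m + 1} ?G"
      by (intro Henstock_Kurzweil_Integration.integral_nonneg int) auto
    have "?G x \<le> \<Lambda>" if x: "x \<in> {m..m + 1}" for x
    proof -
      have "\<Lambda> * \<bar>x - m\<bar> \<le> \<Lambda> * 1" "\<Lambda> * \<bar>x - (m + 1)\<bar> \<le> \<Lambda> * 1"
        using L0 x by (auto intro!: mult_left_le)
      then have "c x \<le> \<Lambda>" using m lip[of x m] lip[of x "m + 1"] by auto
      then show ?thesis using L0 by simp
    qed
    then have "integral {m..m + 1} ?G \<le> integral {m..m + 1} (\<lambda>_. \<Lambda>)"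
      by (intro Henstock_Kurzweil_Integration.integral_le int) auto
    then show "integral {m..m + 1} ?G \<le> \<Lambda>" by simp
  qed
  have whole: "(?G has_integral integral {x..y} ?G) UNIV"
    if "\<And>z. 0 < c z \<Longrightarrow> x \<le> z \<and> z \<le> y" for x y
  proof (rule has_integral_on_superset[OF integrable_integral[OF int]])
    show "?G z = 0" if "z \<notin> {x..y}" for z
      using \<open>0 < c z \<Longrightarrow> x \<le> z \<and> z \<le> y\<close> that by fastforce
  qed auto
  have Kfin: "finite K"
  proof (rule finite_subset)
    show "K \<subseteq> {\<lfloor>x0 - X\<rfloor>..\<lceil>x0 + X\<rceil>}"
    proof
      fix k assume "k \<in> K"
      then have "\<bar>of_int k - x0\<bar> \<le> X" using supp by (simp add: K_def)
      then show "k \<in> {\<lfloor>x0 - X\<rfloor>..\<lceil>x0 + X\<rceil>}" by (simp add: abs_le_iff) linarith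
    qed
  qed simp
  show thesis
  proof (cases "K = {}")
    \<comment> \<open>No integer has c nonnegative, so by concavity the points with c > 0, if any,
      lie in a single unit cell.\<close>
    case True
    show thesis
    proof (cases "\<exists>x. 0 < c x")
      case False
      then have "?G = (\<lambda>x. 0)" by (auto simp: fun_eq_iff not_less)
      then show thesis using that[of 0] True L0 by simp
    next
      case pos: True
      then obtain x where x: "0 < c x" by blast
      define m :: real where "m = of_int \<lfloor>x\<rfloor>"
      have m: "c m < 0" "c (m + 1) < 0"
        using True by (auto simp: K_def m_def not_le) (metis of_int_1 of_int_add)
      have mx: "m \<le> x" "x \<le> m + 1" unfolding m_def by linarith+
      have "m \<le> z \<and> z \<le> m + 1" if "0 < c z" for z
        using qc[of z x m] qc[of x z "m + 1"] x m mx that by force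
      then have "(?G has_integral integral {m..m + 1} ?G) UNIV" by (rule whole)
      then show thesis using that[of "integral {m..m + 1} ?G"] cell[of m] m True L0 by auto
    qed
  next
    case False
    have Kc: "z \<in> K" if "x \<in> K" "y \<in> K" "x \<le> z" "z \<le> y" for x y z
      using qc[of "of_int x" "of_int y" "of_int z"] that by (simp add: K_def)
    obtain k0 where k0: "bij_betw (\<lambda>i. k0 + int i) {..<card K} K"
      using int_interval_param[OF Kfin Kc] .
    have "card K > 0" using Kfin False by (simp add: card_gt_0_iff)
    then obtain n where n: "card K = Suc n" using gr0_implies_Suc by blast
    define a where "a = real_of_int k0"
    have inK: "k0 + int i \<in> K" if "i \<le> n" for i
      using k0 that n unfolding bij_betw_def by auto
    have ca: "0 \<le> c (a + real i)" if "i \<le> n" for i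
      using inK[OF that] by (simp add: K_def a_def)
    have notK: "k0 - 1 \<notin> K" "k0 + int n + 1 \<notin> K"
      using k0 n unfolding bij_betw_def by auto
    have l: "c (a - 1) < 0" and r: "c (a + real n + 1) < 0"
      using notK by (simp_all add: K_def a_def not_le)
    define e1 e2 J where "e1 = integral {a - 1..a} ?G" and "e2 = integral {a + real n..a + real n + 1} ?G"
      and "J = integral {a..a + real n} c"
    have e: "0 \<le> e1" "e1 \<le> \<Lambda>" "0 \<le> e2" "e2 \<le> \<Lambda>"
      using cell[of "a - 1"] cell[of "a + real n"] l r by (simp_all add: e1_def e2_def)
    have JG: "J = integral {a..a + real n} ?G"
      unfolding J_def
    proof (rule Henstock_Kurzweil_Integration.integral_cong)
      fix x assume "x \<in> {a..a + real n}"
      then show "c x = ?G x" using qc[OF ca[of 0] ca[of n], of x] by simp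
    qed
    have "integral {a - 1..a + real n + 1} ?G = e1 + (J + e2)"
      unfolding JG e1_def e2_def
      using Henstock_Kurzweil_Integration.integral_combine[OF _ _ int, of "a - 1" a "a + real n + 1"]
        Henstock_Kurzweil_Integration.integral_combine[OF _ _ int, of a "a + real n" "a + real n + 1"]
      by simp
    moreover have "a - 1 \<le> z \<and> z \<le> a + real n + 1" if "0 < c z" for z
      using qc[of z a "a - 1"] qc[of "a + real n" z "a + real n + 1"] that l r ca[of 0] ca[of n] by force
    ultimately have hI: "(?G has_integral (e1 + (J + e2))) UNIV"
      using whole by metis
    define T where "T = (\<Sum>i<n. (c (a + real i) + c (a + real i + 1)) / 2)"
    have S: "(\<Sum>k\<in>K. c (of_int k)) = T + (c a + c (a + real n)) / 2"
    proof -
      have "(\<Sum>k\<in>K. c (of_int k)) = (\<Sum>i<Suc n. c (a + real i))"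
        using sum.reindex_bij_betw[OF k0, of "\<lambda>k. c (of_int k)"] n by (simp add: a_def)
      also have "\<dots> = T + (c a + c (a + real n)) / 2"
        unfolding T_def by (induction n) (simp_all add: field_simps)
      finally show ?thesis .
    qed
    have TJ: "T \<le> J" "J \<le> T + ((c a - c (a - 1)) - (c (a + real n) - c (a + real n - 1))) / 2"
      using trapezoid_sum[OF c cont, of a n] by (simp_all add: T_def J_def)
    have "c a \<le> \<Lambda>" "c a - c (a - 1) \<le> \<Lambda>" "c (a + real n) \<le> \<Lambda>"
      "- (c (a + real n) - c (a + real n - 1)) \<le> \<Lambda>"
      using lip[of a "a - 1"] l lip[of "a + real n" "a + real n + 1"] r
        lip[of "a + real n" "a + real n - 1"] by auto
    then have "\<bar>(\<Sum>k\<in>K. c (of_int k)) - (e1 + (J + e2))\<bar> \<le> 4 * \<Lambda>"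
      unfolding S using TJ e ca[of 0] ca[of n] L0 by (simp add: abs_le_iff field_simps)
    then show thesis using that[OF hI] by simp
  qed
qed

text \<open>The polygon between -\<open>env V\<close> and \<open>env U\<close>. The lower boundary
  enters with reversed sign, so that it too is a concave envelope and the same floor sums handle
  both boundaries.\<close>

definition region :: "(real \<times> real) set \<Rightarrow> (real \<times> real) set \<Rightarrow> (real \<times> real) set" where
  "region U V = {z. snd z \<le> env U (fst z) \<and> - snd z \<le> env V (fst z)}"

text \<open>The column over an integer k holds floor F + floor G + 1 points, that is
  \<open>rho\<close> F + \<open>rho\<close> G + c, where F and G are the two envelopes and c = F + G
  is the height. The special slopes control the sawtooth sums; the sum of heights differs from the
  area by at most 4 times the Lipschitz constant 2 \<Lambda> of c.\<close>

lemma region_count: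
  assumes U: "finite U" "U \<noteq> {}" and V: "finite V" "V \<noteq> {}" and h: "h > 0" and b: "b > 0"
    and s: "\<And>l. l \<in> U \<union> V \<Longrightarrow> \<exists>a::int. fst l = (of_int a + theta h) / real b"
    and lip: "\<And>l. l \<in> U \<union> V \<Longrightarrow> \<bar>fst l\<bar> \<le> \<Lambda>"
    and supp: "\<And>z. z \<in> region U V \<Longrightarrow> \<bar>fst z - x0\<bar> \<le> X"
    and X: "0 \<le> X" and cl: "closed (region U V)"
  shows "\<bar>real (card {z. int_vec z \<in> region U V}) - measure lborel (region U V)\<bar>
    \<le> (real (card U) + real (card V)) * ((2 * X + 1) / (real h)\<^sup>2 + 3 * real b * real h) + 8 * \<Lambda>"
proof -
  define c where "c x = env U x + env V x" for x
  define K where "K = {k::int. 0 \<le> c (of_int k)}"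
  have conc: "concave_on UNIV c"
    unfolding c_def by (intro concave_on_add env_concave U V)
  have lipc: "\<bar>c x - c y\<bar> \<le> (2 * \<Lambda>) * \<bar>x - y\<bar>" for x y
    using env_lipschitz[OF U lip, of x y] env_lipschitz[OF V lip, of x y] by (simp add: c_def)
  have suppc: "\<bar>x - x0\<bar> \<le> X" if "0 \<le> c x" for x
  proof -
    have "(x, env U x) \<in> region U V" using that by (simp add: region_def c_def)
    from supp[OF this] show ?thesis by simp
  qed
  obtain I where I: "((\<lambda>x. max 0 (c x)) has_integral I) UNIV"
    "\<bar>(\<Sum>k\<in>K. c (of_int k)) - I\<bar> \<le> 4 * (2 * \<Lambda>)"
    using concave_sum_vs_integral[OF conc lipc suppc] unfolding K_def by blast
  have Kconv: "z \<in> K" if "x \<in> K" "y \<in> K" "x \<le> z" "z \<le> y" for x y z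
    using concave_nonneg_between[OF conc, of "of_int x" "of_int y" "of_int z"] that by (simp add: K_def)
  have Ksub: "K \<subseteq> {\<lceil>x0 - X\<rceil>..\<lfloor>x0 + X\<rfloor>}"
  proof
    fix k assume "k \<in> K"
    then have "\<bar>of_int k - x0\<bar> \<le> X" using suppc by (simp add: K_def)
    then show "k \<in> {\<lceil>x0 - X\<rceil>..\<lfloor>x0 + X\<rfloor>}" by (simp add: abs_le_iff ceiling_le_iff le_floor_iff)
  qed
  then have Kfin: "finite K" using finite_subset by blast
  have cardK: "real (card K) \<le> 2 * X + 1" if "K \<noteq> {}"
  proof -
    have "card K \<le> card {\<lceil>x0 - X\<rceil>..\<lfloor>x0 + X\<rfloor>}" by (rule card_mono) (use Ksub in auto)
    moreover have "{\<lceil>x0 - X\<rceil>..\<lfloor>x0 + X\<rfloor>} \<noteq> {}" using that Ksub by auto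
    then have "real (card {\<lceil>x0 - X\<rceil>..\<lfloor>x0 + X\<rfloor>}) = of_int (\<lfloor>x0 + X\<rfloor> - \<lceil>x0 - X\<rceil> + 1)" by simp
    moreover have "real_of_int (\<lfloor>x0 + X\<rfloor> - \<lceil>x0 - X\<rceil> + 1) \<le> 2 * X + 1" by simp linarith
    ultimately show ?thesis by (metis of_nat_mono order_trans)
  qed
  let ?F = "\<lambda>k::int. env U (of_int k)" and ?G = "\<lambda>k::int. env V (of_int k)"
  have "{z. int_vec z \<in> region U V} = Sigma K (\<lambda>k. {- \<lfloor>?G k\<rfloor>..\<lfloor>?F k\<rfloor>})"
  proof (intro equalityI subsetI)
    fix z :: "int \<times> int" assume "z \<in> {z. int_vec z \<in> region U V}"
    then have "of_int (snd z) \<le> ?F (fst z)" "- of_int (snd z) \<le> ?G (fst z)"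
      by (auto simp: region_def)
    then have "snd z \<le> \<lfloor>?F (fst z)\<rfloor>" "- snd z \<le> \<lfloor>?G (fst z)\<rfloor>" "fst z \<in> K"
      by (simp_all add: le_floor_iff K_def c_def)
    then show "z \<in> Sigma K (\<lambda>k. {- \<lfloor>?G k\<rfloor>..\<lfloor>?F k\<rfloor>})" by (cases z) auto
  next
    fix z assume "z \<in> Sigma K (\<lambda>k. {- \<lfloor>?G k\<rfloor>..\<lfloor>?F k\<rfloor>})"
    then have "snd z \<le> \<lfloor>?F (fst z)\<rfloor>" "- snd z \<le> \<lfloor>?G (fst z)\<rfloor>" by auto
    then show "z \<in> {z. int_vec z \<in> region U V}" by (auto simp: region_def le_floor_iff)
  qed
  then have "real (card {z. int_vec z \<in> region U V}) = (\<Sum>k\<in>K. real (card {- \<lfloor>?G k\<rfloor>..\<lfloor>?F k\<rfloor>}))"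
    using Kfin by simp
  also have "\<dots> = (\<Sum>k\<in>K. rho (?F k) + rho (?G k) + c (of_int k))"
  proof (rule sum.cong[OF refl])
    fix k assume "k \<in> K"
    then have "0 \<le> ?F k + ?G k" by (simp add: K_def c_def)
    \<comment> \<open>A column of height below 1 may contain no lattice point. From F + G
      nonnegative still follows floor F + floor G \<ge> -1, so the formula then returns 0 and not a
      negative number.\<close>
    then have "0 \<le> \<lfloor>?F k\<rfloor> + \<lfloor>?G k\<rfloor> + 1" by linarith
    then show "real (card {- \<lfloor>?G k\<rfloor>..\<lfloor>?F k\<rfloor>}) = rho (?F k) + rho (?G k) + c (of_int k)"
      by (simp add: rho_def c_def)
  qed
  finally have count: "real (card {z. int_vec z \<in> region U V})
      = (\<Sum>k\<in>K. rho (?F k)) + (\<Sum>k\<in>K. rho (?G k)) + (\<Sum>k\<in>K. c (of_int k))"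
    by (simp add: sum.distrib)
  let ?E = "(2 * X + 1) / (real h)\<^sup>2 + 3 * real b * real h"
  let ?E' = "real (card K) / (real h)\<^sup>2 + 3 * real b * real h"
  have rhoU: "\<bar>\<Sum>k\<in>K. rho (?F k)\<bar> \<le> real (card U) * ?E'"
    by (rule rho_sum_env[OF U h b _ Kfin Kconv]) (use s in auto)
  have rhoV: "\<bar>\<Sum>k\<in>K. rho (?G k)\<bar> \<le> real (card V) * ?E'"
    by (rule rho_sum_env[OF V h b _ Kfin Kconv]) (use s in auto)
  have "emeasure lborel (region U V) = ennreal I"
  proof -
    have "region U V \<in> sets lborel" using cl by (simp add: borel_closed)
    then have ms: "region U V \<in> sets (lborel \<Otimes>\<^sub>M lborel)" by (simp only: lborel_prod)
    have sl: "Pair x -` region U V = {- env V x..env U x}" for x by (auto simp: region_def)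
    have em: "emeasure lborel (Pair x -` region U V) = ennreal (max 0 (c x))" for x
      unfolding sl by (simp add: emeasure_lborel_Icc_eq c_def max_def add.commute)
    have "emeasure lborel (region U V) = (\<integral>\<^sup>+x. ennreal (max 0 (c x)) \<partial>lborel)"
      unfolding lborel2_prod by (subst lborel.emeasure_pair_measure_alt[OF ms]) (simp only: em)
    also have "\<dots> = ennreal I"
    proof (rule nn_integral_has_integral_lborel)
      have "continuous_on UNIV c"
        by (rule lipschitz_on_continuous_on[of "2 * \<Lambda>"], rule lipschitz_onI)
          (use lipc lipc[of 0 1] in \<open>auto simp: dist_real_def\<close>)
      then show "(\<lambda>x. max 0 (c x)) \<in> borel_measurable borel"
        by (intro borel_measurable_continuous_onI continuous_intros)
    qed (use I in auto)
    finally show ?thesis .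
  qed
  moreover have "0 \<le> I" using has_integral_nonneg[OF I(1)] by simp
  ultimately have meas: "measure lborel (region U V) = I" by (simp add: measure_def)
  have "real (card K) \<le> 2 * X + 1" using cardK X by (cases "K = {}") auto
  then have "?E' \<le> ?E" by (intro add_right_mono divide_right_mono) auto
  then have "(real (card U) + real (card V)) * ?E' \<le> (real (card U) + real (card V)) * ?E"
    by (intro mult_left_mono) auto
  then show ?thesis
    using rhoU rhoV I(2) unfolding count meas by (simp add: distrib_right abs_le_iff)
qed


section \<open>Square grids and their discrepancy for polygons\<close>

definition grid :: "nat \<Rightarrow> (real \<times> real) set" where
  "grid M = (\<lambda>i. (1 / real M) *\<^sub>R int_vec i) ` ({0..<int M} \<times> {0..<int M})"

lemma grid_point_sets:
  assumes "M > 0"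
  shows "grid M \<in> point_sets (M\<^sup>2)"
proof -
  have "inj_on (\<lambda>i. (1 / real M) *\<^sub>R int_vec i) A" for A
    using assms inj_int_vec by (auto simp: inj_on_def inj_def)
  then have "card (grid M) = M\<^sup>2"
    unfolding grid_def by (simp add: card_image card_cartesian_product power2_eq_square)
  moreover have "grid M \<subseteq> unit_sq"
    using assms by (auto simp: grid_def int_vec_def field_simps)
  ultimately show ?thesis by (simp add: point_sets_def grid_def)
qed

lemma finite_int_vec_preimage:
  assumes "bounded S"
  shows "finite {z. int_vec z \<in> S}"
proof -
  obtain B where B: "\<And>x. x \<in> S \<Longrightarrow> norm x \<le> B" using assms bounded_iff by blast
  have "{z. int_vec z \<in> S} \<subseteq> {- \<lceil>B\<rceil>..\<lceil>B\<rceil>} \<times> {- \<lceil>B\<rceil>..\<lceil>B\<rceil>}"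
  proof
    fix z assume "z \<in> {z. int_vec z \<in> S}"
    then have n: "norm (int_vec z) \<le> B" using B by auto
    have "\<bar>real_of_int (fst z)\<bar> \<le> B" "\<bar>real_of_int (snd z)\<bar> \<le> B"
      using norm_fst_le[of "real_of_int (fst z)" "real_of_int (snd z)"]
        norm_snd_le[of "real_of_int (snd z)" "real_of_int (fst z)"] n
      unfolding int_vec_def by simp_all
    then have "\<bar>fst z\<bar> \<le> \<lceil>B\<rceil>" "\<bar>snd z\<bar> \<le> \<lceil>B\<rceil>" by linarith+
    then show "z \<in> {- \<lceil>B\<rceil>..\<lceil>B\<rceil>} \<times> {- \<lceil>B\<rceil>..\<lceil>B\<rceil>}" by (auto simp: mem_Times_iff)
  qed
  then show ?thesis by (rule finite_subset) simp
qed

text \<open>Division with remainder by M writes each vector of (1/M) Z^2 uniquely as a grid point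
  plus an integer vector, so the translates of the grid form a finer lattice.\<close>

lemma grid_lattice_count:
  assumes M: "M > 0" and S: "bounded S"
  shows "(\<Sum>p\<in>grid M. lattice_count p S) = card {z. (1 / real M) *\<^sub>R int_vec z \<in> S}"
proof -
  let ?I = "{0..<int M} \<times> {0..<int M}"
  let ?g = "\<lambda>i. (1 / real M) *\<^sub>R int_vec i"
  have inj: "inj_on ?g ?I"
    using M inj_int_vec by (auto simp: inj_on_def inj_def)
  define Z where "Z i = {m. ?g i + int_vec m \<in> S}" for i
  have fin: "finite (Z i)" for i
  proof -
    have "bounded ((\<lambda>x. x - ?g i) ` S)" using S by (rule bounded_translation_minus)
    moreover have "Z i = {m. int_vec m \<in> (\<lambda>x. x - ?g i) ` S}"
      unfolding Z_def by (auto simp: image_iff algebra_simps)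
    ultimately show ?thesis using finite_int_vec_preimage by simp
  qed
  have "(\<Sum>p\<in>grid M. lattice_count p S) = (\<Sum>i\<in>?I. lattice_count (?g i) S)"
    unfolding grid_def by (subst sum.reindex[OF inj]) simp
  also have "\<dots> = (\<Sum>i\<in>?I. card (Z i))"
    by (simp add: lattice_count_def Z_def int_vec_def)
  also have "\<dots> = card (Sigma ?I Z)" using fin by simp
  also have "\<dots> = card {z. ?g z \<in> S}"
  proof (rule bij_betw_same_card)
    let ?f = "\<lambda>(i, m). (fst i + int M * fst m, snd i + int M * snd m)"
    let ?r = "\<lambda>z. ((fst z mod int M, snd z mod int M), (fst z div int M, snd z div int M))"
    have gf: "?g (?f x) = ?g (fst x) + int_vec (snd x)" for x
      using M by (cases x) (simp add: int_vec_def field_simps)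
    show "bij_betw ?f (Sigma ?I Z) {z. ?g z \<in> S}"
    proof (rule bij_betw_byWitness[where f' = ?r])
      show "\<forall>a\<in>Sigma ?I Z. ?r (?f a) = a" using M by auto
      show "\<forall>a'\<in>{z. ?g z \<in> S}. ?f (?r a') = a'" by auto
      show "?f ` Sigma ?I Z \<subseteq> {z. ?g z \<in> S}"
      proof (intro image_subsetI CollectI)
        fix x assume "x \<in> Sigma ?I Z"
        then have "?g (fst x) + int_vec (snd x) \<in> S" by (auto simp: Z_def)
        then show "?g (?f x) \<in> S" unfolding gf .
      qed
      show "?r ` {z. ?g z \<in> S} \<subseteq> Sigma ?I Z"
      proof (intro image_subsetI)
        fix z assume z: "z \<in> {z. ?g z \<in> S}"
        have "?f (?r z) = z" by simp
        then have "?g (fst (?r z)) + int_vec (snd (?r z)) \<in> S" using gf[of "?r z"] z by simp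
        then show "?r z \<in> Sigma ?I Z" using M by (auto simp: Z_def)
      qed
    qed
  qed
  finally show ?thesis .
qed

text \<open>Each slope carries one upper and one lower constraint, with outer normals (-s, 1) and
  (-s, -1), so both boundaries are graphs over the first axis. The offsets are free, since only the
  slopes matter for the floor sums.\<close>

definition poly_body :: "real set \<Rightarrow> (real \<Rightarrow> real) \<Rightarrow> (real \<Rightarrow> real) \<Rightarrow> (real \<times> real) set" where
  "poly_body S u v = {z. \<forall>s\<in>S. snd z - s * fst z \<le> u s \<and> - snd z - s * fst z \<le> v s}"

lemma closed_poly_body: "closed (poly_body S u v)"
proof -
  have "poly_body S u v = (\<Inter>s\<in>S. {z. snd z - s * fst z \<le> u s} \<inter> {z. - snd z - s * fst z \<le> v s})"
    by (auto simp: poly_body_def)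
  also have "closed \<dots>"
    by (intro closed_INT ballI closed_Int closed_Collect_le continuous_intros)
  finally show ?thesis .
qed

text \<open>Scaling by M turns the grid into Z^2 and the copy into a homothetic polygon: \<tau> and
  \<delta> move the offsets and leave the slopes unchanged. This is why the floor sums were bounded
  uniformly in their constant term.\<close>

lemma poly_body_grid_discrepancy:
  assumes S: "finite S" "S \<noteq> {}" and A: "poly_body S u v \<subseteq> cball 0 R" and R: "0 \<le> R"
    and h: "h > 0" and b: "b > 0" and M: "M > 0"
    and s: "\<And>s. s \<in> S \<Longrightarrow> \<exists>a::int. s = (of_int a + theta h) / real b"
    and lip: "\<And>s. s \<in> S \<Longrightarrow> \<bar>s\<bar> \<le> \<Lambda>" and \<delta>: "0 < \<delta>" "\<delta> \<le> 1"
  shows "\<bar>discrepancy (grid M) (homothetic_copy \<tau> \<delta> (poly_body S u v))\<bar>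
    \<le> 2 * real (card S) * ((2 * (real M * R) + 1) / (real h)\<^sup>2 + 3 * real b * real h) + 8 * \<Lambda>"
proof -
  let ?A = "poly_body S u v"
  have cA: "compact ?A"
    using A closed_poly_body bounded_subset[OF bounded_cball] compact_eq_bounded_closed by blast
  define m where "m = real M"
  have m: "m > 0" using M by (simp add: m_def)
  \<comment> \<open>The offsets result from substituting z = m (\<tau> + \<delta> w) in the
    constraints on w.\<close>
  define fU where "fU s = (s, m * \<delta> * u s + m * snd \<tau> - s * (m * fst \<tau>))" for s
  define fV where "fV s = (s, m * \<delta> * v s - m * snd \<tau> - s * (m * fst \<tau>))" for s
  define U V where "U = fU ` S" and "V = fV ` S"
  have UV: "finite U" "U \<noteq> {}" "finite V" "V \<noteq> {}" "card U = card S" "card V = card S"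
    using S by (auto simp: U_def V_def fU_def fV_def card_image inj_on_def)
  have mem: "m *\<^sub>R (\<tau> + \<delta> *\<^sub>R w) \<in> region U V \<longleftrightarrow> w \<in> ?A" for w
  proof -
    define x y where "x = fst w" and "y = snd w"
    have md: "0 < m * \<delta>" using m \<delta> by simp
    have "m * (snd \<tau> + \<delta> * y) \<le> s * (m * (fst \<tau> + \<delta> * x)) + (m * \<delta> * u s + m * snd \<tau> - s * (m * fst \<tau>))
       \<longleftrightarrow> y - s * x \<le> u s" for s
    proof -
      have "s * (m * (fst \<tau> + \<delta> * x)) + (m * \<delta> * u s + m * snd \<tau> - s * (m * fst \<tau>)) - m * (snd \<tau> + \<delta> * y)
        = (m * \<delta>) * (u s - (y - s * x))" by (simp add: algebra_simps)
      then show ?thesis using md zero_le_mult_iff[of "m * \<delta>" "u s - (y - s * x)"] by linarith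
    qed
    moreover have "- (m * (snd \<tau> + \<delta> * y)) \<le> s * (m * (fst \<tau> + \<delta> * x)) + (m * \<delta> * v s - m * snd \<tau> - s * (m * fst \<tau>))
       \<longleftrightarrow> - y - s * x \<le> v s" for s
    proof -
      have "s * (m * (fst \<tau> + \<delta> * x)) + (m * \<delta> * v s - m * snd \<tau> - s * (m * fst \<tau>)) + m * (snd \<tau> + \<delta> * y)
        = (m * \<delta>) * (v s - (- y - s * x))" by (simp add: algebra_simps)
      then show ?thesis using md zero_le_mult_iff[of "m * \<delta>" "v s - (- y - s * x)"] by linarith
    qed
    ultimately show ?thesis
      unfolding region_def poly_body_def
      by (simp add: le_env_iff UV(1-4)) (auto simp: U_def V_def fU_def fV_def x_def y_def)
  qed
  have mem': "z \<in> region U V \<longleftrightarrow> (1 / m) *\<^sub>R z \<in> homothetic_copy \<tau> \<delta> ?A" for z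
  proof -
    define w where "w = (1 / \<delta>) *\<^sub>R ((1 / m) *\<^sub>R z - \<tau>)"
    have tw: "\<tau> + \<delta> *\<^sub>R w = (1 / m) *\<^sub>R z" using \<delta> by (simp add: w_def)
    then have "z = m *\<^sub>R (\<tau> + \<delta> *\<^sub>R w)" using m by simp
    then have "z \<in> region U V \<longleftrightarrow> w \<in> ?A" using mem by simp
    also have "\<dots> \<longleftrightarrow> (1 / m) *\<^sub>R z \<in> homothetic_copy \<tau> \<delta> ?A"
      unfolding homothetic_copy_def tw[symmetric] using \<delta> by (auto simp: image_iff)
    finally show ?thesis .
  qed
  have "region U V = (\<lambda>x. m *\<^sub>R x) ` homothetic_copy \<tau> \<delta> ?A"
  proof (intro equalityI subsetI)
    fix z assume "z \<in> region U V"
    then have "(1 / m) *\<^sub>R z \<in> homothetic_copy \<tau> \<delta> ?A" "z = m *\<^sub>R ((1 / m) *\<^sub>R z)"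
      using mem' m by simp_all
    then show "z \<in> (\<lambda>x. m *\<^sub>R x) ` homothetic_copy \<tau> \<delta> ?A" by blast
  qed (use mem' m in auto)
  also have "\<dots> = homothetic_copy (m *\<^sub>R \<tau>) (m * \<delta>) ?A"
    unfolding homothetic_copy_def image_image by (simp add: scaleR_right_distrib)
  finally have reg: "region U V = homothetic_copy (m *\<^sub>R \<tau>) (m * \<delta>) ?A" .
  have comp: "compact (homothetic_copy t d ?A)" for t d
    using compact_affinity[OF cA, of t d] by (simp add: homothetic_copy_def)
  have main: "\<bar>real (card {z. int_vec z \<in> region U V}) - measure lborel (region U V)\<bar>
    \<le> (real (card U) + real (card V)) * ((2 * (m * R) + 1) / (real h)\<^sup>2 + 3 * real b * real h) + 8 * \<Lambda>"
  proof (rule region_count[OF UV(1-4) h b])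
    show "\<exists>a::int. fst l = (of_int a + theta h) / real b" if "l \<in> U \<union> V" for l
      using that s by (auto simp: U_def V_def fU_def fV_def)
    show "\<bar>fst l\<bar> \<le> \<Lambda>" if "l \<in> U \<union> V" for l
      using that lip by (auto simp: U_def V_def fU_def fV_def)
    show "\<bar>fst z - m * fst \<tau>\<bar> \<le> m * R" if zr: "z \<in> region U V" for z
    proof -
      obtain w where w: "w \<in> ?A" "z = m *\<^sub>R \<tau> + (m * \<delta>) *\<^sub>R w"
        using zr unfolding reg homothetic_copy_def by blast
      have "\<bar>fst w\<bar> \<le> norm w" using norm_fst_le[of "fst w" "snd w"] by simp
      also have "\<dots> \<le> R" using A w by auto
      finally have "\<delta> * \<bar>fst w\<bar> \<le> 1 * R" using \<delta> by (intro mult_mono) auto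
      then have "m * (\<delta> * \<bar>fst w\<bar>) \<le> m * R" using m by simp
      then show ?thesis using w m \<delta> by (simp add: abs_mult mult.assoc)
    qed
    show "closed (region U V)" unfolding reg using comp compact_imp_closed by blast
    show "0 \<le> m * R" using m R by simp
  qed
  have "(\<Sum>p\<in>grid M. real (lattice_count p (homothetic_copy \<tau> \<delta> ?A))) = real (card {z. int_vec z \<in> region U V})"
  proof -
    have "{z. int_vec z \<in> region U V} = {z. (1 / real M) *\<^sub>R int_vec z \<in> homothetic_copy \<tau> \<delta> ?A}"
      unfolding mem' by (simp add: m_def)
    moreover have "bounded (homothetic_copy \<tau> \<delta> ?A)" using comp compact_imp_bounded by blast
    ultimately have "(\<Sum>p\<in>grid M. lattice_count p (homothetic_copy \<tau> \<delta> ?A)) = card {z. int_vec z \<in> region U V}"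
      using grid_lattice_count[OF M] by simp
    then show ?thesis by (metis of_nat_sum)
  qed
  moreover have "real (card (grid M)) * measure lborel (homothetic_copy \<tau> \<delta> ?A) = measure lborel (region U V)"
    using grid_point_sets[OF M]
    by (simp add: reg measure_homothetic[OF cA] point_sets_def m_def power2_eq_square)
  ultimately show ?thesis
    using main unfolding discrepancy_def UV(5,6) by (simp add: m_def)
qed

text \<open>The lattice of mesh \<open>h\<^sup>-\<^sup>3\<close> sees the slopes as \<open>(a + 1/h + 1/h\<^sup>2) / b\<close>: the two scales
  \<open>h\<close> and \<open>h\<^sup>2\<close> between \<open>1\<close> and \<open>h\<^sup>3\<close> keep every floor sum of size \<open>O(h)\<close>.\<close>

lemma min_quad_poly_body:
  assumes S: "finite S" "S \<noteq> {}" and A: "poly_body S u v \<subseteq> cball 0 (real K)"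
    and h: "h > 0" and b: "b > 0"
    and s: "\<And>s. s \<in> S \<Longrightarrow> \<exists>a::int. s = (of_int a + theta h) / real b"
    and lip: "\<And>s. s \<in> S \<Longrightarrow> \<bar>s\<bar> \<le> \<Lambda>" and \<Lambda>: "0 \<le> \<Lambda>" and cS: "real (card S) \<le> n"
  shows "min_quad_discrepancy (poly_body S u v) (h ^ 6)
    \<le> ((2 * n * (2 * real K + 1 + 3 * real b) + 8 * \<Lambda>) * real h)\<^sup>2"
proof -
  let ?A = "poly_body S u v" and ?M = "h ^ 3"
  have cA: "compact ?A"
    using A closed_poly_body bounded_subset[OF bounded_cball] compact_eq_bounded_closed by blast
  have M: "?M > 0" using h by simp
  have n0: "0 \<le> n" using cS by linarith
  have sq: "?M\<^sup>2 = h ^ 6" by (simp flip: power_mult)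
  have G: "grid ?M \<in> point_sets (h ^ 6)" using grid_point_sets[OF M] by (simp only: sq)
  have "min_quad_discrepancy ?A (h ^ 6) \<le> quad_discrepancy (grid ?M) ?A"
    by (rule min_quad_le[OF G])
  also have "\<dots> \<le> ((2 * n * (2 * real K + 1 + 3 * real b) + 8 * \<Lambda>) * real h)\<^sup>2"
  proof (rule quad_discrepancy_upper[OF cA A])
    show "grid ?M \<subseteq> unit_sq" using G by (simp add: point_sets_def)
    fix \<delta> \<tau> assume \<delta>: "0 < \<delta>" "\<delta> \<le> (1::real)"
    have h1: "1 \<le> real h" using h by simp
    have "(2 * (real ?M * real K) + 1) / (real h)\<^sup>2 = 2 * real K * real h + 1 / (real h)\<^sup>2"
      using h by (simp add: field_simps power2_eq_square power3_eq_cube)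
    also have "\<dots> \<le> 2 * real K * real h + real h"
    proof -
      have "1 / (real h)\<^sup>2 \<le> 1" using h1 by simp
      then show ?thesis using h1 by linarith
    qed
    finally have e: "(2 * (real ?M * real K) + 1) / (real h)\<^sup>2 + 3 * real b * real h
        \<le> (2 * real K + 1 + 3 * real b) * real h"
      by (simp add: algebra_simps)
    have "\<bar>discrepancy (grid ?M) (homothetic_copy \<tau> \<delta> ?A)\<bar>
      \<le> 2 * real (card S) * ((2 * (real ?M * real K) + 1) / (real h)\<^sup>2 + 3 * real b * real h) + 8 * \<Lambda>"
      by (rule poly_body_grid_discrepancy[OF S A _ h b M s lip \<delta>]) auto
    also have "\<dots> \<le> 2 * n * ((2 * real K + 1 + 3 * real b) * real h) + 8 * (\<Lambda> * real h)"
      using e cS n0 \<Lambda> h1 by (intro add_mono mult_mono) (auto simp: mult_le_cancel_left1 intro!: add_nonneg_nonneg)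
    finally show "\<bar>discrepancy (grid ?M) (homothetic_copy \<tau> \<delta> ?A)\<bar>
      \<le> (2 * n * (2 * real K + 1 + 3 * real b) + 8 * \<Lambda>) * real h"
      by (simp add: algebra_simps)
  qed
  finally show ?thesis .
qed

section \<open>Fourier coefficients of round bodies\<close>

lemma Icc_integrable:
  fixes f :: "real \<Rightarrow> real"
  assumes "f \<in> borel_measurable borel" "\<And>x. x \<in> {a..b} \<Longrightarrow> \<bar>f x\<bar> \<le> B"
  shows "set_integrable lborel {a..b} f"
  by (rule set_integrable_bounded[where B = B]) (use assms in \<open>auto simp: emeasure_lborel_Icc_eq\<close>)

lemma Icc_integral_split:
  fixes f :: "real \<Rightarrow> real"
  assumes f: "set_integrable lborel {a..c} f" and "a \<le> b" "b \<le> c"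
  shows "(LINT x:{a..c}|lborel. f x) = (LINT x:{a..b}|lborel. f x) + (LINT x:{b..c}|lborel. f x)"
proof -
  have "{a..c} = {a..b} \<union> {b..c}" using assms by auto
  moreover have "AE x in lborel. (x::real) \<noteq> b" by (rule AE_lborel_singleton)
  then have "AE x in lborel. \<not> (x \<in> {a..b} \<and> x \<in> {b..c})"
    by (rule AE_mp) (auto intro!: AE_I2)
  moreover have "set_integrable lborel {a..b} f" "set_integrable lborel {b..c} f"
    using assms by (auto intro: set_integrable_subset)
  ultimately show ?thesis by (simp add: set_integral_Un_AE)
qed

lemma Icc_integral_shift:
  fixes f :: "real \<Rightarrow> real"
  shows "(LINT x:{t + a..t + b}|lborel. f x) = (LINT x:{a..b}|lborel. f (t + x))"
  unfolding set_lebesgue_integral_def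
  by (subst lborel_integral_real_affine[of 1 _ t])
    (auto intro!: Bochner_Integration.integral_cong simp: indicator_def)

lemma Icc_integral_reflect:
  fixes f :: "real \<Rightarrow> real"
  shows "(LINT x:{t - b..t - a}|lborel. f x) = (LINT x:{a..b}|lborel. f (t - x))"
  unfolding set_lebesgue_integral_def
  by (subst lborel_integral_real_affine[of "-1" _ t])
    (auto intro!: Bochner_Integration.integral_cong simp: indicator_def)

lemma concave_three_slopes:
  fixes f :: "real \<Rightarrow> real"
  assumes f: "concave_on S f" and S: "x \<in> S" "z \<in> S" and xy: "x < y" "y < z"
  shows "(f z - f y) / (z - y) \<le> (f y - f x) / (y - x)"
proof -
  define t where "t = (y - x) / (z - x)"
  have t: "0 \<le> t" "t \<le> 1" and tz: "t * (z - x) = y - x" using xy by (auto simp: t_def)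
  have "(1 - t) *\<^sub>R x + t *\<^sub>R z = x + t * (z - x)" by (simp add: algebra_simps)
  then have "(1 - t) * f x + t * f z \<le> f y"
    using concave_onD[OF f t S] tz by simp
  then have "(z - x) * (f x + t * (f z - f x)) \<le> (z - x) * f y"
    using xy by (intro mult_left_mono) (auto simp: algebra_simps)
  moreover have "(z - x) * (f x + t * (f z - f x)) = (z - x) * f x + (t * (z - x)) * (f z - f x)"
    by (simp add: algebra_simps)
  ultimately have "(z - x) * f x + (y - x) * (f z - f x) \<le> (z - x) * f y" unfolding tz by simp
  then have "(f z - f y) * (y - x) \<le> (f y - f x) * (z - y)" by (simp add: algebra_simps)
  then show ?thesis using xy by (simp add: pos_divide_le_eq pos_le_divide_eq)
qed

lemma concave_slopes:
  fixes f :: "real \<Rightarrow> real"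
  assumes f: "concave_on S f" and S: "x \<in> S" "y \<in> S" "z \<in> S" "w \<in> S" and xy: "x < y" "y \<le> z" "z < w"
  shows "(f w - f z) / (w - z) \<le> (f y - f x) / (y - x)"
proof (cases "y = z")
  case True
  then show ?thesis using concave_three_slopes[OF f S(1,4)] xy by simp
next
  case False
  then show ?thesis
    using concave_three_slopes[OF f S(1,3), of y] concave_three_slopes[OF f S(2,4), of z] xy by simp
qed

text \<open>Folding a period of the cosine twice turns the integral into one of the second difference
  \<open>f v - f (1/2 - v) - f (1/2 + v) + f (1 - v)\<close>, which is nonpositive by concavity.\<close>

lemma concave_cos_period:
  fixes f :: "real \<Rightarrow> real"
  assumes f: "concave_on {0..1} f" and m: "f \<in> borel_measurable borel" and B: "\<And>x. \<bar>f x\<bar> \<le> B"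
    and a: "0 \<le> a" "a \<le> 1 / 6" and g: "0 \<le> g"
    and gap: "\<And>v. 0 \<le> v \<Longrightarrow> v \<le> a \<Longrightarrow> f v - f (v + 1 / 2) - f (1 / 2 - v) + f (1 - v) \<le> - g"
  shows "(LINT v:{0..1}|lborel. f v * cos (2 * pi * v)) \<le> - (g * a / 4)"
proof -
  let ?c = "\<lambda>v. cos (2 * pi * v)"
  define E where "E v = f v - f (v + 1 / 2) - f (1 / 2 - v) + f (1 - v)" for v
  have cm: "?c \<in> borel_measurable borel" by (intro borel_measurable_continuous_onI continuous_intros)
  have fm: "(\<lambda>v. f (p + q * v)) \<in> borel_measurable borel" for p q
    by (rule measurable_compose[OF _ m]) (intro borel_measurable_continuous_onI continuous_intros)
  have bound: "\<bar>x * ?c y\<bar> \<le> C" if "\<bar>x\<bar> \<le> C" for x y C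
    using that abs_cos_le_one[of "2 * pi * y"] mult_mono[of "\<bar>x\<bar>" C "\<bar>?c y\<bar>" 1]
    by (simp add: abs_mult)
  have I0: "set_integrable lborel {x..y} (\<lambda>v. f v * ?c v)" for x y
    by (rule Icc_integrable[where B = B]) (auto intro!: borel_measurable_times m cm bound B)
  have I1: "set_integrable lborel {x..y} (\<lambda>v. f (p + q * v) * ?c v)" for x y p q
    by (rule Icc_integrable[where B = B]) (auto intro!: borel_measurable_times fm cm bound B)
  let ?I = "LINT v:{0..1}|lborel. f v * ?c v"
  define G where "G v = f (0 + 1 * v) - f (1 / 2 + 1 * v)" for v
  have Gm: "G \<in> borel_measurable borel" unfolding G_def by (intro borel_measurable_diff fm)
  have Gb: "\<bar>G v\<bar> \<le> 2 * B" for v unfolding G_def using B[of v] B[of "1 / 2 + v"] by simp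
  have "?I = (LINT v:{0..1/2}|lborel. f v * ?c v) + (LINT v:{1/2 + 0..1/2 + 1/2}|lborel. f v * ?c v)"
    using Icc_integral_split[OF I0, of 0 "1/2" 1] by simp
  also have "(LINT v:{1/2 + 0..1/2 + 1/2}|lborel. f v * ?c v)
      = (LINT v:{0..1/2}|lborel. - (f (1 / 2 + 1 * v) * ?c v))"
    unfolding Icc_integral_shift by (simp add: distrib_left cos_add)
  also have "\<dots> = - (LINT v:{0..1/2}|lborel. f (1 / 2 + 1 * v) * ?c v)"
    by (simp add: set_lebesgue_integral_def)
  finally have "?I = (LINT v:{0..1/2}|lborel. f (0 + 1 * v) * ?c v) - (LINT v:{0..1/2}|lborel. f (1 / 2 + 1 * v) * ?c v)"
    by simp
  also have "\<dots> = (LINT v:{0..1/2}|lborel. f (0 + 1 * v) * ?c v - f (1 / 2 + 1 * v) * ?c v)"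
    by (rule set_integral_diff(2)[symmetric]) (rule I1)+
  finally have IG: "?I = (LINT v:{0..1/2}|lborel. G v * ?c v)"
    by (simp only: G_def left_diff_distrib)
  have "(LINT v:{0..1/2}|lborel. G v * ?c v) = (LINT v:{1/2 - 1/2..1/2 - 0}|lborel. G v * ?c v)"
    by simp
  also have "\<dots> = (LINT v:{0..1/2}|lborel. - (G (1/2 - v) * ?c v))"
    unfolding Icc_integral_reflect by (simp add: right_diff_distrib cos_diff)
  finally have IG': "?I = (LINT v:{0..1/2}|lborel. - (G (1/2 - v) * ?c v))" using IG by simp
  have J: "set_integrable lborel {0..1/2} (\<lambda>v. G v * ?c v)"
    by (rule Icc_integrable[where B = "2 * B"]) (auto intro!: borel_measurable_times Gm cm bound Gb)
  have "(\<lambda>v. G (1/2 - v)) \<in> borel_measurable borel"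
    by (rule measurable_compose[OF _ Gm]) (intro borel_measurable_continuous_onI continuous_intros)
  then have J': "set_integrable lborel {0..1/2} (\<lambda>v. - (G (1/2 - v) * ?c v))"
    by (intro Icc_integrable[where B = "2 * B"]) (auto intro!: borel_measurable_times borel_measurable_uminus cm bound Gb)
  have "2 * ?I = (LINT v:{0..1/2}|lborel. G v * ?c v + - (G (1/2 - v) * ?c v))"
    using set_integral_add(2)[OF J J'] IG IG' by simp
  also have "\<dots> = (LINT v:{0..1/2}|lborel. E v * ?c v)"
    by (rule arg_cong[of _ _ "\<lambda>F. LINT v:{0..1/2}|lborel. F v"])
      (auto simp: fun_eq_iff G_def E_def algebra_simps)
  also have "\<dots> \<le> (LINT v:{0..1/2}|lborel. - (g / 2) * indicator {0..a} v)"
  proof (rule set_integral_mono)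
    show "set_integrable lborel {0..1/2} (\<lambda>v. E v * ?c v)"
      using set_integral_add(1)[OF J J'] by (simp add: G_def E_def algebra_simps)
    show "set_integrable lborel {0..1/2} (\<lambda>v. - (g / 2) * indicator {0..a} v)"
      by (rule Icc_integrable[where B = "g / 2"]) (use g in \<open>auto simp: indicator_def\<close>)
    fix v :: real assume v: "v \<in> {0..1/2}"
    \<comment> \<open>The secants over [v, 1/2 - v] and [v + 1/2, 1 - v] have equal length, and the
      later one is not steeper. Beyond 1/4 the sign of E is reversed, as E (1/2 - v) = - E v, but
      there the cosine is nonpositive, so the product stays nonpositive.\<close>
    have neg: "E v \<le> 0" if "0 \<le> v" "v \<le> 1 / 4" for v
    proof (cases "v = 1 / 4")
      case True
      show ?thesis unfolding True E_def by simp
    next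
      case False
      then have "(f (1 - v) - f (v + 1 / 2)) / ((1 - v) - (v + 1 / 2)) \<le> (f (1 / 2 - v) - f v) / ((1 / 2 - v) - v)"
        using that by (intro concave_slopes[OF f]) auto
      moreover have "(1 - v) - (v + 1 / 2) = (1 / 2 - v) - v" by simp
      ultimately show ?thesis using that False by (simp add: E_def divide_le_cancel)
    qed
    show "E v * ?c v \<le> - (g / 2) * indicator {0..a} v"
    proof (cases "v \<le> 1 / 4")
      case True
      have "0 \<le> 2 * pi * v" using v by simp
      moreover have "2 * pi * v \<le> 2 * pi * (1 / 4)" using True by (intro mult_left_mono) auto
      ultimately have c0: "0 \<le> ?c v" using pi_gt_zero by (intro cos_ge_zero) linarith+
      show ?thesis
      proof (cases "v \<le> a")
        case va: True
        \<comment> \<open>The bound 1/6 on a keeps the angle within pi/3, where the cosine is at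
          least 1/2.\<close>
        have "cos (pi / 3) \<le> ?c v"
          using v va a by (intro cos_monotone_0_pi_le) auto
        then have c1: "1 / 2 \<le> ?c v" by (simp add: cos_60)
        have "E v \<le> - g" using gap[of v] v va by (simp add: E_def)
        then have "E v * ?c v \<le> - g * ?c v" using c0 by (rule mult_right_mono)
        also have "\<dots> \<le> - g * (1 / 2)" using c1 g by (intro mult_left_mono_neg) auto
        finally show ?thesis using va v by simp
      next
        case False
        then show ?thesis using mult_nonpos_nonneg[OF neg[of v] c0] v True by simp
      qed
    next
      case False
      have "E (1 / 2 - v) \<le> 0" using neg[of "1 / 2 - v"] v False by simp
      then have E0: "0 \<le> E v" by (simp add: E_def algebra_simps)
      have "0 \<le> cos (pi - 2 * pi * v)" using v False by (intro cos_ge_zero) (auto simp: field_simps)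
      then have "?c v \<le> 0" by (simp add: cos_diff)
      then have "E v * ?c v \<le> 0" using E0 by (rule mult_nonneg_nonpos[rotated])
      then show ?thesis using False a by (simp add: indicator_def)
    qed
  qed
  also have "\<dots> = - (g / 2) * a"
  proof -
    have "indicat_real {0..1/2} v *\<^sub>R (- (g / 2) * indicat_real {0..a} v) = - (g / 2) * indicat_real {0..a} v" for v
      using a by (auto simp: indicator_def)
    then have "(LINT v:{0..1/2}|lborel. - (g / 2) * indicator {0..a} v)
        = (\<integral>v. - (g / 2) * indicat_real {0..a} v \<partial>lborel)"
      unfolding set_lebesgue_integral_def by (simp only:)
    also have "\<dots> = - (g / 2) * a" using a by simp
    finally show ?thesis .
  qed
  finally show ?thesis by simp
qed

text \<open>\<kappa> models a chord length, with square-root behaviour at both ends. By concavity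
  full periods contribute at most 0; the steep start brings the first one down to - 4 c2 \<theta>;
  the remainder has length at most \<theta>, and \<kappa> is at most c2 there, so it adds at most c2
  \<theta>. Hence the condition on the fractional part of L.\<close>

lemma concave_cos_integral:
  fixes \<kappa> :: "real \<Rightarrow> real"
  assumes c: "0 < c1" "c1 \<le> c2" and e: "0 < e" "8 * c2 * e \<le> c1"
    and conc: "concave_on {0..L} \<kappa>" and m: "\<kappa> \<in> borel_measurable borel" and B: "\<And>x. \<bar>\<kappa> x\<bar> \<le> B"
    and pos: "\<And>v. 0 \<le> \<kappa> v"
    and up: "\<And>v. 0 \<le> v \<Longrightarrow> v \<le> L \<Longrightarrow> \<kappa> v \<le> c2 * sqrt v"
    and up': "\<And>v. 0 \<le> v \<Longrightarrow> v \<le> L \<Longrightarrow> \<kappa> v \<le> c2 * sqrt (L - v)"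
    and lo: "c1 * e \<le> \<kappa> (e\<^sup>2)" and L: "1 \<le> L"
  defines "\<theta> \<equiv> (c1 / c2)^3 * e^3 / 512"
  assumes fr: "L - of_int \<lfloor>L\<rfloor> \<le> \<theta>"
  shows "(LINT v:{0..L}|lborel. \<kappa> v * cos (2 * pi * v)) \<le> - (c2 * \<theta>)"
proof -
  let ?c = "\<lambda>v. cos (2 * pi * v)"
  have c2: "0 < c2" using c by linarith
  have e8: "e \<le> 1 / 8"
  proof -
    have "c2 * (8 * e) = 8 * c2 * e" by simp
    then have "c2 * (8 * e) \<le> c2 * 1" using e c by linarith
    then have "8 * e \<le> 1" using c2 by (rule mult_left_le_imp_le)
    then show ?thesis by simp
  qed
  define \<rho> where "\<rho> = c1 / c2"
  have \<rho>: "0 < \<rho>" "\<rho> \<le> 1" "c2 * \<rho> = c1" using c c2 by (auto simp: \<rho>_def)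
  \<comment> \<open>Chosen so that c2 * sqrt a = c1 * e / 4: up to a, \<kappa> is at most a quarter
    of its guaranteed value c1 * e at e^2.\<close>
  define a where "a = (e * \<rho> / 4)\<^sup>2"
  have er: "e * \<rho> \<le> e" using e \<rho> by simp
  have a_le: "a \<le> (e / 4)\<^sup>2" unfolding a_def using er e \<rho> by (intro power_mono) auto
  have e2: "e\<^sup>2 \<le> 1 / 64"
    using power_mono[OF e8, of 2] e by (simp add: power2_eq_square)
  have a: "0 < a" "a \<le> e\<^sup>2 / 16"
    using a_le e \<rho> by (auto simp: a_def power2_eq_square)
  have a6: "a \<le> 1 / 6" using a(2) e2 by linarith
  have cm: "?c \<in> borel_measurable borel" by (intro borel_measurable_continuous_onI continuous_intros)
  have bound: "\<bar>x * ?c y\<bar> \<le> C" if "\<bar>x\<bar> \<le> C" for x y C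
    using that abs_cos_le_one[of "2 * pi * y"] mult_mono[of "\<bar>x\<bar>" C "\<bar>?c y\<bar>" 1]
    by (simp add: abs_mult)
  have I: "set_integrable lborel {x..y} (\<lambda>v. \<kappa> v * ?c v)" for x y
    by (rule Icc_integrable[where B = B]) (auto intro!: borel_measurable_times m cm bound B)
  have first: "(LINT v:{0..1}|lborel. \<kappa> v * ?c v) \<le> - (c1 * e / 2 * a / 4)"
  proof (rule concave_cos_period[OF _ m B])
    show c01: "concave_on {0..1} \<kappa>" using conc L convex_on_subset[of "{0..L}" _ "{0..1}"] by (auto simp: concave_on_def)
    fix v assume v: "0 \<le> v" "v \<le> a"
    have ve: "v \<le> e\<^sup>2 / 16" using v a by linarith
    \<comment> \<open>The slope \<sigma> of the late secant bounds the slope over [e^2, 1/2 - v]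
      from below, so the second difference is at most \<kappa> v - \<kappa> (e^2) + \<sigma> (e^2 -
      v). The last term is at most c1 e / 4, because \<sigma> \<le> 2 c2 and 8 c2 e \<le> c1; the
      total is at most - c1 e / 2.\<close>
    define \<sigma> where "\<sigma> = (\<kappa> (1 - v) - \<kappa> (1 / 2 + v)) / ((1 - v) - (1 / 2 + v))"
    have d: "0 < e\<^sup>2" using e by simp
    have kv: "\<kappa> v \<le> c1 * e / 4"
    proof -
      have "sqrt v \<le> sqrt a" using v by simp
      also have "\<dots> = e * \<rho> / 4" unfolding a_def using e \<rho> by (simp add: real_sqrt_abs)
      finally have "c2 * sqrt v \<le> c2 * (e * \<rho> / 4)" using c2 by (intro mult_left_mono) auto
      also have "\<dots> = (c2 * \<rho>) * e / 4" by simp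
      also have "\<dots> = c1 * e / 4" unfolding \<rho>(3) ..
      finally show ?thesis using up[of v] v a a6 L by linarith
    qed
    have s1: "\<sigma> \<le> (\<kappa> (1 / 2 - v) - \<kappa> (e\<^sup>2)) / ((1 / 2 - v) - e\<^sup>2)"
      unfolding \<sigma>_def using v ve e2 by (intro concave_slopes[OF c01]) auto
    have s2: "\<sigma> \<le> 2 * c2"
    proof -
      have "\<sigma> \<le> (\<kappa> (1 / 2 + v) - \<kappa> 0) / ((1 / 2 + v) - 0)"
        unfolding \<sigma>_def using v ve e2 by (intro concave_slopes[OF c01]) auto
      also have "\<dots> \<le> (c2 * sqrt (1 / 2 + v)) / (1 / 2 + v)"
        using v ve e2 L c2 pos[of 0] up[of "1 / 2 + v"]
        by (intro frac_le) (auto intro!: mult_nonneg_nonneg)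
      also have "\<dots> \<le> 2 * c2"
      proof -
        have "sqrt (1 / 2 + v) \<le> 1" using v ve e2 by simp
        also have "1 \<le> 2 * (1 / 2 + v)" using v by simp
        finally have "sqrt (1 / 2 + v) \<le> 2 * (1 / 2 + v)" .
        then have "c2 * sqrt (1 / 2 + v) \<le> c2 * (2 * (1 / 2 + v))" using c2 by (intro mult_left_mono) auto
        then have "c2 * sqrt (1 / 2 + v) \<le> 2 * c2 * (1 / 2 + v)" by (simp only: mult_ac)
        then show ?thesis using v by (simp only: pos_divide_le_eq)
      qed
      finally show ?thesis .
    qed
    have pd: "0 < (1 / 2 - v) - e\<^sup>2" "0 \<le> e\<^sup>2 - v" using ve e2 d by linarith+
    have "\<sigma> * ((1 / 2 - v) - e\<^sup>2) \<le> \<kappa> (1 / 2 - v) - \<kappa> (e\<^sup>2)"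
      using s1 pd by (simp add: pos_le_divide_eq)
    moreover have "\<kappa> (1 - v) - \<kappa> (1 / 2 + v) = \<sigma> * ((1 - v) - (1 / 2 + v))"
      using ve e2 by (simp add: \<sigma>_def)
    moreover have "\<sigma> * (e\<^sup>2 - v) \<le> c1 * e / 4"
    proof -
      have "\<sigma> * (e\<^sup>2 - v) \<le> (2 * c2) * (e\<^sup>2 - v)" using s2 pd by (intro mult_right_mono) auto
      also have "\<dots> \<le> (2 * c2) * e\<^sup>2" using v c2 by (intro mult_left_mono) auto
      also have "\<dots> = (8 * c2 * e) * (e / 4)" by (simp add: power2_eq_square)
      also have "\<dots> \<le> c1 * (e / 4)" using e by (intro mult_right_mono) auto
      finally show ?thesis by simp
    qed
    ultimately show "\<kappa> v - \<kappa> (v + 1 / 2) - \<kappa> (1 / 2 - v) + \<kappa> (1 - v) \<le> - (c1 * e / 2)"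
      using lo kv by (simp add: algebra_simps)
  qed (use a a6 c e in auto)
  define n where "n = nat \<lfloor>L\<rfloor>"
  have n: "1 \<le> n" "real n \<le> L" "L - real n \<le> \<theta>" using L fr by (auto simp: n_def le_nat_floor)
  have per: "(LINT v:{0..real k}|lborel. \<kappa> v * ?c v) \<le> - (c1 * e / 2 * a / 4)" if "1 \<le> k" "k \<le> n" for k
    using that
  proof (induction k rule: nat_induct_at_least)
    case base
    then show ?case using first by simp
  next
    case (Suc k)
    have "(LINT v:{real k + 0..real k + 1}|lborel. \<kappa> v * ?c v)
        = (LINT v:{0..1}|lborel. \<kappa> (real k + v) * ?c v)"
    proof -
      have "cos (2 * pi * (real k + v)) = ?c v" for v
      proof -
        have "2 * pi * (real k + v) = 2 * pi * v + (2 * pi) * of_int (int k)"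
          by (simp add: algebra_simps)
        then show ?thesis by (simp only: cos_add cos_int_2pin sin_int_2pin)
      qed
      then show ?thesis unfolding Icc_integral_shift by simp
    qed
    \<comment> \<open>The period lemma with a = g = 0: later periods need only the sign.\<close>
    also have "\<dots> \<le> - (0 * 0 / 4)"
    proof (rule concave_cos_period)
      show "concave_on {0..1} (\<lambda>v. \<kappa> (real k + v))"
        unfolding concave_on_iff
      proof (intro conjI ballI allI impI)
        fix x y u w :: real
        assume xy: "x \<in> {0..1}" "y \<in> {0..1}" and uw: "0 \<le> u" "0 \<le> w" "u + w = 1"
        have kL: "real k + 1 \<le> L" using Suc n by linarith
        have "u * \<kappa> (real k + x) + w * \<kappa> (real k + y) \<le> \<kappa> (u *\<^sub>R (real k + x) + w *\<^sub>R (real k + y))"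
          using conc xy uw kL unfolding concave_on_iff by auto
        also have "u *\<^sub>R (real k + x) + w *\<^sub>R (real k + y) = (u + w) * real k + (u *\<^sub>R x + w *\<^sub>R y)"
          by (simp add: algebra_simps)
        finally show "u * \<kappa> (real k + x) + w * \<kappa> (real k + y) \<le> \<kappa> (real k + (u *\<^sub>R x + w *\<^sub>R y))"
          using uw by simp
      qed simp
      show "(\<lambda>v. \<kappa> (real k + v)) \<in> borel_measurable borel"
        by (rule measurable_compose[OF _ m]) (intro borel_measurable_continuous_onI continuous_intros)
      show "\<bar>\<kappa> (real k + v)\<bar> \<le> B" for v by (rule B)
      fix v :: real assume v: "0 \<le> v" "v \<le> 0"
      then show "\<kappa> (real k + v) - \<kappa> (real k + (v + 1 / 2)) - \<kappa> (real k + (1 / 2 - v)) + \<kappa> (real k + (1 - v)) \<le> - 0"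
      proof -
        have kL: "real k + 1 \<le> L" using Suc n by linarith
        have "(\<kappa> (real k + 1) - \<kappa> (real k + 1/2)) / ((real k + 1) - (real k + 1/2))
          \<le> (\<kappa> (real k + 1/2) - \<kappa> (real k + 0)) / ((real k + 1/2) - (real k + 0))"
          using kL by (intro concave_slopes[OF conc]) auto
        then show ?thesis using v by simp
      qed
    qed auto
    finally have "(LINT v:{real k..real (Suc k)}|lborel. \<kappa> v * ?c v) \<le> 0" by (simp add: add.commute)
    then show ?case using Suc Icc_integral_split[OF I, of 0 "real k" "real (Suc k)"] by simp
  qed
  have last: "(LINT v:{real n..L}|lborel. \<kappa> v * ?c v) \<le> c2 * \<theta>"
  proof -
    have "(LINT v:{real n..L}|lborel. \<kappa> v * ?c v) \<le> (LINT v:{real n..L}|lborel. c2)"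
    proof (rule set_integral_mono[OF I])
      show "set_integrable lborel {real n..L} (\<lambda>v. c2)" by (rule Icc_integrable[where B = "c2"]) (use c2 in auto)
      fix v assume v: "v \<in> {real n..L}"
      have "L - v \<le> 1" using v n_def L by (auto simp: le_nat_floor) linarith
      then have "sqrt (L - v) \<le> 1" by simp
      then have "c2 * sqrt (L - v) \<le> c2 * 1" using c2 by (intro mult_left_mono) auto
      then have "\<kappa> v \<le> c2" using up'[of v] v by auto
      have "\<kappa> v * ?c v \<le> \<kappa> v * 1" using pos[of v] by (intro mult_left_mono) auto
      then show "\<kappa> v * ?c v \<le> c2" using \<open>\<kappa> v \<le> c2\<close> by simp
    qed
    also have "\<dots> = c2 * (L - real n)" using n by (simp add: set_lebesgue_integral_def)
    also have "\<dots> \<le> c2 * \<theta>" using n c2 by (intro mult_left_mono) auto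
    finally show ?thesis .
  qed
  \<comment> \<open>The divisor 512 in \<theta> makes the gain of the first period exactly four
    times the bound for the incomplete last one.\<close>
  have "c1 * e / 2 * a / 4 = (c2 * \<rho>) * e * (e * \<rho> / 4)\<^sup>2 / 8" by (simp add: \<rho>(3) a_def)
  also have "\<dots> = 4 * (c2 * \<theta>)"
    by (simp add: \<theta>_def \<rho>_def[symmetric] power2_eq_square power3_eq_cube)
  finally have "c1 * e / 2 * a / 4 = 4 * (c2 * \<theta>)" .
  moreover have "0 \<le> c2 * \<theta>" using c c2 e by (simp add: \<theta>_def)
  moreover have "(LINT v:{0..L}|lborel. \<kappa> v * ?c v)
      = (LINT v:{0..real n}|lborel. \<kappa> v * ?c v) + (LINT v:{real n..L}|lborel. \<kappa> v * ?c v)"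
    using n by (intro Icc_integral_split[OF I]) auto
  ultimately show ?thesis using per[of n] n(1) last by linarith
qed


section \<open>Chord lengths of convex and of round bodies\<close>

lemma compact_section:
  fixes S :: "(real \<times> real) set"
  assumes "compact S"
  shows "compact {x. (x, v) \<in> S}"
proof -
  have "{x. (x, v) \<in> S} = fst ` (S \<inter> {z. snd z = v})" by force
  moreover have "compact (S \<inter> {z. snd z = v})"
    using assms by (intro compact_Int_closed closed_Collect_eq continuous_intros)
  then have "compact (fst ` (S \<inter> {z. snd z = v}))"
    by (rule compact_continuous_image[rotated]) (intro continuous_intros)
  ultimately show ?thesis by simp
qed

text \<open>Brunn's principle in the plane: the sections at two heights are intervals, and the
  interval between the combined endpoints lies in the intermediate section.\<close>

lemma section_length_concave:
  fixes S :: "(real \<times> real) set"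
  assumes S: "compact S" "convex S" and L: "\<And>v. a \<le> v \<Longrightarrow> v \<le> b \<Longrightarrow> \<exists>x. (x, v) \<in> S"
  shows "concave_on {a..b} (\<lambda>v. measure lborel {x. (x, v) \<in> S})"
  unfolding concave_on_iff
proof (intro conjI ballI allI impI)
  have sec: "\<exists>l r. l \<le> r \<and> {x. (x, v) \<in> S} = {l..r}" if vab: "v \<in> {a..b}" for v
  proof -
    have "compact {x. (x, v) \<in> S}" by (rule compact_section[OF S(1)])
    moreover have "convex {x. (x, v) \<in> S}"
    proof (rule convexI)
      fix x y u w :: real
      assume "x \<in> {x. (x, v) \<in> S}" "y \<in> {x. (x, v) \<in> S}" "0 \<le> u" "0 \<le> w" and uw: "u + w = 1"
      then have "u *\<^sub>R (x, v) + w *\<^sub>R (y, v) \<in> S" by (intro convexD[OF S(2)]) auto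
      moreover have "u * v + w * v = v" using uw by (metis distrib_right mult_1)
      ultimately show "u *\<^sub>R x + w *\<^sub>R y \<in> {x. (x, v) \<in> S}"
        by (simp only: scaleR_Pair add_Pair real_scaleR_def mem_Collect_eq)
    qed
    ultimately obtain l r where lr: "{x. (x, v) \<in> S} = {l..r}"
      using connected_compact_interval_1[of "{x. (x, v) \<in> S}"] convex_connected[of "{x. (x, v) \<in> S}"] by auto
    obtain x0 where "(x0, v) \<in> S" using L vab by auto
    then have "x0 \<in> {l..r}" unfolding lr[symmetric] by simp
    then have "l \<le> r" by simp
    then show ?thesis using lr by blast
  qed
  fix x y u w :: real
  assume x: "x \<in> {a..b}" and y: "y \<in> {a..b}" and u: "0 \<le> u" and w: "0 \<le> w" and uw: "u + w = 1"
  let ?z = "u *\<^sub>R x + w *\<^sub>R y"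
  have z: "?z \<in> {a..b}" using convexD[OF convex_real_interval(5) x y u w uw] .
  obtain l1 r1 where 1: "l1 \<le> r1" "{t. (t, x) \<in> S} = {l1..r1}" using sec[OF x] by blast
  obtain l2 r2 where 2: "l2 \<le> r2" "{t. (t, y) \<in> S} = {l2..r2}" using sec[OF y] by blast
  obtain l3 r3 where 3: "l3 \<le> r3" "{t. (t, ?z) \<in> S} = {l3..r3}" using sec[OF z] by blast
  have comb: "u * t + w * s \<in> {l3..r3}" if "t \<in> {l1..r1}" "s \<in> {l2..r2}" for t s
  proof -
    have "u *\<^sub>R (t, x) + w *\<^sub>R (s, y) \<in> S"
      using that 1(2) 2(2) by (intro convexD[OF S(2)] u w uw) auto
    then show ?thesis unfolding 3(2)[symmetric] by simp
  qed
  have "u * (r1 - l1) + w * (r2 - l2) = (u * r1 + w * r2) - (u * l1 + w * l2)" by (simp add: algebra_simps)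
  also have "\<dots> \<le> r3 - l3" using comb[of r1 r2] comb[of l1 l2] 1(1) 2(1) by auto
  finally show "u * measure lborel {t. (t, x) \<in> S} + w * measure lborel {t. (t, y) \<in> S}
      \<le> measure lborel {t. (t, ?z) \<in> S}"
    unfolding 1(2) 2(2) 3(2) using 1(1) 2(1) 3(1) by simp
qed (rule convex_real_interval)

text \<open>Linear change of variables of determinant \<open>snd n\<close> that makes the level
  lines of the inner product with n horizontal.\<close>

definition shear :: "real \<times> real \<Rightarrow> real \<times> real \<Rightarrow> real \<times> real" where
  "shear n z = (fst z, n \<bullet> z)"

text \<open>The level chord at v projected to the first axis: its true length times |snd n| /
  |n|.\<close>

definition chord :: "(real \<times> real) set \<Rightarrow> real \<times> real \<Rightarrow> real \<Rightarrow> real" where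
  "chord S n v = measure lborel {x. (x, v) \<in> shear n ` S}"

lemma shear_image_iff:
  assumes "snd n \<noteq> 0"
  shows "(x, v) \<in> shear n ` S \<longleftrightarrow> (x, (v - fst n * x) / snd n) \<in> S"
proof
  assume "(x, v) \<in> shear n ` S"
  then obtain z where z: "z \<in> S" "x = fst z" "v = n \<bullet> z" by (auto simp: shear_def)
  then have "(v - fst n * x) / snd n = snd z" using assms by (simp add: inner_prod_def)
  then show "(x, (v - fst n * x) / snd n) \<in> S" using z by simp
next
  assume "(x, (v - fst n * x) / snd n) \<in> S"
  moreover have "shear n (x, (v - fst n * x) / snd n) = (x, v)"
    using assms by (simp add: shear_def inner_prod_def)
  ultimately show "(x, v) \<in> shear n ` S" by force
qed

lemma compact_shear: "compact S \<Longrightarrow> compact (shear n ` S)"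
  unfolding shear_def by (intro compact_continuous_image continuous_intros)

lemma convex_shear: "convex S \<Longrightarrow> convex (shear n ` S)"
  by (rule convex_linear_image)
    (rule linearI; simp add: shear_def inner_right_distrib)

text \<open>Fubini in sheared coordinates: for a fixed first coordinate x, the substitution y = (v -
  fst n * x) / snd n has constant Jacobian 1 / |snd n|. Exponential integrals over S become
  one-dimensional ones against the chord length.\<close>

lemma chord_integral:
  fixes S :: "(real \<times> real) set" and G :: "real \<Rightarrow> real"
  assumes S: "compact S" and n: "snd n \<noteq> 0" and G: "continuous_on UNIV G"
  shows "(LINT z:S|lborel. G (n \<bullet> z)) = (1 / \<bar>snd n\<bar>) * (\<integral>v. chord S n v * G v \<partial>lborel)"
    and "chord S n \<in> borel_measurable borel"
proof -
  let ?S' = "shear n ` S"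
  have S': "compact ?S'" using S by (rule compact_shear)
  have Sb: "?S' \<in> sets (lborel \<Otimes>\<^sub>M lborel)"
    using S' by (simp only: lborel_prod) (simp add: borel_closed compact_imp_closed)
  define f where "f = (\<lambda>z. indicat_real S z * G (n \<bullet> z))"
  define f' where "f' = (\<lambda>z. indicat_real ?S' z * G (snd z))"
  have "continuous_on S (\<lambda>z. G (n \<bullet> z))"
    by (rule continuous_on_compose2[OF G]) (auto intro!: continuous_intros)
  moreover have "continuous_on ?S' (\<lambda>z. G (snd z))"
    by (rule continuous_on_compose2[OF G]) (auto intro!: continuous_intros)
  ultimately have "integrable lborel f" "integrable lborel f'"
    using borel_integrable_compact[OF S, of "\<lambda>z. G (n \<bullet> z)"] borel_integrable_compact[OF S', of "\<lambda>z. G (snd z)"]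
    by (simp_all add: f_def f'_def)
  then have fi: "integrable (lborel \<Otimes>\<^sub>M lborel) f" and fi': "integrable (lborel \<Otimes>\<^sub>M lborel) f'"
    by (simp_all only: lborel_prod)
  have sub: "f (x, - (fst n / snd n) * x + (1 / snd n) * v) = f' (x, v)" for x v
  proof -
    have e: "- (fst n / snd n) * x + (1 / snd n) * v = (v - fst n * x) / snd n"
      by (simp add: diff_divide_distrib)
    have "n \<bullet> (x, (v - fst n * x) / snd n) = v" using n by (simp add: inner_prod_def)
    then show ?thesis unfolding f_def f'_def e
      using shear_image_iff[OF n, of x v S] by (simp add: indicator_def)
  qed
  have "(LINT z:S|lborel. G (n \<bullet> z)) = (\<integral>z. f z \<partial>(lborel \<Otimes>\<^sub>M lborel))"
    unfolding lborel_prod by (simp add: set_lebesgue_integral_def f_def)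
  also have "\<dots> = (\<integral>x. (\<integral>y. f (x, y) \<partial>lborel) \<partial>lborel)"
    by (rule lborel_pair.integral_fst'[OF fi, symmetric])
  also have "\<dots> = (\<integral>x. (1 / \<bar>snd n\<bar>) * (\<integral>v. f' (x, v) \<partial>lborel) \<partial>lborel)"
  proof (rule Bochner_Integration.integral_cong[OF refl])
    fix x
    show "(\<integral>y. f (x, y) \<partial>lborel) = (1 / \<bar>snd n\<bar>) * (\<integral>v. f' (x, v) \<partial>lborel)"
      by (subst lborel_integral_real_affine[of "1 / snd n" _ "- (fst n / snd n) * x"])
        (use n in \<open>simp_all only: sub, simp_all\<close>)
  qed
  also have "\<dots> = (1 / \<bar>snd n\<bar>) * (\<integral>x. (\<integral>v. f' (x, v) \<partial>lborel) \<partial>lborel)" by simp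
  also have "(\<integral>x. (\<integral>v. f' (x, v) \<partial>lborel) \<partial>lborel) = (\<integral>v. (\<integral>x. f' (x, v) \<partial>lborel) \<partial>lborel)"
    using lborel_pair.Fubini_integral[of "\<lambda>x v. f' (x, v)"] fi' by simp
  also have "\<dots> = (\<integral>v. chord S n v * G v \<partial>lborel)"
  proof (rule Bochner_Integration.integral_cong[OF refl])
    fix v
    have "(\<lambda>x. f' (x, v)) = (\<lambda>x. indicat_real {x. (x, v) \<in> ?S'} x * G v)"
      by (auto simp: f'_def indicator_def)
    then show "(\<integral>x. f' (x, v) \<partial>lborel) = chord S n v * G v" by (simp add: chord_def)
  qed
  finally show "(LINT z:S|lborel. G (n \<bullet> z)) = (1 / \<bar>snd n\<bar>) * (\<integral>v. chord S n v * G v \<partial>lborel)" .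
  have "(\<lambda>v. emeasure lborel ((\<lambda>x. (x, v)) -` ?S')) \<in> borel_measurable lborel"
    by (rule lborel_pair.measurable_emeasure_Pair2[OF Sb])
  then show "chord S n \<in> borel_measurable borel"
    unfolding chord_def[abs_def] measure_def vimage_def by measurable
qed

text \<open>For each direction u there is a point p with outer normal u at which a ball of radius r
  touches from inside and one of radius R from outside. Directions rather than boundary points are
  quantified, since a frequency prescribes a direction.\<close>

definition round_body :: "real \<Rightarrow> real \<Rightarrow> (real \<times> real) set \<Rightarrow> bool" where
  "round_body r R S \<longleftrightarrow> (\<forall>u. norm u = 1 \<longrightarrow>
     (\<exists>p. cball (p - r *\<^sub>R u) r \<subseteq> S \<and> S \<subseteq> cball (p - R *\<^sub>R u) R))"

text \<open>Expanding the squared norm in the condition for the outer ball: the squared distance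
  from p is at most 2R times the depth below the tangent at p. In particular p is extremal in
  direction u.\<close>

lemma outer_ball_bound:
  fixes p z u :: "real \<times> real"
  assumes u: "norm u = 1" and z: "z \<in> cball (p - R *\<^sub>R u) R" and R: "0 < R"
  shows "(norm (z - p))\<^sup>2 \<le> 2 * R * (u \<bullet> (p - z))" "u \<bullet> z \<le> u \<bullet> p"
proof -
  have "norm (z - p + R *\<^sub>R u) \<le> R" using z by (simp add: dist_norm norm_minus_commute algebra_simps)
  then have "(norm (z - p + R *\<^sub>R u))\<^sup>2 \<le> R\<^sup>2" by (intro power_mono) auto
  moreover have "(norm (z - p + R *\<^sub>R u))\<^sup>2 = (norm (z - p))\<^sup>2 + 2 * R * (u \<bullet> (z - p)) + R\<^sup>2"
    unfolding power2_norm_eq_inner using u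
    by (simp add: inner_add_left inner_add_right inner_commute[of u "z - p"] norm_eq_1 power2_eq_square distrib_left)
  ultimately show *: "(norm (z - p))\<^sup>2 \<le> 2 * R * (u \<bullet> (p - z))"
    by (simp add: inner_diff_right algebra_simps)
  then have "0 \<le> R * (u \<bullet> (p - z))" using zero_le_power2[of "norm (z - p)"] by linarith
  then have "0 \<le> u \<bullet> (p - z)" using R by (simp add: zero_le_mult_iff)
  then show "u \<bullet> z \<le> u \<bullet> p" by (simp add: inner_diff_right)
qed

text \<open>At depth s below the tangent at p the body lies within sqrt (2 R s) of p. The factor c
  may have either sign, so the lemma applies near the lowest and near the highest level.\<close>

lemma chord_upper:
  fixes p u n :: "real \<times> real"
  assumes S: "compact S" "S \<subseteq> cball (p - R *\<^sub>R u) R" and u: "norm u = 1" "n = c *\<^sub>R u" "0 < \<bar>c\<bar>" and R: "0 < R"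
    and n: "snd n \<noteq> 0"
  shows "chord S n v \<le> 2 * sqrt (2 * R / \<bar>c\<bar>) * sqrt \<bar>v - n \<bullet> p\<bar>"
proof -
  define s where "s = \<bar>v - n \<bullet> p\<bar> / \<bar>c\<bar>"
  define D where "D = sqrt (2 * R * s)"
  have s0: "0 \<le> s" by (simp add: s_def)
  have sub: "{x. (x, v) \<in> shear n ` S} \<subseteq> {fst p - D..fst p + D}"
  proof
    fix x assume "x \<in> {x. (x, v) \<in> shear n ` S}"
    then obtain z where z: "z \<in> S" "x = fst z" "v = n \<bullet> z" by (auto simp: shear_def)
    have ub: "(norm (z - p))\<^sup>2 \<le> 2 * R * (u \<bullet> (p - z))"
      using outer_ball_bound[OF u(1) _ R] S z by blast
    have "v - n \<bullet> p = - c * (u \<bullet> (p - z))" using z u by (simp add: inner_diff_right algebra_simps)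
    then have "\<bar>v - n \<bullet> p\<bar> = \<bar>c\<bar> * \<bar>u \<bullet> (p - z)\<bar>" by (simp add: abs_mult)
    then have "s = \<bar>u \<bullet> (p - z)\<bar>" using u by (simp add: s_def)
    then have "2 * R * (u \<bullet> (p - z)) \<le> 2 * R * s" using R by simp
    then have "norm (z - p) \<le> D" unfolding D_def using ub by (intro real_le_rsqrt) simp
    moreover have "\<bar>fst (z - p)\<bar> \<le> norm (z - p)" using norm_fst_le[of "fst (z - p)" "snd (z - p)"] by (simp only: prod.collapse real_norm_def)
    ultimately show "x \<in> {fst p - D..fst p + D}" using z by (auto simp: abs_le_iff)
  qed
  have D0: "0 \<le> D" using R s0 by (simp add: D_def)
  have "chord S n v \<le> measure lborel {fst p - D..fst p + D}"
    unfolding chord_def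
  proof (rule measure_mono_fmeasurable[OF sub])
    have "{x. (x, v) \<in> shear n ` S} = (\<lambda>x. (x, v)) -` (shear n ` S)" by auto
    moreover have "closed ((\<lambda>x. (x, v)) -` (shear n ` S))"
      using compact_shear[OF S(1)] by (intro closed_vimage compact_imp_closed continuous_intros)
    ultimately show "{x. (x, v) \<in> shear n ` S} \<in> sets lborel" by (simp add: borel_closed)
  qed (auto intro!: fmeasurableI simp: emeasure_lborel_Icc_eq)
  also have "\<dots> = 2 * D" using D0 by simp
  also have "D = sqrt (2 * R / \<bar>c\<bar>) * sqrt \<bar>v - n \<bullet> p\<bar>"
    by (simp add: D_def s_def real_sqrt_mult real_sqrt_divide)
  finally show ?thesis by simp
qed

text \<open>At depth s \<le> r the chord of the inner ball has half-length sqrt (2 r s - s^2), at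
  least sqrt (r s). Projection to the first axis keeps at least half of it, because |fst n| \<le>
  |snd n|.\<close>

lemma chord_lower:
  fixes p u n :: "real \<times> real"
  assumes S: "compact S" "cball (p - r *\<^sub>R u) r \<subseteq> S" and u: "norm u = 1" "n = - c *\<^sub>R u" "0 < c" and r: "0 < r"
    and n: "snd n \<noteq> 0" "\<bar>fst n\<bar> \<le> \<bar>snd n\<bar>" and v: "v = n \<bullet> p + c * s" "0 \<le> s" "s \<le> r"
  shows "sqrt (r * s) \<le> chord S n v"
proof -
  have nu: "(fst u)\<^sup>2 + (snd u)\<^sup>2 = 1" using u(1) by (simp add: norm_prod_def)
  have fs: "\<bar>fst u\<bar> \<le> \<bar>snd u\<bar>" using n u by (simp add: abs_mult)
  then have "(fst u)\<^sup>2 \<le> (snd u)\<^sup>2" by (simp add: abs_le_square_iff)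
  then have "(1 / 2)\<^sup>2 \<le> (snd u)\<^sup>2" using nu by (simp add: power2_eq_square)
  then have s2: "1 / 2 \<le> \<bar>snd u\<bar>" using abs_le_square_iff[of "1 / 2" "snd u"] by simp
  define q where "q = p - s *\<^sub>R u"
  define T where "T = sqrt (r * s)"
  have T0: "0 \<le> T" using r v by (simp add: T_def)
  define w where "w = (- snd u, fst u)"
  have wu: "w \<bullet> u = 0" "w \<bullet> w = 1" "u \<bullet> u = 1"
    using nu by (auto simp: w_def inner_prod_def power2_eq_square add.commute)
  have inS: "q + t *\<^sub>R w \<in> S" if t: "\<bar>t\<bar> \<le> T" for t
  proof -
    have "t\<^sup>2 \<le> T\<^sup>2" using t T0 by (simp add: abs_le_square_iff[symmetric])
    then have t2: "t\<^sup>2 \<le> r * s" using r v by (simp add: T_def)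
    have ss: "s * s \<le> r * s" using v by (intro mult_right_mono) auto
    have e: "(p - r *\<^sub>R u) - (q + t *\<^sub>R w) = (s - r) *\<^sub>R u - t *\<^sub>R w"
      by (simp add: q_def algebra_simps)
    have "(norm ((s - r) *\<^sub>R u - t *\<^sub>R w))\<^sup>2 = (s - r)\<^sup>2 + t\<^sup>2"
      unfolding power2_norm_eq_inner using wu
      by (simp add: inner_diff_left inner_diff_right inner_commute[of u w] power2_eq_square)
    also have "\<dots> \<le> r\<^sup>2" using t2 ss by (simp add: power2_eq_square algebra_simps)
    finally have "norm ((s - r) *\<^sub>R u - t *\<^sub>R w) \<le> r" using r by (simp add: power2_le_iff_abs_le)
    then have "q + t *\<^sub>R w \<in> cball (p - r *\<^sub>R u) r" by (simp only: mem_cball dist_norm e)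
    then show ?thesis using S by blast
  qed
  have nq: "n \<bullet> (q + t *\<^sub>R w) = v" for t
    using u(2) wu v(1) by (simp add: q_def inner_add_right inner_diff_right inner_commute[of u w] algebra_simps)
  have mem: "x \<in> {x. (x, v) \<in> shear n ` S}" if "\<bar>x - fst q\<bar> \<le> T / 2" for x
  proof -
    define t where "t = (fst q - x) / snd u"
    have sn: "snd u \<noteq> 0" using s2 by auto
    have "\<bar>t\<bar> = \<bar>x - fst q\<bar> / \<bar>snd u\<bar>"
      unfolding t_def abs_divide by (subst abs_minus_commute) (rule refl)
    also have "\<dots> \<le> (T / 2) / (1 / 2)" using that s2 T0 by (intro frac_le) auto
    finally have "\<bar>t\<bar> \<le> T" by simp
    then have "q + t *\<^sub>R w \<in> S" by (rule inS)
    moreover have "shear n (q + t *\<^sub>R w) = (x, v)"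
      unfolding shear_def nq using sn by (simp add: t_def w_def)
    ultimately show ?thesis by force
  qed
  have sub: "{fst q - T / 2..fst q + T / 2} \<subseteq> {x. (x, v) \<in> shear n ` S}"
  proof
    fix x assume "x \<in> {fst q - T / 2..fst q + T / 2}"
    then have "\<bar>x - fst q\<bar> \<le> T / 2" unfolding abs_le_iff by auto
    then show "x \<in> {x. (x, v) \<in> shear n ` S}" by (rule mem)
  qed
  have comp: "compact {x. (x, v) \<in> shear n ` S}"
    by (rule compact_section[OF compact_shear[OF S(1)]])
  have "T = measure lborel {fst q - T / 2..fst q + T / 2}" using T0 by simp
  also have "\<dots> \<le> chord S n v"
    unfolding chord_def
    using comp emeasure_bounded_finite[OF compact_imp_bounded[OF comp]]
    by (intro measure_mono_fmeasurable sub fmeasurableI) (auto intro!: borel_closed compact_imp_closed)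
  finally show ?thesis by (simp add: T_def)
qed

text \<open>The chord function, shifted to start at 0, obeys the square-root bounds with c1 and c2
  proportional to |n|^(-1/2). Their ratio, hence \<theta>, depends only on r, R and e. With 1 / |snd
  n| \<ge> 1 / |n| this gives the order |n|^(-3/2).\<close>

lemma cos_integral_round:
  fixes S :: "(real \<times> real) set" and n :: "real \<times> real"
  assumes S: "compact S" "convex S" and r: "0 < r" "r \<le> R" and rd: "round_body r R S"
    and e: "0 < e" "8 * (2 * sqrt (2 * R)) * e \<le> sqrt r" "e\<^sup>2 \<le> r"
    and n: "1 \<le> norm n" "\<bar>fst n\<bar> \<le> \<bar>snd n\<bar>"
    and p0: "p0 \<in> S" "\<And>z. z \<in> S \<Longrightarrow> n \<bullet> p0 \<le> n \<bullet> z"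
    and p1: "p1 \<in> S" "\<And>z. z \<in> S \<Longrightarrow> n \<bullet> z \<le> n \<bullet> p1"
    and L: "1 \<le> n \<bullet> p1 - n \<bullet> p0"
  defines "\<theta> \<equiv> (sqrt r / (2 * sqrt (2 * R)))^3 * e^3 / 512"
  assumes fr: "n \<bullet> p1 - n \<bullet> p0 - of_int \<lfloor>n \<bullet> p1 - n \<bullet> p0\<rfloor> \<le> \<theta>"
  shows "(LINT z:S|lborel. cos (2 * pi * (n \<bullet> z - n \<bullet> p0))) \<le> - (2 * sqrt (2 * R) * \<theta> / (norm n * sqrt (norm n)))"
proof -
  define l where "l = norm n"
  define u where "u = (1 / l) *\<^sub>R n"
  have l: "1 \<le> l" "0 < l" using n by (auto simp: l_def)
  have u: "norm u = 1" "n = l *\<^sub>R u" using l by (auto simp: u_def l_def)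
  have R: "0 < R" using r by simp
  have sn: "snd n \<noteq> 0"
  proof
    assume "snd n = 0"
    then have "n = 0" using n(2) by (simp add: prod_eq_iff)
    then show False using n(1) by simp
  qed
  define L where "L = n \<bullet> p1 - n \<bullet> p0"
  define \<kappa> where "\<kappa> v = chord S n (n \<bullet> p0 + v)" for v
  obtain q0 where q0: "cball (q0 - r *\<^sub>R (- u)) r \<subseteq> S" "S \<subseteq> cball (q0 - R *\<^sub>R (- u)) R"
    using rd u(1) unfolding round_body_def by (metis norm_minus_cancel)
  obtain q1 where q1: "cball (q1 - r *\<^sub>R u) r \<subseteq> S" "S \<subseteq> cball (q1 - R *\<^sub>R u) R"
    using rd u(1) unfolding round_body_def by blast
  \<comment> \<open>The tangent points q0, q1 are matched with the extremal points p0, p1 through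
    their levels only.\<close>
  have "q0 \<in> cball (q0 - r *\<^sub>R (- u)) r" using u(1) r by (simp add: dist_norm)
  then have "q0 \<in> S" using q0(1) by blast
  moreover have "n \<bullet> q0 \<le> n \<bullet> p0"
    using outer_ball_bound(2)[of "- u" p0 q0 R] q0(2) p0(1) u R l by auto
  ultimately have nq0: "n \<bullet> q0 = n \<bullet> p0" using p0(2)[of q0] by simp
  have "q1 \<in> cball (q1 - r *\<^sub>R u) r" using u(1) r by (simp add: dist_norm)
  then have "q1 \<in> S" using q1(1) by blast
  moreover have "n \<bullet> p1 \<le> n \<bullet> q1"
    using outer_ball_bound(2)[of u p1 q1 R] q1(2) p1(1) u R l by auto
  ultimately have nq1: "n \<bullet> q1 = n \<bullet> p1" using p1(2)[of q1] by simp
  define c2 where "c2 = 2 * sqrt (2 * R / l)"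
  define c1 where "c1 = sqrt (r / l)"
  have c: "0 < c1" "c1 \<le> c2"
  proof -
    show "0 < c1" using r l by (simp add: c1_def)
    have "sqrt (r / l) \<le> sqrt (2 * R / l)" using r l by (intro real_sqrt_le_mono divide_right_mono) auto
    moreover have "0 \<le> sqrt (2 * R / l)" using R l by simp
    ultimately show "c1 \<le> c2" unfolding c1_def c2_def by linarith
  qed
  have c_eq: "c1 = sqrt r / sqrt l" "c2 = 2 * sqrt (2 * R) / sqrt l"
    by (simp_all add: c1_def c2_def real_sqrt_divide)
  have ratio: "c1 / c2 = sqrt r / (2 * sqrt (2 * R))" using l by (simp add: c_eq)
  have up0: "\<kappa> v \<le> c2 * sqrt v" if "0 \<le> v" for v
  proof -
    have "chord S n (n \<bullet> p0 + v) \<le> 2 * sqrt (2 * R / \<bar>- l\<bar>) * sqrt \<bar>(n \<bullet> p0 + v) - n \<bullet> q0\<bar>"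
      by (rule chord_upper[OF S(1) q0(2) _ _ _ R sn]) (use u l in auto)
    then show ?thesis unfolding nq0 using l that by (simp add: \<kappa>_def c2_def)
  qed
  have up1: "\<kappa> v \<le> c2 * sqrt (L - v)" if "v \<le> L" for v
  proof -
    have "chord S n (n \<bullet> p0 + v) \<le> 2 * sqrt (2 * R / \<bar>l\<bar>) * sqrt \<bar>(n \<bullet> p0 + v) - n \<bullet> q1\<bar>"
      by (rule chord_upper[OF S(1) q1(2) _ _ _ R sn]) (use u l in auto)
    moreover have "\<bar>(n \<bullet> p0 + v) - n \<bullet> q1\<bar> = L - v" unfolding nq1 using that by (simp add: L_def)
    ultimately show ?thesis using l by (simp add: \<kappa>_def c2_def)
  qed
  have pos: "0 \<le> \<kappa> v" for v by (simp add: \<kappa>_def chord_def)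
  have zero: "chord S n v = 0" if "v \<notin> {n \<bullet> p0..n \<bullet> p0 + L}" for v
  proof -
    have "{x. (x, v) \<in> shear n ` S} = {}" using that p0 p1 by (auto simp: shear_def L_def)
    then show ?thesis unfolding chord_def by simp
  qed
  have B: "\<bar>\<kappa> v\<bar> \<le> c2 * sqrt L" for v
  proof (cases "v \<in> {0..L}")
    case True
    then have "c2 * sqrt v \<le> c2 * sqrt L" using c by (intro mult_left_mono) auto
    then show ?thesis using pos[of v] up0[of v] True by auto
  next
    case False
    then have "\<kappa> v = 0" unfolding \<kappa>_def by (intro zero) auto
    then show ?thesis using c L by (auto simp: L_def)
  qed
  have m: "\<kappa> \<in> borel_measurable borel"
    unfolding \<kappa>_def
    by (rule measurable_compose[OF _ chord_integral(2)[OF S(1) sn continuous_on_const]])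
      (intro borel_measurable_continuous_onI continuous_intros)
  have conc: "concave_on {0..L} \<kappa>"
  proof -
    have ex: "\<exists>x. (x, v) \<in> shear n ` S" if v: "n \<bullet> p0 \<le> v" "v \<le> n \<bullet> p1" for v
    proof -
      define t where "t = (v - n \<bullet> p0) / L"
      have L0: "0 < L" using L by (simp add: L_def)
      have t: "0 \<le> t" "t \<le> 1" "t * L = v - n \<bullet> p0" using v L0 by (auto simp: t_def L_def)
      define z where "z = (1 - t) *\<^sub>R p0 + t *\<^sub>R p1"
      have "z \<in> S" unfolding z_def using t by (intro convexD[OF S(2) p0(1) p1(1)]) auto
      moreover have "n \<bullet> z = n \<bullet> p0 + t * L" by (simp add: z_def L_def inner_add_right algebra_simps)
      ultimately have "shear n z = (fst z, v)" "z \<in> S" using t by (auto simp: shear_def)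
      then show ?thesis by (metis image_eqI)
    qed
    have cc: "concave_on {n \<bullet> p0..n \<bullet> p1} (chord S n)"
      unfolding chord_def[abs_def]
      by (rule section_length_concave[OF compact_shear[OF S(1)] convex_shear[OF S(2)] ex])
    show ?thesis
      unfolding concave_on_iff
    proof (intro conjI ballI allI impI)
      fix x y t w :: real
      assume xy: "x \<in> {0..L}" "y \<in> {0..L}" and tw: "0 \<le> t" "0 \<le> w" "t + w = 1"
      have "t * chord S n (n \<bullet> p0 + x) + w * chord S n (n \<bullet> p0 + y)
          \<le> chord S n (t *\<^sub>R (n \<bullet> p0 + x) + w *\<^sub>R (n \<bullet> p0 + y))"
        using cc xy tw unfolding concave_on_iff by (auto simp: L_def)
      also have "t *\<^sub>R (n \<bullet> p0 + x) + w *\<^sub>R (n \<bullet> p0 + y) = (t + w) * (n \<bullet> p0) + (t *\<^sub>R x + w *\<^sub>R y)"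
        by (simp add: algebra_simps)
      finally show "t * \<kappa> x + w * \<kappa> y \<le> \<kappa> (t *\<^sub>R x + w *\<^sub>R y)" using tw by (simp add: \<kappa>_def)
    qed simp
  qed
  have lo: "c1 * e \<le> \<kappa> (e\<^sup>2)"
  proof -
    have "sqrt (r * (e\<^sup>2 / l)) \<le> chord S n (n \<bullet> p0 + e\<^sup>2)"
    proof (rule chord_lower[OF S(1) q0(1)])
      show "norm (- u) = 1" "n = - l *\<^sub>R (- u)" "0 < l" "0 < r" using u l r by simp_all
      show "snd n \<noteq> 0" "\<bar>fst n\<bar> \<le> \<bar>snd n\<bar>" by fact+
      show "n \<bullet> p0 + e\<^sup>2 = n \<bullet> q0 + l * (e\<^sup>2 / l)" using nq0 l by simp
      show "0 \<le> e\<^sup>2 / l" using l by simp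
      have "e\<^sup>2 / l \<le> e\<^sup>2 / 1" using l by (intro divide_left_mono) auto
      then show "e\<^sup>2 / l \<le> r" using e(3) by simp
    qed
    moreover have "sqrt (r * (e\<^sup>2 / l)) = c1 * e"
      using e(1) by (simp add: c1_def real_sqrt_mult real_sqrt_divide)
    ultimately show ?thesis by (simp add: \<kappa>_def)
  qed
  have e8: "8 * c2 * e \<le> c1"
  proof -
    have "8 * (2 * sqrt (2 * R)) * e / sqrt l \<le> sqrt r / sqrt l"
      using e(2) l by (intro divide_right_mono) auto
    then show ?thesis by (simp add: c_eq)
  qed
  have main: "(LINT v:{0..L}|lborel. \<kappa> v * cos (2 * pi * v)) \<le> - (c2 * ((c1 / c2)^3 * e^3 / 512))"
    using concave_cos_integral[OF c e(1) e8 conc m B pos up0 up1 lo] L fr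
    unfolding L_def[symmetric] ratio \<theta>_def by blast
  have "(LINT z:S|lborel. cos (2 * pi * (n \<bullet> z - n \<bullet> p0)))
     = (1 / \<bar>snd n\<bar>) * (\<integral>v. chord S n v * cos (2 * pi * (v - n \<bullet> p0)) \<partial>lborel)"
    by (rule chord_integral(1)[OF S(1) sn]) (intro continuous_intros)
  also have "(\<integral>v. chord S n v * cos (2 * pi * (v - n \<bullet> p0)) \<partial>lborel)
      = (\<integral>v. \<kappa> v * cos (2 * pi * v) \<partial>lborel)"
    by (subst lborel_integral_real_affine[of 1 _ "n \<bullet> p0"]) (simp_all add: \<kappa>_def)
  also have "\<dots> = (LINT v:{0..L}|lborel. \<kappa> v * cos (2 * pi * v))"
    unfolding set_lebesgue_integral_def
  proof (rule Bochner_Integration.integral_cong[OF refl])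
    fix v
    show "\<kappa> v * cos (2 * pi * v) = indicat_real {0..L} v *\<^sub>R (\<kappa> v * cos (2 * pi * v))"
      using zero[of "n \<bullet> p0 + v"] by (auto simp: indicator_def \<kappa>_def)
  qed
  also have "(1 / \<bar>snd n\<bar>) * \<dots> \<le> (1 / \<bar>snd n\<bar>) * - (c2 * \<theta>)"
    using main unfolding ratio \<theta>_def by (intro mult_left_mono) auto
  also have "\<dots> \<le> (1 / l) * - (c2 * \<theta>)"
  proof (rule mult_right_mono_neg)
    have "\<bar>snd n\<bar> \<le> l" using norm_snd_le[of "snd n" "fst n"] by (simp add: l_def)
    then show "1 / l \<le> 1 / \<bar>snd n\<bar>" using sn by (intro divide_left_mono) auto
    show "- (c2 * \<theta>) \<le> 0" using c r R e by (simp add: \<theta>_def)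
  qed
  also have "\<dots> = - (2 * sqrt (2 * R) * \<theta> / (norm n * sqrt (norm n)))"
    by (simp add: c_eq l_def)
  finally show ?thesis .
qed

section \<open>The Fourier transform of an indicator function\<close>

definition fourier :: "(real \<times> real) set \<Rightarrow> real \<times> real \<Rightarrow> complex" where
  "fourier S n = (LINT z:S|lborel. cis (2 * pi * (n \<bullet> z)))"

lemma cis_integrable:
  assumes "compact (S :: (real \<times> real) set)"
  shows "set_integrable lborel S (\<lambda>z. cis (a * (n \<bullet> z) + b))"
proof -
  have "continuous_on S (\<lambda>z. cis (a * (n \<bullet> z) + b))"
    by (auto intro!: continuous_intros simp: cis_conv_exp)
  then show ?thesis
    unfolding set_integrable_def by (rule borel_integrable_compact[OF assms])
qed

text \<open>A factor of modulus 1 moves the origin of the phase to level c; the real part is then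
  bounded by the modulus.\<close>

lemma norm_fourier_ge:
  assumes "compact (S :: (real \<times> real) set)"
  shows "- (LINT z:S|lborel. cos (2 * pi * (n \<bullet> z - c))) \<le> norm (fourier S n)"
proof -
  have "cis (- (2 * pi * c)) * fourier S n = (LINT z:S|lborel. cis (- (2 * pi * c)) * cis (2 * pi * (n \<bullet> z)))"
    unfolding fourier_def by simp
  also have "\<dots> = (LINT z:S|lborel. cis (2 * pi * (n \<bullet> z - c)))"
    by (simp add: cis_mult algebra_simps)
  also have "Re \<dots> = (LINT z:S|lborel. cos (2 * pi * (n \<bullet> z - c)))"
  proof -
    have "set_integrable lborel S (\<lambda>z. cis (2 * pi * (n \<bullet> z - c)))"
      using cis_integrable[OF assms, of "2 * pi" n "- (2 * pi * c)"] by (simp add: algebra_simps)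
    then show ?thesis
      unfolding set_lebesgue_integral_def set_integrable_def
      by (subst integral_Re[symmetric]) simp_all
  qed
  finally have "\<bar>LINT z:S|lborel. cos (2 * pi * (n \<bullet> z - c))\<bar> \<le> norm (cis (- (2 * pi * c)) * fourier S n)"
    by (metis abs_Re_le_cmod)
  then show ?thesis by (simp add: norm_mult)
qed

section \<open>Exchange of the two coordinates\<close>

lemma lborel2_swap: "distr lborel borel prod.swap = (lborel :: (real \<times> real) measure)"
proof -
  have "distr (lborel \<Otimes>\<^sub>M lborel) (lborel \<Otimes>\<^sub>M lborel) (\<lambda>(x::real, y::real). (y, x)) = lborel \<Otimes>\<^sub>M lborel"
    by (rule lborel_pair.distr_pair_swap[symmetric])
  then show ?thesis
    by (simp only: lborel_prod) (simp add: prod.swap_def case_prod_unfold cong: distr_cong)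
qed

lemma swap_cball: "prod.swap ` cball p r = cball (prod.swap p) r" for p :: "real \<times> real"
proof -
  have d: "dist (prod.swap p) (prod.swap z) = dist p z" for p z :: "real \<times> real"
    by (simp add: dist_prod_def add.commute)
  show ?thesis
  proof (intro equalityI subsetI)
    fix z assume "z \<in> cball (prod.swap p) r"
    then have "prod.swap z \<in> cball p r" using d[of p "prod.swap z"] by simp
    then show "z \<in> prod.swap ` cball p r" by (metis image_eqI swap_swap)
  next
    fix z assume "z \<in> prod.swap ` cball p r"
    then obtain w where "z = prod.swap w" "dist p w \<le> r" by auto
    then show "z \<in> cball (prod.swap p) r" using d[of p w] by simp
  qed
qed

lemma round_body_swap:
  assumes "round_body r R S"
  shows "round_body r R (prod.swap ` S)"
  unfolding round_body_def
proof (intro allI impI)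
  fix u :: "real \<times> real" assume u: "norm u = 1"
  have "norm (prod.swap u) = 1" using u by (simp add: norm_prod_def add.commute)
  then obtain p where p: "cball (p - r *\<^sub>R prod.swap u) r \<subseteq> S" "S \<subseteq> cball (p - R *\<^sub>R prod.swap u) R"
    using assms unfolding round_body_def by blast
  have s: "prod.swap (p - t *\<^sub>R prod.swap u) = prod.swap p - t *\<^sub>R u" for t by (simp add: prod_eq_iff)
  show "\<exists>p. cball (p - r *\<^sub>R u) r \<subseteq> prod.swap ` S \<and> prod.swap ` S \<subseteq> cball (p - R *\<^sub>R u) R"
    using image_mono[OF p(1), of prod.swap] image_mono[OF p(2), of prod.swap]
    unfolding swap_cball s by blast
qed

lemma fourier_swap:
  assumes "compact S"
  shows "fourier (prod.swap ` S) (prod.swap n) = fourier S n"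
proof -
  have sw: "prod.swap \<in> borel \<rightarrow>\<^sub>M (borel :: (real \<times> real) measure)"
    unfolding prod.swap_def by (intro borel_measurable_continuous_onI continuous_intros)
  have "compact (prod.swap ` S)"
    using assms unfolding prod.swap_def by (intro compact_continuous_image continuous_intros)
  then have [measurable]: "prod.swap ` S \<in> sets borel" by (simp add: borel_closed compact_imp_closed)
  have [measurable]: "(\<lambda>z. cis (2 * pi * (prod.swap n \<bullet> z))) \<in> borel_measurable borel"
    unfolding cis_conv_exp by (intro borel_measurable_continuous_onI continuous_intros)
  have "fourier (prod.swap ` S) (prod.swap n)
     = (\<integral>z. indicator (prod.swap ` S) z *\<^sub>R cis (2 * pi * (prod.swap n \<bullet> z)) \<partial>distr lborel borel prod.swap)"
    unfolding fourier_def set_lebesgue_integral_def lborel2_swap ..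
  also have "\<dots> = (\<integral>z. indicator (prod.swap ` S) (prod.swap z) *\<^sub>R cis (2 * pi * (prod.swap n \<bullet> prod.swap z)) \<partial>lborel)"
    by (rule integral_distr) (use sw in measurable)
  also have "\<dots> = fourier S n"
    unfolding fourier_def set_lebesgue_integral_def
    by (intro Bochner_Integration.integral_cong refl arg_cong2[of _ _ _ _ scaleR])
      (auto simp: indicator_def image_iff inner_prod_def add.commute)
  finally show ?thesis .
qed

text \<open>The chord estimates need |fst n| \<le> |snd n|. Otherwise the coordinates are exchanged,
  which preserves roundness and the value of the transform.\<close>

lemma norm_fourier_round:
  fixes S :: "(real \<times> real) set" and n :: "real \<times> real"
  assumes S: "compact S" "convex S" and r: "0 < r" "r \<le> R" and rd: "round_body r R S"
    and e: "0 < e" "8 * (2 * sqrt (2 * R)) * e \<le> sqrt r" "e\<^sup>2 \<le> r"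
    and n: "1 \<le> norm n"
    and p0: "p0 \<in> S" "\<And>z. z \<in> S \<Longrightarrow> n \<bullet> p0 \<le> n \<bullet> z"
    and p1: "p1 \<in> S" "\<And>z. z \<in> S \<Longrightarrow> n \<bullet> z \<le> n \<bullet> p1"
    and L: "1 \<le> n \<bullet> p1 - n \<bullet> p0"
  defines "\<theta> \<equiv> (sqrt r / (2 * sqrt (2 * R)))^3 * e^3 / 512"
  assumes fr: "n \<bullet> p1 - n \<bullet> p0 - of_int \<lfloor>n \<bullet> p1 - n \<bullet> p0\<rfloor> \<le> \<theta>"
  shows "2 * sqrt (2 * R) * \<theta> / (norm n * sqrt (norm n)) \<le> norm (fourier S n)"
proof (cases "\<bar>fst n\<bar> \<le> \<bar>snd n\<bar>")
  case True
  have "(LINT z:S|lborel. cos (2 * pi * (n \<bullet> z - n \<bullet> p0))) \<le> - (2 * sqrt (2 * R) * \<theta> / (norm n * sqrt (norm n)))"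
    using fr unfolding \<theta>_def by (intro cos_integral_round[OF S r rd e n True p0 p1 L])
  then show ?thesis using norm_fourier_ge[OF S(1), of n "n \<bullet> p0"] by linarith
next
  case False
  let ?S = "prod.swap ` S" and ?n = "prod.swap n"
  have sw: "?n \<bullet> prod.swap z = n \<bullet> z" for z by (simp add: inner_prod_def add.commute)
  have nn: "norm ?n = norm n" by (simp add: norm_prod_def add.commute)
  have cS: "compact ?S" "convex ?S"
    using S unfolding prod.swap_def
    by (auto intro!: compact_continuous_image continuous_intros convex_linear_image linearI)
  have "(LINT z:?S|lborel. cos (2 * pi * (?n \<bullet> z - ?n \<bullet> prod.swap p0)))
      \<le> - (2 * sqrt (2 * R) * \<theta> / (norm ?n * sqrt (norm ?n)))"
    unfolding \<theta>_def
  proof (rule cos_integral_round[OF cS r round_body_swap[OF rd] e, of ?n "prod.swap p0" "prod.swap p1"])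
    show "1 \<le> norm ?n" "\<bar>fst ?n\<bar> \<le> \<bar>snd ?n\<bar>" using n nn False by auto
  qed (use p0 p1 sw L fr in \<open>auto simp: \<theta>_def simp del: swap_simp\<close>)
  then have "2 * sqrt (2 * R) * \<theta> / (norm n * sqrt (norm n)) \<le> norm (fourier ?S ?n)"
    using norm_fourier_ge[OF cS(1), of ?n "?n \<bullet> prod.swap p0"]
    unfolding nn by linarith
  then show ?thesis unfolding fourier_swap[OF S(1)] .
qed

section \<open>Bessel's inequality and exponential sums\<close>

text \<open>The intervals [j/\<Lambda>, (j + \<theta>)/\<Lambda>] with \<Lambda>/2 \<le> j \<le>
  \<Lambda> - 1 are disjoint and consist of admissible \<delta>. The transform of a single dilate
  may vanish at a given frequency, but the favourable fractional part occurs for a fixed proportion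
  of the dilates.\<close>

lemma measure_small_frac:
  assumes \<Lambda>: "8 \<le> \<Lambda>" and \<theta>: "0 < \<theta>" "\<theta> \<le> 1 / 2"
  defines "A \<equiv> {\<delta>\<in>{1/2..1}. \<delta> * \<Lambda> - of_int \<lfloor>\<delta> * \<Lambda>\<rfloor> \<le> \<theta>}"
  shows "\<theta> / 4 \<le> measure lborel A" "A \<in> sets borel"
proof -
  show Ab: "A \<in> sets borel" unfolding A_def by measurable
  define J where "J = {\<lceil>\<Lambda> / 2\<rceil>..\<lfloor>\<Lambda>\<rfloor> - 1}"
  define I where "I j = {real_of_int j / \<Lambda>..(real_of_int j + \<theta>) / \<Lambda>}" for j :: int
  have L0: "0 < \<Lambda>" using \<Lambda> by simp
  have fl: "\<lfloor>\<delta> * \<Lambda>\<rfloor> = j \<and> \<delta> * \<Lambda> - of_int j \<le> \<theta>" if "\<delta> \<in> I j" for \<delta> j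
  proof -
    have "real_of_int j \<le> \<delta> * \<Lambda>" "\<delta> * \<Lambda> \<le> real_of_int j + \<theta>"
      using that L0 by (auto simp: I_def pos_divide_le_eq pos_le_divide_eq)
    then show ?thesis using \<theta> by (auto intro!: floor_unique)
  qed
  have disj: "disjoint_family_on I J"
    unfolding disjoint_family_on_def using fl by blast
  have sub: "(\<Union>j\<in>J. I j) \<subseteq> A"
  proof
    fix \<delta> assume "\<delta> \<in> (\<Union>j\<in>J. I j)"
    then obtain j where j: "j \<in> J" "\<delta> \<in> I j" by blast
    have "\<Lambda> / 2 \<le> real_of_int j" "j \<le> \<lfloor>\<Lambda>\<rfloor> - 1" using j(1) by (auto simp: J_def ceiling_le_iff)
    moreover from this(2) have "real_of_int j + 1 \<le> \<Lambda>" by linarith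
    moreover have "real_of_int j \<le> \<delta> * \<Lambda>" "\<delta> * \<Lambda> \<le> real_of_int j + \<theta>"
      using j(2) L0 by (auto simp: I_def pos_divide_le_eq pos_le_divide_eq)
    ultimately have "(1 / 2) * \<Lambda> \<le> \<delta> * \<Lambda>" "\<delta> * \<Lambda> \<le> 1 * \<Lambda>" using \<theta> by linarith+
    then have "1 / 2 \<le> \<delta>" "\<delta> \<le> 1" using L0 using mult_right_le_imp_le by blast+
    then show "\<delta> \<in> A" using fl[OF j(2)] by (simp add: A_def)
  qed
  have "\<theta> / 4 \<le> real (card J) * (\<theta> / \<Lambda>)"
  proof -
    \<comment> \<open>There are at least \<Lambda>/2 - 2 integers j, and \<Lambda> \<ge> 8 turns
      this into \<Lambda>/4.\<close>
    have "\<Lambda> / 4 \<le> real_of_int (\<lfloor>\<Lambda>\<rfloor> - \<lceil>\<Lambda> / 2\<rceil>)" using \<Lambda> by simp linarith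
    also have "\<dots> \<le> real (card J)" by (simp add: J_def)
    finally have "\<Lambda> / 4 * (\<theta> / \<Lambda>) \<le> real (card J) * (\<theta> / \<Lambda>)"
      using \<theta> L0 by (intro mult_right_mono) auto
    then show ?thesis using L0 by simp
  qed
  also have "real (card J) * (\<theta> / \<Lambda>) = (\<Sum>j\<in>J. measure lborel (I j))"
    using \<theta> L0 by (simp add: I_def add_divide_distrib)
  also have "\<dots> = measure lborel (\<Union>j\<in>J. I j)"
  proof (rule measure_finite_Union[symmetric, OF _ _ disj])
    show "emeasure lborel (I j) \<noteq> \<infinity>" for j by (simp add: I_def emeasure_lborel_Icc_eq)
  qed (auto simp: J_def I_def)
  also have "\<dots> \<le> measure lborel A"
  proof (rule measure_mono_fmeasurable[OF sub])
    have "A \<subseteq> {1/2..1}" by (auto simp: A_def)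
    then have "emeasure lborel A \<le> emeasure lborel {1/2..1::real}"
      by (rule emeasure_mono) simp
    also have "\<dots> = ennreal (1 - 1/2)" by (rule emeasure_lborel_Icc) simp
    also have "\<dots> < \<infinity>" by (simp only: ennreal_less_top infinity_ennreal_def)
    finally show "A \<in> fmeasurable lborel" using Ab by (intro fmeasurableI) auto
  qed (auto simp: I_def J_def)
  finally show "\<theta> / 4 \<le> measure lborel A" .
qed

lemma finite_measure_bounded_integrable:
  fixes f :: "'a \<Rightarrow> 'b::{banach, second_countable_topology}"
  assumes "finite_measure \<mu>" "f \<in> borel_measurable \<mu>" "\<And>x. x \<in> space \<mu> \<Longrightarrow> norm (f x) \<le> C"
  shows "integrable \<mu> f"
  by (rule finite_measure.integrable_const_bound[OF assms(1), where B = C]) (use assms in auto)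

text \<open>From the nonnegative integral of |D - g|^2, where g projects D to the span of the
  conjugates of \<open>e n\<close>. Boundedness on a finite measure space makes all integrals
  exist.\<close>

lemma bessel:
  fixes D :: "'a \<Rightarrow> real" and e :: "'i \<Rightarrow> 'a \<Rightarrow> complex"
  assumes \<mu>: "finite_measure \<mu>" and D: "D \<in> borel_measurable \<mu>" "\<And>x. x \<in> space \<mu> \<Longrightarrow> \<bar>D x\<bar> \<le> B"
    and e: "\<And>n. e n \<in> borel_measurable \<mu>" "\<And>n x. norm (e n x) \<le> 1"
    and orth: "\<And>n m. n \<in> F \<Longrightarrow> m \<in> F \<Longrightarrow> (\<integral>x. cnj (e n x) * e m x \<partial>\<mu>) = (if n = m then 1 else 0)"
    and F: "finite F"
  shows "(\<Sum>n\<in>F. (norm (\<integral>x. of_real (D x) * e n x \<partial>\<mu>))\<^sup>2) \<le> (\<integral>x. (D x)\<^sup>2 \<partial>\<mu>)"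
proof -
  interpret finite_measure \<mu> by fact
  have cn: "(\<lambda>x. cnj (e n x)) \<in> borel_measurable \<mu>" for n
    by (rule borel_measurable_continuous_on[OF _ e(1)]) (intro continuous_intros)
  have Dc: "(\<lambda>x. complex_of_real (D x)) \<in> borel_measurable \<mu>" using D(1) by measurable
  have Dn: "norm (complex_of_real (D x) * z) \<le> \<bar>B\<bar>" if "x \<in> space \<mu>" "norm z \<le> 1" for x z
    using D(2)[OF that(1)] that(2) mult_mono[of "\<bar>D x\<bar>" "\<bar>B\<bar>" "norm z" 1] by (simp add: norm_mult)
  have i1: "integrable \<mu> (\<lambda>x. of_real (D x) * e n x)" for n
    by (rule finite_measure_bounded_integrable[OF \<mu>, where C = "\<bar>B\<bar>"]) (auto intro!: borel_measurable_times Dc e Dn)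
  have i2: "integrable \<mu> (\<lambda>x. of_real (D x) * cnj (e n x))" for n
    by (rule finite_measure_bounded_integrable[OF \<mu>, where C = "\<bar>B\<bar>"]) (auto intro!: borel_measurable_times Dc cn Dn simp: e)
  have i3: "integrable \<mu> (\<lambda>x. cnj (e n x) * e m x)" for n m
    by (rule finite_measure_bounded_integrable[OF \<mu>, where C = 1]) (auto intro!: borel_measurable_times cn e mult_le_one simp: norm_mult)
  have i4: "integrable \<mu> (\<lambda>x. (D x)\<^sup>2)"
    by (rule finite_measure_bounded_integrable[OF \<mu>, where C = "B\<^sup>2"])
      (use D in \<open>auto simp: abs_le_square_iff[symmetric] intro: order_trans[OF _ abs_ge_self]\<close>)
  define c where "c n = (\<integral>x. of_real (D x) * e n x \<partial>\<mu>)" for n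
  define g where "g x = (\<Sum>n\<in>F. c n * cnj (e n x))" for x
  define s where "s = (\<Sum>n\<in>F. (norm (c n))\<^sup>2)"
  have cnjc: "(\<integral>x. of_real (D x) * cnj (e n x) \<partial>\<mu>) = cnj (c n)" for n
  proof -
    have "cnj (c n) = (\<integral>x. cnj (of_real (D x) * e n x) \<partial>\<mu>)"
      unfolding c_def using i1[of n] by (simp del: complex_cnj_mult)
    then show ?thesis by simp
  qed
  have Dg: "(\<lambda>x. of_real (D x) * g x) = (\<lambda>x. \<Sum>n\<in>F. c n * (of_real (D x) * cnj (e n x)))"
    by (simp add: g_def sum_distrib_left mult.left_commute fun_eq_iff)
  have iDg: "integrable \<mu> (\<lambda>x. of_real (D x) * g x)"
    unfolding Dg by (intro Bochner_Integration.integrable_sum integrable_mult_right i2)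
  have "(\<integral>x. of_real (D x) * g x \<partial>\<mu>) = (\<Sum>n\<in>F. c n * cnj (c n))"
    unfolding Dg by (subst Bochner_Integration.integral_sum) (auto intro!: integrable_mult_right i2 simp: cnjc)
  also have "\<dots> = of_real s" by (simp only: s_def complex_norm_square of_real_sum)
  finally have IDg: "(\<integral>x. of_real (D x) * g x \<partial>\<mu>) = of_real s" .
  have gg: "(\<lambda>x. g x * cnj (g x)) = (\<lambda>x. \<Sum>n\<in>F. \<Sum>m\<in>F. c n * cnj (c m) * (cnj (e n x) * e m x))"
    by (simp add: g_def sum_product mult_ac fun_eq_iff)
  have igg: "integrable \<mu> (\<lambda>x. g x * cnj (g x))"
    unfolding gg by (intro Bochner_Integration.integrable_sum integrable_mult_right i3)
  have "(\<integral>x. g x * cnj (g x) \<partial>\<mu>) = (\<Sum>n\<in>F. \<Sum>m\<in>F. c n * cnj (c m) * (\<integral>x. cnj (e n x) * e m x \<partial>\<mu>))"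
    unfolding gg
    by (subst Bochner_Integration.integral_sum)
      (auto intro!: Bochner_Integration.integrable_sum integrable_mult_right i3
        simp: Bochner_Integration.integral_sum i3)
  also have "\<dots> = (\<Sum>n\<in>F. \<Sum>m\<in>F. if m = n then c n * cnj (c n) else 0)"
    by (intro sum.cong refl) (simp add: orth)
  also have "\<dots> = (\<Sum>n\<in>F. c n * cnj (c n))" using F by simp
  also have "\<dots> = of_real s" by (simp only: s_def complex_norm_square of_real_sum)
  finally have Igg: "(\<integral>x. g x * cnj (g x) \<partial>\<mu>) = of_real s" .
  have pw: "(norm (of_real (D x) - g x))\<^sup>2 = (D x)\<^sup>2 - 2 * Re (of_real (D x) * g x) + Re (g x * cnj (g x))" for x
    unfolding cmod_power2 by (simp add: power2_eq_square algebra_simps)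
  have "0 \<le> (\<integral>x. (norm (of_real (D x) - g x))\<^sup>2 \<partial>\<mu>)" by simp
  also have "\<dots> = (\<integral>x. (D x)\<^sup>2 \<partial>\<mu>) - 2 * (\<integral>x. Re (of_real (D x) * g x) \<partial>\<mu>) + (\<integral>x. Re (g x * cnj (g x)) \<partial>\<mu>)"
    unfolding pw using i4 integrable_Re[OF iDg] integrable_Re[OF igg]
    by (simp only: Bochner_Integration.integral_add Bochner_Integration.integral_diff
        Bochner_Integration.integrable_diff integrable_mult_right integral_mult_right_zero)
  also have "(\<integral>x. Re (of_real (D x) * g x) \<partial>\<mu>) = s"
    using integral_Re[OF iDg] IDg by simp
  also have "(\<integral>x. Re (g x * cnj (g x)) \<partial>\<mu>) = s"
    using integral_Re[OF igg] Igg by simp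
  finally show ?thesis by (simp add: s_def c_def)
qed

section \<open>Characters of the torus and the coefficients of the discrepancy\<close>

definition torus_char :: "int \<times> int \<Rightarrow> real \<times> real \<Rightarrow> complex" where
  "torus_char n \<tau> = cis (- (2 * pi * (int_vec n \<bullet> \<tau>)))"

lemma torus_char_measurable: "torus_char n \<in> borel_measurable borel"
  unfolding torus_char_def[abs_def] cis_conv_exp
  by (intro borel_measurable_continuous_onI continuous_intros)

lemma norm_char [simp]: "norm (torus_char n \<tau>) = 1"
  by (simp add: torus_char_def)

lemma int_vec_diff: "int_vec (n - m) = int_vec n - int_vec m"
  by (simp add: int_vec_def prod_eq_iff)

lemma torus_char_diff: "cnj (torus_char n \<tau>) * torus_char m \<tau> = torus_char (m - n) \<tau>"
  by (simp add: torus_char_def cis_cnj cis_mult int_vec_diff inner_diff_left algebra_simps)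

lemma cis_integral_period:
  fixes k :: int
  shows "(\<integral>x. indicator {0..<1} x *\<^sub>R cis (2 * pi * of_int k * x) \<partial>lborel) = (if k = 0 then 1 else 0)"
    and "integrable lborel (\<lambda>x. indicator {0..<1::real} x *\<^sub>R cis (2 * pi * of_int k * x))"
proof -
  let ?f = "\<lambda>x. indicator {0..<1::real} x *\<^sub>R cis (2 * pi * of_int k * x)"
  have si: "set_integrable lborel {0..<1::real} (\<lambda>x. cis (2 * pi * of_int k * x))"
    by (rule set_integrable_bounded[where B = 1])
      (auto intro!: borel_measurable_continuous_onI continuous_intros simp: cis_conv_exp)
  then show i: "integrable lborel ?f" by (simp add: set_integrable_def)
  show "(\<integral>x. ?f x \<partial>lborel) = (if k = 0 then 1 else 0)"
  proof (cases "k = 0")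
    case True
    then show ?thesis by (simp add: of_real_def[symmetric])
  next
    case False
    define w where "w = 2 * pi * real_of_int k"
    have w: "w \<noteq> 0" "cos w = 1" "sin w = 0"
      using False by (simp_all add: w_def)
    have hI: "(\<integral>x. indicator {0..<1} x * f x \<partial>lborel) = 0"
      if "(f has_integral 0) {0..1}" "continuous_on UNIV f" for f :: "real \<Rightarrow> real"
    proof -
      have "set_integrable lborel {0..1} f"
        unfolding set_integrable_def
        by (rule borel_integrable_compact) (use that(2) continuous_on_subset in auto)
      then have "(\<integral>x. indicator {0..1} x * f x \<partial>lborel) = 0"
        using set_borel_integral_eq_integral(2)[of "{0..1}" f] that(1)
        by (simp add: set_lebesgue_integral_def integral_unique)
      moreover have "(\<integral>x. indicator {0..<1} x * f x \<partial>lborel) = (\<integral>x. indicator {0..1} x * f x \<partial>lborel)"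
      proof (rule integral_cong_AE)
        have fm: "f \<in> borel_measurable borel" using that(2) by (rule borel_measurable_continuous_onI)
        show "(\<lambda>x. indicat_real {0..<1} x * f x) \<in> borel_measurable lborel"
          "(\<lambda>x. indicat_real {0..1} x * f x) \<in> borel_measurable lborel"
          using fm by measurable
        have "AE x in lborel. (x::real) \<noteq> 1" by (rule AE_lborel_singleton)
        then show "AE x in lborel. indicat_real {0..<1} x * f x = indicat_real {0..1} x * f x"
          by (rule AE_mp) (auto intro!: AE_I2 simp: indicator_def)
      qed
      ultimately show ?thesis by simp
    qed
    have "((\<lambda>x. cos (w * x)) has_integral (sin (w * 1) / w - sin (w * 0) / w)) {0..1}"
      by (rule fundamental_theorem_of_calculus)
        (auto intro!: derivative_eq_intros simp: has_real_derivative_iff_has_vector_derivative[symmetric] w)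
    then have c: "(\<integral>x. indicator {0..<1} x * cos (w * x) \<partial>lborel) = 0"
      by (intro hI continuous_intros) (simp add: w)
    have "((\<lambda>x. sin (w * x)) has_integral (- cos (w * 1) / w - (- cos (w * 0) / w))) {0..1}"
      by (rule fundamental_theorem_of_calculus)
        (auto intro!: derivative_eq_intros simp: has_real_derivative_iff_has_vector_derivative[symmetric] w)
    then have s: "(\<integral>x. indicator {0..<1} x * sin (w * x) \<partial>lborel) = 0"
      by (intro hI continuous_intros) (simp add: w)
    show ?thesis
      using False c s integral_Re[OF i] integral_Im[OF i]
      by (intro complex_eqI) (simp_all add: w_def)
  qed
qed

lemma torus_char_integral: "(LINT \<tau>:unit_sq|lborel. torus_char n \<tau>) = (if n = 0 then 1 else 0)"
proof -
  let ?g = "\<lambda>k x. indicator {0..<1::real} x *\<^sub>R cis (2 * pi * of_int k * x)"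
  have eq: "indicator unit_sq \<tau> *\<^sub>R torus_char n \<tau> = ?g (- fst n) (fst \<tau>) * ?g (- snd n) (snd \<tau>)" for \<tau>
    by (cases \<tau>) (auto simp: indicator_def torus_char_def int_vec_def cis_mult algebra_simps)
  have "integrable lborel (\<lambda>\<tau>. indicator unit_sq \<tau> *\<^sub>R torus_char n \<tau>)"
    using unit_sq_integrable[of "torus_char n" 1] torus_char_measurable by (simp add: set_integrable_def)
  then have i: "integrable (lborel \<Otimes>\<^sub>M lborel) (\<lambda>\<tau>. ?g (- fst n) (fst \<tau>) * ?g (- snd n) (snd \<tau>))"
    unfolding eq lborel_prod .
  have "(LINT \<tau>:unit_sq|lborel. torus_char n \<tau>) = (\<integral>\<tau>. ?g (- fst n) (fst \<tau>) * ?g (- snd n) (snd \<tau>) \<partial>(lborel \<Otimes>\<^sub>M lborel))"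
    unfolding set_lebesgue_integral_def eq lborel_prod ..
  also have "\<dots> = (\<integral>x. (\<integral>y. ?g (- fst n) x * ?g (- snd n) y \<partial>lborel) \<partial>lborel)"
    using lborel_pair.integral_fst'[OF i] by simp
  also have "\<dots> = (\<integral>x. ?g (- fst n) x * (\<integral>y. ?g (- snd n) y \<partial>lborel) \<partial>lborel)"
    by (simp only: integral_mult_right_zero)
  also have "\<dots> = (\<integral>x. ?g (- fst n) x \<partial>lborel) * (\<integral>y. ?g (- snd n) y \<partial>lborel)"
    by (simp only: integral_mult_left_zero)
  also have "\<dots> = (if n = 0 then 1 else 0)"
    unfolding cis_integral_period by (cases n) (auto simp: zero_prod_def)
  finally show ?thesis .
qed

definition exp_sum :: "(real \<times> real) set \<Rightarrow> int \<times> int \<Rightarrow> complex" where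
  "exp_sum P n = (\<Sum>p\<in>P. torus_char n p)"

text \<open>Unfolding turns a coefficient of the periodized indicator into the transform over the
  plane. With z = p + m - \<tau> the character at \<tau> splits into \<open>torus_char n p\<close>,
  a factor 1 for the integer vector m, and a positive exponential in z; hence the opposite signs in
  \<open>torus_char\<close> and \<open>fourier\<close>.\<close>

lemma lcount_fourier:
  assumes C: "compact C" "C \<subseteq> cball 0 (real K)" and \<delta>: "0 \<le> \<delta>" "\<delta> \<le> 1" and p: "p \<in> unit_sq"
  shows "(LINT \<tau>:unit_sq|lborel. of_real (lcount K C \<delta> p \<tau>) * torus_char n \<tau>) = torus_char n p * fourier ((*\<^sub>R) \<delta> ` C) (int_vec n)"
proof -
  let ?S = "(*\<^sub>R) \<delta> ` C"
  define f where "f z = indicat_real ?S z *\<^sub>R cis (2 * pi * (int_vec n \<bullet> z))" for z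
  have S: "compact ?S" using C by (simp add: compact_scaling)
  have fi: "integrable lborel f"
    using cis_integrable[OF S, of "2 * pi" "int_vec n" 0] by (simp add: set_integrable_def f_def[abs_def])
  have sup: "norm z \<le> real K" if "f z \<noteq> 0" for z
    using that dilate_norm_le[OF C(2) \<delta>] by (auto simp: f_def indicator_def split: if_splits)
  have trm: "of_real (indicator (dilates C) (\<delta>, p + int_vec m - \<tau>)) * torus_char n \<tau>
      = torus_char n p * f (p + int_vec m - \<tau>)" for m \<tau>
  proof -
    have "int_vec n \<bullet> int_vec m = of_int (fst n * fst m + snd n * snd m)"
      by (simp add: int_vec_def)
    then have one: "cis (2 * pi * (int_vec n \<bullet> int_vec m)) = 1"
      by (simp add: cis.ctr complex_eq_iff del: of_int_add of_int_mult)
    have "torus_char n p * cis (2 * pi * (int_vec n \<bullet> (p + int_vec m - \<tau>)))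
        = cis (2 * pi * (int_vec n \<bullet> int_vec m)) * torus_char n \<tau>"
      by (simp add: torus_char_def cis_mult inner_add_right inner_diff_right algebra_simps)
    then have e: "torus_char n p * cis (2 * pi * (int_vec n \<bullet> (p + int_vec m - \<tau>))) = torus_char n \<tau>"
      unfolding one by simp
    show ?thesis
      using e dilates_iff[OF \<delta>, of "p + int_vec m - \<tau>" C] by (simp add: f_def indicator_def)
  qed
  have "(LINT \<tau>:unit_sq|lborel. of_real (lcount K C \<delta> p \<tau>) * torus_char n \<tau>)
     = (LINT \<tau>:unit_sq|lborel. torus_char n p * (\<Sum>m\<in>int_box (K + 1). f (p + int_vec m - \<tau>)))"
    unfolding lcount_def of_real_sum sum_distrib_right trm sum_distrib_left ..
  also have "\<dots> = torus_char n p * (LINT \<tau>:unit_sq|lborel. (\<Sum>m\<in>int_box (K + 1). f (p + int_vec m - \<tau>)))"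
    by simp
  also have "\<dots> = torus_char n p * integral\<^sup>L lborel f"
    using unfold_integral[OF fi sup p] by simp
  finally show ?thesis by (simp add: fourier_def set_lebesgue_integral_def f_def[abs_def])
qed

text \<open>The area term is constant in \<tau> and drops out for nonzero n, so the points enter
  only through their exponential sum.\<close>

lemma disc_fourier:
  assumes C: "compact C" "C \<subseteq> cball 0 (real K)" and \<delta>: "0 \<le> \<delta>" "\<delta> \<le> 1"
    and P: "P \<subseteq> unit_sq" and n: "n \<noteq> 0"
  shows "(LINT \<tau>:unit_sq|lborel. of_real (disc K P C \<delta> \<tau>) * torus_char n \<tau>)
    = exp_sum P n * fourier ((*\<^sub>R) \<delta> ` C) (int_vec n)"
proof -
  have lm: "(\<lambda>\<tau>. complex_of_real (lcount K C \<delta> p \<tau>)) \<in> borel_measurable borel" for p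
    using lcount_measurable_snd[OF C(1), of K \<delta> p] by measurable
  have li: "set_integrable lborel unit_sq (\<lambda>\<tau>. complex_of_real (lcount K C \<delta> p \<tau>) * torus_char n \<tau>)" for p
    by (rule unit_sq_integrable[where B = "count_bound K"])
      (use lm torus_char_measurable lcount_bounds in \<open>auto simp: norm_mult intro!: borel_measurable_times\<close>)
  have ci: "set_integrable lborel unit_sq (torus_char n)"
    by (rule unit_sq_integrable[where B = 1]) (auto intro: torus_char_measurable)
  have si: "set_integrable lborel unit_sq (\<lambda>\<tau>. \<Sum>p\<in>P. complex_of_real (lcount K C \<delta> p \<tau>) * torus_char n \<tau>)"
    using li unfolding set_integrable_def scaleR_sum_right by (intro Bochner_Integration.integrable_sum)
  define a where "a = complex_of_real (real (card P) * (\<delta>\<^sup>2 * measure lborel C))"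
  have "(LINT \<tau>:unit_sq|lborel. of_real (disc K P C \<delta> \<tau>) * torus_char n \<tau>)
     = (LINT \<tau>:unit_sq|lborel. (\<Sum>p\<in>P. of_real (lcount K C \<delta> p \<tau>) * torus_char n \<tau>) - a * torus_char n \<tau>)"
    unfolding disc_def a_def by (simp only: of_real_diff of_real_sum left_diff_distrib sum_distrib_right)
  also have "\<dots> = (LINT \<tau>:unit_sq|lborel. (\<Sum>p\<in>P. of_real (lcount K C \<delta> p \<tau>) * torus_char n \<tau>))
      - a * (LINT \<tau>:unit_sq|lborel. torus_char n \<tau>)"
    using set_integral_diff(2)[OF si set_integrable_mult_right[OF ci, of a]] by simp
  also have "\<dots> = (\<Sum>p\<in>P. (LINT \<tau>:unit_sq|lborel. of_real (lcount K C \<delta> p \<tau>) * torus_char n \<tau>))"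
  proof -
    have "(LINT \<tau>:unit_sq|lborel. torus_char n \<tau>) = 0" using n by (simp only: torus_char_integral if_False)
    moreover have "(LINT \<tau>:unit_sq|lborel. (\<Sum>p\<in>P. of_real (lcount K C \<delta> p \<tau>) * torus_char n \<tau>))
       = (\<Sum>p\<in>P. (LINT \<tau>:unit_sq|lborel. of_real (lcount K C \<delta> p \<tau>) * torus_char n \<tau>))"
      using li unfolding set_lebesgue_integral_def set_integrable_def scaleR_sum_right
      by (rule Bochner_Integration.integral_sum)
    ultimately show ?thesis by simp
  qed
  also have "\<dots> = (\<Sum>p\<in>P. torus_char n p * fourier ((*\<^sub>R) \<delta> ` C) (int_vec n))"
    by (intro sum.cong refl lcount_fourier C \<delta>) (use P in auto)
  finally show ?thesis by (simp add: exp_sum_def sum_distrib_right)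
qed

text \<open>Only a lower bound is wanted, so Bessel's inequality on finitely many frequencies takes
  the place of Parseval's identity.\<close>

lemma sq_disc_fourier:
  assumes C: "compact C" "C \<subseteq> cball 0 (real K)" and \<delta>: "0 \<le> \<delta>" "\<delta> \<le> 1"
    and P: "P \<subseteq> unit_sq" and F: "finite F" "0 \<notin> F"
  shows "(\<Sum>n\<in>F. (norm (exp_sum P n))\<^sup>2 * (norm (fourier ((*\<^sub>R) \<delta> ` C) (int_vec n)))\<^sup>2) \<le> sq_disc K P C \<delta>"
proof -
  let ?\<mu> = "restrict_space lborel unit_sq"
  have sq: "unit_sq \<inter> space lborel \<in> sets lborel" using unit_sq_borel by simp
  have conv: "integral\<^sup>L ?\<mu> f = (LINT \<tau>:unit_sq|lborel. f \<tau>)"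
    for f :: "real \<times> real \<Rightarrow> 'b::{banach,second_countable_topology}"
    using integral_restrict_space[OF sq, of f] by (simp add: set_lebesgue_integral_def)
  have "(\<Sum>n\<in>F. (norm (\<integral>\<tau>. of_real (disc K P C \<delta> \<tau>) * torus_char n \<tau> \<partial>?\<mu>))\<^sup>2) \<le> (\<integral>\<tau>. (disc K P C \<delta> \<tau>)\<^sup>2 \<partial>?\<mu>)"
  proof (rule bessel[OF _ _ _ _ _ _ F(1)])
    show "finite_measure ?\<mu>"
      by (rule finite_measureI) (use emeasure_unit_sq unit_sq_borel in \<open>simp add: emeasure_restrict_space space_restrict_space\<close>)
    show "disc K P C \<delta> \<in> borel_measurable ?\<mu>"
      by (rule measurable_restrict_space1) (use disc_measurable_snd[OF C(1)] in simp)
    show "torus_char n \<in> borel_measurable ?\<mu>" for n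
      by (rule measurable_restrict_space1) (use torus_char_measurable in simp)
    show "\<bar>disc K P C \<delta> \<tau>\<bar> \<le> real (card P) * count_bound K" for \<tau> by (rule disc_bound[OF C \<delta>])
    show "(\<integral>x. cnj (torus_char n x) * torus_char m x \<partial>?\<mu>) = (if n = m then 1 else 0)" for n m
      unfolding conv torus_char_diff torus_char_integral by auto
  qed simp
  then have "(\<Sum>n\<in>F. (norm (LINT \<tau>:unit_sq|lborel. of_real (disc K P C \<delta> \<tau>) * torus_char n \<tau>))\<^sup>2) \<le> sq_disc K P C \<delta>"
    by (simp only: conv sq_disc_def)
  moreover have "(norm (LINT \<tau>:unit_sq|lborel. of_real (disc K P C \<delta> \<tau>) * torus_char n \<tau>))\<^sup>2
      = (norm (exp_sum P n))\<^sup>2 * (norm (fourier ((*\<^sub>R) \<delta> ` C) (int_vec n)))\<^sup>2" if "n \<in> F" for n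
  proof -
    have "n \<noteq> 0" using that F by auto
    then show ?thesis using disc_fourier[OF C \<delta> P] by (simp add: norm_mult power_mult_distrib)
  qed
  ultimately show ?thesis by (simp cong: sum.cong)
qed

text \<open>The argument of Cassels and Montgomery: the form \<open>\<Sum>\<^sub>n\<^sub>,\<^sub>m |S(n - m)|\<^sup>2\<close> over a box is also
  \<open>\<Sum>\<^sub>p\<^sub>,\<^sub>q |\<Sum>\<^sub>n e(n \<bullet> (p - q))|\<^sup>2\<close>, whose diagonal alone is large.\<close>

lemma exp_sum_large:
  assumes P: "finite P" and X: "2 * card P \<le> X\<^sup>2"
  shows "(real (card P))\<^sup>2 \<le> (\<Sum>n\<in>int_box X - {0}. (norm (exp_sum P n))\<^sup>2)"
proof -
  define B where "B = {0..<int X} \<times> {0..<int X}"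
  have B: "finite B" "card B = X\<^sup>2" by (simp_all add: B_def card_cartesian_product power2_eq_square)
  define N where "N = real (card P)"
  define \<phi> where "\<phi> n = (norm (exp_sum P n))\<^sup>2" for n
  have \<phi>: "complex_of_real (\<phi> (n - m)) = (\<Sum>p\<in>P. \<Sum>q\<in>P. (torus_char n p * cnj (torus_char n q)) * cnj (torus_char m p * cnj (torus_char m q)))" for n m
  proof -
    have "complex_of_real (\<phi> (n - m)) = exp_sum P (n - m) * cnj (exp_sum P (n - m))"
      unfolding \<phi>_def by (rule complex_norm_square)
    also have "\<dots> = (\<Sum>p\<in>P. \<Sum>q\<in>P. torus_char (n - m) p * cnj (torus_char (n - m) q))"
      by (simp add: exp_sum_def sum_product)
    finally show ?thesis by (simp add: torus_char_diff[symmetric] mult_ac)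
  qed
  have "complex_of_real (\<Sum>n\<in>B. \<Sum>m\<in>B. \<phi> (n - m))
     = (\<Sum>n\<in>B. \<Sum>m\<in>B. \<Sum>p\<in>P. \<Sum>q\<in>P. (torus_char n p * cnj (torus_char n q)) * cnj (torus_char m p * cnj (torus_char m q)))"
    by (simp add: \<phi>)
  also have "\<dots> = (\<Sum>p\<in>P. \<Sum>q\<in>P. \<Sum>n\<in>B. \<Sum>m\<in>B. (torus_char n p * cnj (torus_char n q)) * cnj (torus_char m p * cnj (torus_char m q)))"
  proof -
    have "(\<Sum>n\<in>B. \<Sum>m\<in>B. \<Sum>p\<in>P. \<Sum>q\<in>P. f n m p q) = (\<Sum>p\<in>P. \<Sum>q\<in>P. \<Sum>n\<in>B. \<Sum>m\<in>B. f n m p q)"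
      for f :: "int \<times> int \<Rightarrow> int \<times> int \<Rightarrow> real \<times> real \<Rightarrow> real \<times> real \<Rightarrow> complex"
    proof -
      have "(\<Sum>n\<in>B. \<Sum>m\<in>B. \<Sum>p\<in>P. \<Sum>q\<in>P. f n m p q) = (\<Sum>n\<in>B. \<Sum>p\<in>P. \<Sum>m\<in>B. \<Sum>q\<in>P. f n m p q)"
        by (intro sum.cong refl sum.swap)
      also have "\<dots> = (\<Sum>p\<in>P. \<Sum>n\<in>B. \<Sum>m\<in>B. \<Sum>q\<in>P. f n m p q)" by (rule sum.swap)
      also have "\<dots> = (\<Sum>p\<in>P. \<Sum>n\<in>B. \<Sum>q\<in>P. \<Sum>m\<in>B. f n m p q)"
        by (intro sum.cong refl sum.swap)
      also have "\<dots> = (\<Sum>p\<in>P. \<Sum>q\<in>P. \<Sum>n\<in>B. \<Sum>m\<in>B. f n m p q)"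
        by (intro sum.cong refl sum.swap)
      finally show ?thesis .
    qed
    then show ?thesis .
  qed
  also have "\<dots> = (\<Sum>p\<in>P. \<Sum>q\<in>P. complex_of_real ((norm (\<Sum>n\<in>B. torus_char n p * cnj (torus_char n q)))\<^sup>2))"
    by (simp only: complex_norm_square cnj_sum sum_product)
  finally have "complex_of_real (\<Sum>n\<in>B. \<Sum>m\<in>B. \<phi> (n - m))
      = complex_of_real (\<Sum>p\<in>P. \<Sum>q\<in>P. (norm (\<Sum>n\<in>B. torus_char n p * cnj (torus_char n q)))\<^sup>2)" by simp
  then have "(\<Sum>n\<in>B. \<Sum>m\<in>B. \<phi> (n - m)) = (\<Sum>p\<in>P. \<Sum>q\<in>P. (norm (\<Sum>n\<in>B. torus_char n p * cnj (torus_char n q)))\<^sup>2)"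
    by (simp only: of_real_eq_iff)
  also have "\<dots> \<ge> (\<Sum>p\<in>P. (real X ^ 2)\<^sup>2)"
  proof (rule sum_mono)
    fix p assume p: "p \<in> P"
    have "torus_char n p * cnj (torus_char n p) = 1" for n by (simp add: complex_norm_square[symmetric])
    then have "(real X ^ 2)\<^sup>2 = (norm (\<Sum>n\<in>B. torus_char n p * cnj (torus_char n p)))\<^sup>2"
      by (simp add: B norm_power)
    also have "\<dots> \<le> (\<Sum>q\<in>P. (norm (\<Sum>n\<in>B. torus_char n p * cnj (torus_char n q)))\<^sup>2)"
      by (rule member_le_sum[OF p]) (use P in auto)
    finally show "(real X ^ 2)\<^sup>2 \<le> (\<Sum>q\<in>P. (norm (\<Sum>n\<in>B. torus_char n p * cnj (torus_char n q)))\<^sup>2)" .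
  qed
  finally have 1: "N * (real X ^ 2)\<^sup>2 \<le> (\<Sum>n\<in>B. \<Sum>m\<in>B. \<phi> (n - m))" by (simp add: N_def)
  define T where "T = (\<Sum>d\<in>int_box X - {0}. \<phi> d)"
  \<comment> \<open>For fixed n in the square B the differences n - m are distinct and lie in
    \<open>int_box X\<close>; m = n contributes N^2, the rest is part of T.\<close>
  have "(\<Sum>m\<in>B. \<phi> (n - m)) \<le> N\<^sup>2 + T" if n: "n \<in> B" for n
  proof -
    have "(\<Sum>m\<in>B. \<phi> (n - m)) = \<phi> (n - n) + (\<Sum>m\<in>B - {n}. \<phi> (n - m))"
      by (rule sum.remove) (use B n in auto)
    also have "\<phi> (n - n) = N\<^sup>2" by (simp add: \<phi>_def exp_sum_def torus_char_def int_vec_def N_def zero_prod_def[symmetric])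
    also have "(\<Sum>m\<in>B - {n}. \<phi> (n - m)) = (\<Sum>d\<in>(\<lambda>m. n - m) ` (B - {n}). \<phi> d)"
      by (subst sum.reindex) (auto simp: inj_on_def)
    also have "\<dots> \<le> T"
      unfolding T_def
    proof (rule sum_mono2)
      show "(\<lambda>m. n - m) ` (B - {n}) \<subseteq> int_box X - {0}"
        using n by (auto simp: B_def int_box_def zero_prod_def)
    qed (auto simp: \<phi>_def)
    finally show ?thesis by simp
  qed
  then have "(\<Sum>n\<in>B. \<Sum>m\<in>B. \<phi> (n - m)) \<le> (\<Sum>n\<in>B. N\<^sup>2 + T)" by (rule sum_mono)
  then have 2: "(\<Sum>n\<in>B. \<Sum>m\<in>B. \<phi> (n - m)) \<le> real X ^ 2 * (N\<^sup>2 + T)" by (simp add: B)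
  show ?thesis
  proof (cases "X = 0")
    case True
    then show ?thesis using X by (simp add: sum_nonneg)
  next
    case False
    have "real X ^ 2 * (N * real X ^ 2) \<le> real X ^ 2 * (N\<^sup>2 + T)"
      using 1 2 by (simp add: power2_eq_square mult_ac)
    then have "N * real X ^ 2 \<le> N\<^sup>2 + T" using False by simp
    \<comment> \<open>Here X^2 \<ge> 2 N enters: it turns N X^2 \<le> N^2 + T into T \<ge>
      N^2.\<close>
    moreover have "N * (2 * N) \<le> N * real X ^ 2"
    proof (rule mult_left_mono)
      have "real (2 * card P) \<le> real (X\<^sup>2)" using X by (rule of_nat_mono)
      then show "2 * N \<le> real X ^ 2" by (simp add: N_def)
    qed (simp add: N_def)
    ultimately show ?thesis by (simp add: T_def \<phi>_def N_def power2_eq_square)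
  qed
qed

section \<open>Lower bound for round bodies\<close>

lemma round_body_scale:
  assumes rd: "round_body r R C" and d: "0 < d"
  shows "round_body (d * r) (d * R) ((*\<^sub>R) d ` C)"
  unfolding round_body_def
proof (intro allI impI)
  fix u :: "real \<times> real" assume "norm u = 1"
  then obtain p where p: "cball (p - r *\<^sub>R u) r \<subseteq> C" "C \<subseteq> cball (p - R *\<^sub>R u) R"
    using rd unfolding round_body_def by blast
  have sc: "(*\<^sub>R) d ` cball (p - s *\<^sub>R u) s = cball (d *\<^sub>R p - (d * s) *\<^sub>R u) (d * s)" for s
    using cball_scale[of d "p - s *\<^sub>R u" s] d by (simp add: scaleR_diff_right)
  show "\<exists>p. cball (p - (d * r) *\<^sub>R u) (d * r) \<subseteq> (*\<^sub>R) d ` C \<and> (*\<^sub>R) d ` C \<subseteq> cball (p - (d * R) *\<^sub>R u) (d * R)"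
    using image_mono[OF p(1), of "(*\<^sub>R) d"] image_mono[OF p(2), of "(*\<^sub>R) d"] unfolding sc by blast
qed

lemma tangent_balls_mono:
  fixes p u :: "real \<times> real"
  assumes "norm u = 1" "s \<le> s'"
  shows "cball (p - s *\<^sub>R u) s \<subseteq> cball (p - s' *\<^sub>R u) s'"
proof
  fix z assume z: "z \<in> cball (p - s *\<^sub>R u) s"
  have "dist (p - s' *\<^sub>R u) (p - s *\<^sub>R u) = norm ((s - s') *\<^sub>R u)"
    by (simp add: dist_norm algebra_simps)
  also have "\<dots> = s' - s" using assms by simp
  finally have "dist (p - s' *\<^sub>R u) (p - s *\<^sub>R u) = s' - s" .
  then show "z \<in> cball (p - s' *\<^sub>R u) s'"
    using z dist_triangle[of "p - s' *\<^sub>R u" z "p - s *\<^sub>R u"] by simp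
qed

lemma round_body_mono:
  assumes rd: "round_body r R C" and "r' \<le> r" "R \<le> R'"
  shows "round_body r' R' C"
  unfolding round_body_def
proof (intro allI impI)
  fix u :: "real \<times> real" assume u: "norm u = 1"
  then obtain p where p: "cball (p - r *\<^sub>R u) r \<subseteq> C" "C \<subseteq> cball (p - R *\<^sub>R u) R"
    using rd unfolding round_body_def by blast
  then show "\<exists>p. cball (p - r' *\<^sub>R u) r' \<subseteq> C \<and> C \<subseteq> cball (p - R' *\<^sub>R u) R'"
    using tangent_balls_mono[OF u assms(2), of p] tangent_balls_mono[OF u assms(3), of p] by blast
qed

lemma norm_int_vec_ge_1:
  assumes "n \<noteq> 0"
  shows "1 \<le> norm (int_vec n)"
proof -
  have "fst n \<noteq> 0 \<or> snd n \<noteq> 0" using assms by (auto simp: prod_eq_iff)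
  then have "1 \<le> \<bar>real_of_int (fst n)\<bar> \<or> 1 \<le> \<bar>real_of_int (snd n)\<bar>" by linarith
  then show ?thesis
    using norm_fst_le[of "real_of_int (fst n)" "real_of_int (snd n)"]
      norm_snd_le[of "real_of_int (snd n)" "real_of_int (fst n)"]
    unfolding int_vec_def by auto
qed

text \<open>All dilates with \<delta> \<ge> 1/2 are round with radii r/2 and R, so one \<theta>
  serves every frequency and every dilate. The set of good \<delta> depends on n, only the bound for
  its measure is uniform. The exponent 3 is twice the 3/2 of the transform.\<close>

lemma round_body_fourier_lower:
  assumes C: "compact C" "convex C" and C4: "cball 0 4 \<subseteq> C"
    and r: "0 < r" "r \<le> R" and rd: "round_body r R C"
  obtains c \<theta> where "0 < c" "0 < \<theta>"
    "\<And>n. n \<noteq> 0 \<Longrightarrow> \<exists>A\<in>sets borel. A \<subseteq> {0..1} \<and> \<theta> \<le> measure lborel A \<and>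
      (\<forall>\<delta>\<in>A. c / (norm (int_vec n))^3 \<le> (norm (fourier ((*\<^sub>R) \<delta> ` C) (int_vec n)))\<^sup>2)"
proof -
  define r' where "r' = r / 2"
  have r': "0 < r'" "r' \<le> R" using r by (auto simp: r'_def)
  have R: "0 < R" using r by simp
  \<comment> \<open>The first entry makes e small against the ratio of the square-root constants,
    the second keeps e^2 within the inner radius.\<close>
  define e where "e = min (sqrt r' / (8 * (2 * sqrt (2 * R)))) (sqrt r')"
  have "x / (2 * y) \<le> 1" "x / (8 * (2 * y)) \<le> 1" if "x \<le> y" "0 < y" for x y :: real
    using that by (simp_all add: divide_le_eq)
  moreover have "sqrt r' \<le> sqrt (2 * R)" using r' by (intro real_sqrt_le_mono) simp
  moreover have "0 < sqrt (2 * R)" using R by simp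
  ultimately have q1: "sqrt r' / (2 * sqrt (2 * R)) \<le> 1" "sqrt r' / (8 * (2 * sqrt (2 * R))) \<le> 1"
    by blast+
  have e_le: "e \<le> sqrt r'" "e \<le> sqrt r' / (8 * (2 * sqrt (2 * R)))"
    unfolding e_def by (rule min.cobounded2 min.cobounded1)+
  have e: "0 < e" "e \<le> 1" "e \<le> sqrt r'" "e \<le> sqrt r' / (8 * (2 * sqrt (2 * R)))"
  proof -
    show "0 < e" unfolding e_def using r' R by simp
    show "e \<le> 1" using e_le(2) q1(2) by linarith
  qed fact+
  have e2: "8 * (2 * sqrt (2 * R)) * e \<le> sqrt r'"
    using e(4) R by (simp add: pos_le_divide_eq mult.commute)
  have e3: "e\<^sup>2 \<le> r'"
    using power_mono[OF e(3), of 2] e(1) r' by simp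
  define \<theta> where "\<theta> = (sqrt r' / (2 * sqrt (2 * R)))^3 * e^3 / 512"
  have \<theta>: "0 < \<theta>" using e r' R by (simp add: \<theta>_def)
  have "(sqrt r' / (2 * sqrt (2 * R)))^3 * e^3 \<le> 1 * 1"
    using q1 e r' R by (intro mult_mono power_le_one) auto
  then have \<theta>1: "\<theta> \<le> 1 / 2" unfolding \<theta>_def by linarith
  define c where "c = (2 * sqrt (2 * R) * \<theta>)\<^sup>2"
  have c: "0 < c" using \<theta> R by (simp add: c_def)
  show thesis
  proof (rule that[OF c, of "\<theta> / 4"])
    show "0 < \<theta> / 4" using \<theta> by simp
    fix n :: "int \<times> int" assume n: "n \<noteq> 0"
    define v where "v = int_vec n"
    have v1: "1 \<le> norm v" using norm_int_vec_ge_1[OF n] by (simp add: v_def)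
    have ne: "C \<noteq> {}" using C4 by auto
    have cont: "continuous_on C (\<lambda>z. v \<bullet> z)" by (intro continuous_intros)
    obtain z0 where z0: "z0 \<in> C" "\<And>z. z \<in> C \<Longrightarrow> v \<bullet> z0 \<le> v \<bullet> z"
      using continuous_attains_inf[OF C(1) ne cont] by blast
    obtain z1 where z1: "z1 \<in> C" "\<And>z. z \<in> C \<Longrightarrow> v \<bullet> z \<le> v \<bullet> z1"
      using continuous_attains_sup[OF C(1) ne cont] by blast
    define \<Lambda> where "\<Lambda> = v \<bullet> z1 - v \<bullet> z0"
    \<comment> \<open>The ball of radius 4 has width 8 along v, and |v| \<ge> 1.\<close>
    have "8 \<le> \<Lambda>"
    proof -
      have "(4 / norm v) *\<^sub>R v \<in> C" "(- 4 / norm v) *\<^sub>R v \<in> C"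
        using C4 v1 by (auto intro!: subsetD[OF C4])
      moreover have "v \<noteq> 0" using v1 by auto
      ultimately show ?thesis
        using z1(2)[of "(4 / norm v) *\<^sub>R v"] z0(2)[of "(- 4 / norm v) *\<^sub>R v"] v1
        by (simp add: \<Lambda>_def power2_norm_eq_inner[symmetric] power2_eq_square)
    qed
    define A where "A = {\<delta>\<in>{1/2..1}. \<delta> * \<Lambda> - of_int \<lfloor>\<delta> * \<Lambda>\<rfloor> \<le> \<theta>}"
    have A: "\<theta> / 4 \<le> measure lborel A" "A \<in> sets borel"
      unfolding A_def by (rule measure_small_frac[OF \<open>8 \<le> \<Lambda>\<close> \<theta> \<theta>1])+
    have "c / (norm v)^3 \<le> (norm (fourier ((*\<^sub>R) \<delta> ` C) v))\<^sup>2" if d: "\<delta> \<in> A" for \<delta>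
    proof -
      have d12: "1 / 2 \<le> \<delta>" "\<delta> \<le> 1" and fr: "\<delta> * \<Lambda> - of_int \<lfloor>\<delta> * \<Lambda>\<rfloor> \<le> \<theta>"
        using d by (auto simp: A_def)
      let ?S = "(*\<^sub>R) \<delta> ` C"
      have S: "compact ?S" "convex ?S" using C by (auto intro: compact_scaling convex_scaling)
      have "r' \<le> \<delta> * r" "\<delta> * R \<le> R"
        using d12 r R mult_right_mono[of "1/2" \<delta> r] by (auto simp: r'_def)
      then have rdS: "round_body r' R ?S"
        using round_body_mono[OF round_body_scale[OF rd]] d12 by simp
      have dL: "v \<bullet> (\<delta> *\<^sub>R z1) - v \<bullet> (\<delta> *\<^sub>R z0) = \<delta> * \<Lambda>" by (simp add: \<Lambda>_def algebra_simps)
      have "(1 / 2) * 8 \<le> \<delta> * \<Lambda>" using d12 \<open>8 \<le> \<Lambda>\<close> by (intro mult_mono) auto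
      then have L1: "1 \<le> v \<bullet> (\<delta> *\<^sub>R z1) - v \<bullet> (\<delta> *\<^sub>R z0)" unfolding dL by simp
      have d0: "0 \<le> \<delta>" using d12 by simp
      have "2 * sqrt (2 * R) * \<theta> / (norm v * sqrt (norm v)) \<le> norm (fourier ?S v)"
        unfolding \<theta>_def
      proof (rule norm_fourier_round[OF S r' rdS e(1) e2 e3 v1 _ _ _ _ L1])
        show "v \<bullet> (\<delta> *\<^sub>R z1) - v \<bullet> (\<delta> *\<^sub>R z0) - of_int \<lfloor>v \<bullet> (\<delta> *\<^sub>R z1) - v \<bullet> (\<delta> *\<^sub>R z0)\<rfloor>
            \<le> (sqrt r' / (2 * sqrt (2 * R)))^3 * e^3 / 512"
          unfolding dL using fr by (simp add: \<theta>_def)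
        show "v \<bullet> \<delta> *\<^sub>R z0 \<le> v \<bullet> z" if zS: "z \<in> ?S" for z
        proof -
          obtain x where "x \<in> C" "z = \<delta> *\<^sub>R x" using zS by blast
          then show ?thesis using z0(2)[of x] d0 by (simp add: mult_left_mono)
        qed
        show "v \<bullet> z \<le> v \<bullet> \<delta> *\<^sub>R z1" if zS: "z \<in> ?S" for z
        proof -
          obtain x where "x \<in> C" "z = \<delta> *\<^sub>R x" using zS by blast
          then show ?thesis using z1(2)[of x] d0 by (simp add: mult_left_mono)
        qed
      qed (use z0(1) z1(1) in auto)
      then have "(2 * sqrt (2 * R) * \<theta> / (norm v * sqrt (norm v)))\<^sup>2 \<le> (norm (fourier ?S v))\<^sup>2"
        using \<theta> R by (intro power_mono) auto
      moreover have "(2 * sqrt (2 * R) * \<theta> / (norm v * sqrt (norm v)))\<^sup>2 = c / (norm v)^3"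
        by (simp add: c_def power_divide power_mult_distrib power2_eq_square power3_eq_cube)
      ultimately show ?thesis by simp
    qed
    then show "\<exists>A\<in>sets borel. A \<subseteq> {0..1} \<and> \<theta> / 4 \<le> measure lborel A \<and>
      (\<forall>\<delta>\<in>A. c / (norm (int_vec n))^3 \<le> (norm (fourier ((*\<^sub>R) \<delta> ` C) (int_vec n)))\<^sup>2)"
      using A by (intro bexI[of _ A]) (auto simp: v_def A_def)
  qed
qed

text \<open>For X of order sqrt N the squared exponential sums over the box add up to at least N^2,
  while each squared transform is at least of order N^(-3/2) on a set of \<delta> of measure
  \<theta>. As these sets vary with n, each frequency is integrated over its own set before
  summing.\<close>

lemma round_body_min_quad:
  assumes C: "compact C" "convex C" "C \<subseteq> cball 0 (real K)" and C4: "cball 0 4 \<subseteq> C"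
    and r: "0 < r" "r \<le> R" and rd: "round_body r R C"
  obtains c where "0 < c" "\<And>N. 1 \<le> N \<Longrightarrow> c * sqrt (real N) \<le> min_quad_discrepancy C N"
proof -
  obtain c \<theta> where c: "0 < c" and \<theta>: "0 < \<theta>" and ex: "\<And>n. n \<noteq> 0 \<Longrightarrow> \<exists>A\<in>sets borel. A \<subseteq> {0..1} \<and> \<theta> \<le> measure lborel A \<and>
      (\<forall>\<delta>\<in>A. c / (norm (int_vec n))^3 \<le> (norm (fourier ((*\<^sub>R) \<delta> ` C) (int_vec n)))\<^sup>2)"
    using round_body_fourier_lower[OF C(1,2) C4 r rd] by blast
  obtain A where A: "\<And>n. n \<noteq> 0 \<Longrightarrow> A n \<in> sets borel \<and> A n \<subseteq> {0..1} \<and> \<theta> \<le> measure lborel (A n) \<and>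
      (\<forall>\<delta>\<in>A n. c / (norm (int_vec n))^3 \<le> (norm (fourier ((*\<^sub>R) \<delta> ` C) (int_vec n)))\<^sup>2)"
    using ex by metis
  show thesis
  proof (rule that[of "c * \<theta> / 216"])
    show "0 < c * \<theta> / 216" using c \<theta> by simp
    fix N :: nat assume N: "1 \<le> N"
    define s where "s = sqrt (real N)"
    have s: "1 \<le> s" "s * s = real N" using N by (auto simp: s_def)
    define X where "X = nat \<lceil>sqrt (2 * real N)\<rceil>"
    have Xr: "sqrt (2 * real N) \<le> real X" by (simp add: X_def real_nat_ceiling_ge)
    have X2: "2 * N \<le> X\<^sup>2"
    proof -
      have "(sqrt (2 * real N))\<^sup>2 \<le> (real X)\<^sup>2" using Xr by (intro power_mono) auto
      then have "real (2 * N) \<le> real (X\<^sup>2)" by simp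
      then show ?thesis by (simp only: of_nat_le_iff)
    qed
    have X3: "real X \<le> 3 * s"
    proof -
      have "real X \<le> sqrt (2 * real N) + 1"
        using ceiling_correct[of "sqrt (2 * real N)"] by (simp add: X_def)
      moreover have "sqrt (2 * real N) \<le> 2 * s"
        unfolding s_def using real_sqrt_le_mono[of "2 * real N" "4 * real N"] by (simp add: real_sqrt_mult)
      ultimately show ?thesis using s by linarith
    qed
    \<comment> \<open>Frequencies in the box have norm at most 2 X \<le> 6 s; the cube of 6 is the
      216 of the constant.\<close>
    define k0 where "k0 = c / (6 * s)^3"
    have k0: "0 < k0" using c s by (simp add: k0_def)
    let ?F = "int_box X - {0}"
    have k0_le: "k0 \<le> c / (norm (int_vec n))^3" if "n \<in> ?F" for n
      unfolding k0_def
    proof (rule divide_left_mono)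
      have n0: "n \<noteq> 0" using that by simp
      have "norm (int_vec n) \<le> \<bar>real_of_int (fst n)\<bar> + \<bar>real_of_int (snd n)\<bar>"
        using norm_Pair_le[of "real_of_int (fst n)" "real_of_int (snd n)"] by (simp add: int_vec_def)
      also have "\<dots> \<le> real X + real X"
        using that by (intro add_mono) (auto simp: int_box_def)
      also have "\<dots> \<le> 6 * s" using X3 by simp
      finally show "norm (int_vec n) ^ 3 \<le> (6 * s) ^ 3" by (intro power_mono) auto
      show "0 < (6 * s) ^ 3 * norm (int_vec n) ^ 3"
        using s norm_int_vec_ge_1[OF n0] by (intro mult_pos_pos zero_less_power) linarith+
    qed (use c in simp)
    show "c * \<theta> / 216 * sqrt (real N) \<le> min_quad_discrepancy C N"
    proof (rule min_quad_ge)
      fix P assume P: "P \<in> point_sets N"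
      then have fP: "finite P" "card P = N" "P \<subseteq> unit_sq" by (auto simp: point_sets_def)
      define a where "a n = (norm (exp_sum P n))\<^sup>2 * k0" for n
      have a0: "0 \<le> a n" for n using k0 by (simp add: a_def)
      have An: "A n \<in> sets borel" "A n \<subseteq> {0..1}" "\<theta> \<le> measure lborel (A n)" if "n \<in> ?F" for n
        using A[of n] that by auto
      have pw: "(\<Sum>n\<in>?F. a n * indicator (A n) \<delta>) \<le> sq_disc K P C \<delta>" if d: "\<delta> \<in> {0..1}" for \<delta>
      proof -
        have "(\<Sum>n\<in>?F. a n * indicator (A n) \<delta>)
            \<le> (\<Sum>n\<in>?F. (norm (exp_sum P n))\<^sup>2 * (norm (fourier ((*\<^sub>R) \<delta> ` C) (int_vec n)))\<^sup>2)"
        proof (rule sum_mono)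
          fix n assume n: "n \<in> ?F"
          show "a n * indicator (A n) \<delta> \<le> (norm (exp_sum P n))\<^sup>2 * (norm (fourier ((*\<^sub>R) \<delta> ` C) (int_vec n)))\<^sup>2"
          proof (cases "\<delta> \<in> A n")
            case True
            have "k0 \<le> (norm (fourier ((*\<^sub>R) \<delta> ` C) (int_vec n)))\<^sup>2"
              using k0_le[OF n] A[of n] n True by force
            then show ?thesis using True by (simp add: a_def mult_left_mono)
          qed simp
        qed
        also have "\<dots> \<le> sq_disc K P C \<delta>"
          by (rule sq_disc_fourier[OF C(1,3) _ _ fP(3)]) (use d in auto)
        finally show ?thesis .
      qed
      have Afin: "emeasure lborel (A n) < \<infinity>" if "n \<in> ?F" for n
      proof -
        have "emeasure lborel (A n) \<le> emeasure lborel {0..1::real}"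
          by (rule emeasure_mono) (use An[OF that] in auto)
        also have "\<dots> = ennreal (1 - 0)" by (rule emeasure_lborel_Icc) simp
        also have "\<dots> < \<infinity>" by (simp only: ennreal_less_top infinity_ennreal_def)
        finally show ?thesis .
      qed
      have ii: "integrable lborel (\<lambda>\<delta>. a n * indicat_real (A n) \<delta>)" if "n \<in> ?F" for n
        using An[OF that] Afin[OF that] by (intro integrable_mult_right integrable_real_indicator) auto
      have restr: "indicat_real {0..1} \<delta> *\<^sub>R (\<Sum>n\<in>?F. a n * indicator (A n) \<delta>) = (\<Sum>n\<in>?F. a n * indicator (A n) \<delta>)" for \<delta>
      proof (cases "\<delta> \<in> {0..1}")
        case False
        then have "indicat_real (A n) \<delta> = 0" if "n \<in> ?F" for n using An(2)[OF that] by (auto simp: indicator_def)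
        then show ?thesis by simp
      qed simp
      have "c * \<theta> / 216 * sqrt (real N) = (real N)\<^sup>2 * (k0 * \<theta>)"
      proof -
        have "(real N)\<^sup>2 * (k0 * \<theta>) = (s * s)\<^sup>2 * (c / (6 * s)^3 * \<theta>)" by (simp add: s k0_def)
        also have "\<dots> = c * \<theta> / 216 * s"
          using s(1) by (simp add: power2_eq_square power3_eq_cube)
        finally show ?thesis by (simp only: s_def)
      qed
      also have "\<dots> \<le> (\<Sum>n\<in>?F. (norm (exp_sum P n))\<^sup>2) * (k0 * \<theta>)"
        using exp_sum_large[OF fP(1), of X] X2 k0 \<theta> fP(2) by (intro mult_right_mono) auto
      also have "\<dots> = (\<Sum>n\<in>?F. a n * \<theta>)" by (simp only: sum_distrib_right a_def mult.assoc)
      also have "\<dots> \<le> (\<Sum>n\<in>?F. a n * measure lborel (A n))"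
        by (intro sum_mono mult_left_mono An a0)
      also have "\<dots> = (\<Sum>n\<in>?F. (\<integral>\<delta>. a n * indicat_real (A n) \<delta> \<partial>lborel))"
        by (intro sum.cong refl) (use An in simp)
      also have "\<dots> = (\<integral>\<delta>. (\<Sum>n\<in>?F. a n * indicat_real (A n) \<delta>) \<partial>lborel)"
        by (rule Bochner_Integration.integral_sum[symmetric]) (rule ii)
      also have "\<dots> = (LINT \<delta>:{0..1}|lborel. (\<Sum>n\<in>?F. a n * indicat_real (A n) \<delta>))"
        unfolding set_lebesgue_integral_def restr ..
      also have "\<dots> \<le> (LINT \<delta>:{0..1}|lborel. sq_disc K P C \<delta>)"
      proof (rule set_integral_mono[OF _ sq_disc_integrable[OF C(1,3)] pw])
        show "set_integrable lborel {0..1} (\<lambda>\<delta>. \<Sum>n\<in>?F. a n * indicat_real (A n) \<delta>)"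
          unfolding set_integrable_def restr by (intro Bochner_Integration.integrable_sum ii)
      qed
      also have "\<dots> = quad_discrepancy P C" by (rule quad_discrepancy_eq[OF C(1,3) fP(3), symmetric])
      finally show "c * \<theta> / 216 * sqrt (real N) \<le> quad_discrepancy P C" .
    qed
  qed
qed

text \<open>A polygon \<open>{z. \<forall>a\<in>H. a \<bullet> z \<le> 1}\<close>, smoothed by penalizing its constraints and made
  strictly convex by a small multiple of \<open>|z|\<^sup>2\<close>.\<close>

definition penalty :: "(real \<times> real) set \<Rightarrow> real \<Rightarrow> real \<Rightarrow> real \<times> real \<Rightarrow> real" where
  "penalty H k b z = k * (z \<bullet> z) + b * (\<Sum>a\<in>H. (max 0 (a \<bullet> z - 1))\<^sup>2)"

definition penalty_grad :: "(real \<times> real) set \<Rightarrow> real \<Rightarrow> real \<Rightarrow> real \<times> real \<Rightarrow> real \<times> real" where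
  "penalty_grad H k b z = (2 * k) *\<^sub>R z + (\<Sum>a\<in>H. (2 * b * max 0 (a \<bullet> z - 1)) *\<^sub>R a)"

definition smooth_body :: "(real \<times> real) set \<Rightarrow> real \<Rightarrow> real \<Rightarrow> (real \<times> real) set" where
  "smooth_body H k b = {z. penalty H k b z \<le> 1}"

text \<open>The squared hinge is convex with derivative \<open>2 * max 0 t\<close> of Lipschitz
  constant 2, so it lies between its tangent and the tangent plus s^2.\<close>

lemma hinge_square_bounds:
  fixes t s :: real
  shows "(max 0 t)\<^sup>2 + 2 * max 0 t * s \<le> (max 0 (t + s))\<^sup>2"
    and "(max 0 (t + s))\<^sup>2 \<le> (max 0 t)\<^sup>2 + 2 * max 0 t * s + s\<^sup>2"
proof -
  define A B where "A = max 0 t" and "B = max 0 (t + s)"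
  have "0 \<le> (A - B)\<^sup>2" by simp
  then have "2 * (A * B) - A * A \<le> B * B" by (simp add: power2_eq_square algebra_simps)
  moreover have "A * (t + s) \<le> A * B" unfolding A_def B_def by (intro mult_left_mono) auto
  moreover have "A * t = A * A" by (auto simp: A_def max_def)
  ultimately have "A * A + 2 * (A * s) \<le> B * B" by (simp add: distrib_left)
  then show "(max 0 t)\<^sup>2 + 2 * max 0 t * s \<le> (max 0 (t + s))\<^sup>2"
    unfolding A_def[symmetric] B_def[symmetric] by (simp add: power2_eq_square)
  show "(max 0 (t + s))\<^sup>2 \<le> (max 0 t)\<^sup>2 + 2 * max 0 t * s + s\<^sup>2"
  proof (cases "0 \<le> t")
    case True
    have "(max 0 (t + s))\<^sup>2 \<le> (t + s)\<^sup>2" by (auto simp: max_def)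
    then show ?thesis using True by (simp add: power2_eq_square algebra_simps)
  next
    case False
    have "\<bar>max 0 (t + s)\<bar> \<le> \<bar>s\<bar>" using False by auto
    then have "(max 0 (t + s))\<^sup>2 \<le> s\<^sup>2" by (simp only: abs_le_square_iff)
    then show ?thesis using False by simp
  qed
qed

text \<open>Strong convexity comes from the term with k, the upper quadratic bound from the squared
  hinges. For a sublevel set the former yields outer tangent balls, the latter inner ones.\<close>

lemma penalty_bounds:
  assumes b: "0 \<le> b"
  shows "penalty H k b p + penalty_grad H k b p \<bullet> y + k * (y \<bullet> y) \<le> penalty H k b (p + y)"
    and "penalty H k b (p + y) \<le> penalty H k b p + penalty_grad H k b p \<bullet> y + (k + b * (\<Sum>a\<in>H. a \<bullet> a)) * (y \<bullet> y)"
proof -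
  define t where "t a = a \<bullet> p - 1" for a
  have e1: "penalty H k b (p + y) = k * (p \<bullet> p) + 2 * k * (p \<bullet> y) + k * (y \<bullet> y) + b * (\<Sum>a\<in>H. (max 0 (t a + a \<bullet> y))\<^sup>2)"
    by (simp add: penalty_def t_def inner_add_left inner_add_right inner_commute[of y p] algebra_simps)
  have e2: "penalty_grad H k b p \<bullet> y = 2 * k * (p \<bullet> y) + b * (\<Sum>a\<in>H. 2 * max 0 (t a) * (a \<bullet> y))"
    by (simp add: penalty_grad_def t_def inner_add_left inner_sum_left sum_distrib_left mult_ac)
  have e3: "penalty H k b p = k * (p \<bullet> p) + b * (\<Sum>a\<in>H. (max 0 (t a))\<^sup>2)" by (simp add: penalty_def t_def)
  have "(\<Sum>a\<in>H. (max 0 (t a))\<^sup>2 + 2 * max 0 (t a) * (a \<bullet> y)) \<le> (\<Sum>a\<in>H. (max 0 (t a + a \<bullet> y))\<^sup>2)"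
    by (intro sum_mono hinge_square_bounds(1))
  then have "b * (\<Sum>a\<in>H. (max 0 (t a))\<^sup>2 + 2 * max 0 (t a) * (a \<bullet> y)) \<le> b * (\<Sum>a\<in>H. (max 0 (t a + a \<bullet> y))\<^sup>2)"
    using b by (rule mult_left_mono)
  then show "penalty H k b p + penalty_grad H k b p \<bullet> y + k * (y \<bullet> y) \<le> penalty H k b (p + y)"
    unfolding e1 e2 e3 by (simp add: sum.distrib distrib_left)
  have "(\<Sum>a\<in>H. (max 0 (t a + a \<bullet> y))\<^sup>2)
      \<le> (\<Sum>a\<in>H. (max 0 (t a))\<^sup>2 + 2 * max 0 (t a) * (a \<bullet> y) + (a \<bullet> a) * (y \<bullet> y))"
  proof (rule sum_mono)
    fix a
    show "(max 0 (t a + a \<bullet> y))\<^sup>2 \<le> (max 0 (t a))\<^sup>2 + 2 * max 0 (t a) * (a \<bullet> y) + (a \<bullet> a) * (y \<bullet> y)"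
      using hinge_square_bounds(2)[of "t a" "a \<bullet> y"] Cauchy_Schwarz_ineq[of a y] by linarith
  qed
  then have "b * (\<Sum>a\<in>H. (max 0 (t a + a \<bullet> y))\<^sup>2)
      \<le> b * (\<Sum>a\<in>H. (max 0 (t a))\<^sup>2 + 2 * max 0 (t a) * (a \<bullet> y) + (a \<bullet> a) * (y \<bullet> y))"
    using b by (rule mult_left_mono)
  then show "penalty H k b (p + y) \<le> penalty H k b p + penalty_grad H k b p \<bullet> y + (k + b * (\<Sum>a\<in>H. a \<bullet> a)) * (y \<bullet> y)"
    unfolding e1 e2 e3 by (simp add: sum.distrib distrib_left distrib_right sum_distrib_right[symmetric])
qed

lemma smooth_body_compact_convex:
  assumes k: "0 < k" and b: "0 \<le> b"
  shows "compact (smooth_body H k b)" "convex (smooth_body H k b)" "smooth_body H k b \<subseteq> cball 0 (1 / sqrt k)"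
proof -
  show sub: "smooth_body H k b \<subseteq> cball 0 (1 / sqrt k)"
  proof
    fix z assume "z \<in> smooth_body H k b"
    then have "k * (z \<bullet> z) + b * (\<Sum>a\<in>H. (max 0 (a \<bullet> z - 1))\<^sup>2) \<le> 1" by (simp add: smooth_body_def penalty_def)
    moreover have "0 \<le> b * (\<Sum>a\<in>H. (max 0 (a \<bullet> z - 1))\<^sup>2)" using b by (intro mult_nonneg_nonneg sum_nonneg) auto
    ultimately have "k * (norm z)\<^sup>2 \<le> 1" by (simp add: power2_norm_eq_inner)
    then have "(norm z)\<^sup>2 \<le> 1 / k" using k by (simp add: pos_le_divide_eq mult.commute)
    then have "norm z \<le> sqrt (1 / k)" by (rule real_le_rsqrt)
    then show "z \<in> cball 0 (1 / sqrt k)" by (simp add: real_sqrt_divide)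
  qed
  have "closed (smooth_body H k b)"
    unfolding smooth_body_def penalty_def
    by (intro closed_Collect_le continuous_intros)
  then show "compact (smooth_body H k b)"
    using sub bounded_subset[OF bounded_cball] compact_eq_bounded_closed by blast
  show "convex (smooth_body H k b)"
  proof (rule convexI)
    fix x y u w assume xy: "x \<in> smooth_body H k b" "y \<in> smooth_body H k b" and uw: "0 \<le> u" "0 \<le> w" "u + w = (1::real)"
    define z where "z = u *\<^sub>R x + w *\<^sub>R y"
    \<comment> \<open>The tangent plane at z lies below the function, so it is at most 1 at x and y;
      in the weighted sum the gradient cancels.\<close>
    have low: "penalty H k b z + penalty_grad H k b z \<bullet> (q - z) \<le> 1" if "q \<in> smooth_body H k b" for q
    proof -
      have "0 \<le> k * ((q - z) \<bullet> (q - z))" using k by simp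
      then show ?thesis using penalty_bounds(1)[OF b, of H k z "q - z"] that by (simp add: smooth_body_def)
    qed
    define g where "g = penalty_grad H k b z"
    have "u * (penalty H k b z + g \<bullet> (x - z)) + w * (penalty H k b z + g \<bullet> (y - z)) \<le> u * 1 + w * 1"
      unfolding g_def using uw xy by (intro add_mono mult_left_mono low) auto
    moreover have "u * (penalty H k b z + g \<bullet> (x - z)) + w * (penalty H k b z + g \<bullet> (y - z))
        = (u + w) * penalty H k b z + g \<bullet> (u *\<^sub>R x + w *\<^sub>R y - (u + w) *\<^sub>R z)"
      by (simp add: inner_diff_right inner_add_right algebra_simps)
    ultimately have "penalty H k b z \<le> 1" using uw by (simp add: z_def)
    then show "u *\<^sub>R x + w *\<^sub>R y \<in> smooth_body H k b" by (simp add: smooth_body_def z_def)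
  qed
qed

text \<open>At the extremal point p in direction u the gradient g is a positive multiple of u, so
  the quadratic bounds at p describe balls touching there, of radius |g| / (2m) inside and |g| /
  (2k) outside. The tangent inequality at the origin gives |g| \<ge> sqrt k and compactness gives
  |g| \<le> M, which makes the radii uniform in u.\<close>

lemma smooth_body_round:
  assumes H: "finite H" and k: "0 < k" and b: "0 \<le> b"
  obtains r R where "0 < r" "r \<le> R" "round_body r R (smooth_body H k b)"
proof -
  let ?B = "smooth_body H k b" and ?F = "penalty H k b" and ?G = "penalty_grad H k b"
  note B = smooth_body_compact_convex[OF k b, of H]
  have F0: "?F 0 = 0" by (simp add: penalty_def)
  then have B0: "0 \<in> ?B" by (simp add: smooth_body_def)
  define m where "m = k + b * (\<Sum>a\<in>H. a \<bullet> a)"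
  have "0 \<le> b * (\<Sum>a\<in>H. a \<bullet> a)" using b by (intro mult_nonneg_nonneg sum_nonneg) auto
  then have m: "0 < m" "k \<le> m" using k by (auto simp: m_def)
  have "continuous_on ?B (\<lambda>z. norm (?G z))"
    unfolding penalty_grad_def by (intro continuous_intros)
  then have "compact ((\<lambda>z. norm (?G z)) ` ?B)" using B(1) by (rule compact_continuous_image)
  then obtain M where M: "\<And>z. z \<in> ?B \<Longrightarrow> norm (?G z) \<le> M"
    using compact_imp_bounded[of "(\<lambda>z. norm (?G z)) ` ?B"] unfolding bounded_iff by auto
  define r where "r = sqrt k / (2 * m)"
  define R where "R = (\<bar>M\<bar> + sqrt k) / (2 * k)"
  have r: "0 < r" using k m by (simp add: r_def)
  have rR: "r \<le> R"
  proof -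
    have "sqrt k / (2 * m) \<le> sqrt k / (2 * k)" using k m by (intro divide_left_mono) auto
    also have "\<dots> \<le> R" unfolding R_def using k by (intro divide_right_mono) auto
    finally show ?thesis by (simp add: r_def)
  qed
  have "round_body r R ?B"
    unfolding round_body_def
  proof (intro allI impI)
    fix u :: "real \<times> real" assume u: "norm u = 1"
    have cont: "continuous_on ?B (\<lambda>z. u \<bullet> z)" by (intro continuous_intros)
    obtain p where p: "p \<in> ?B" "\<And>z. z \<in> ?B \<Longrightarrow> u \<bullet> z \<le> u \<bullet> p"
      using continuous_attains_sup[OF B(1) _ cont] B0 by blast
    define g where "g = ?G p"
    have inB: "p + y \<in> ?B" if "?F p + g \<bullet> y + m * (y \<bullet> y) \<le> 1" for y
      using penalty_bounds(2)[OF b, of H k p y] that by (simp add: smooth_body_def g_def m_def)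
    have uy: "u \<bullet> y \<le> 0" if "?F p + g \<bullet> y + m * (y \<bullet> y) \<le> 1" for y
      using p(2)[OF inB[OF that]] by (simp add: inner_add_right)
    have uu: "u \<bullet> u = 1" using u by (simp add: norm_eq_1)
    \<comment> \<open>Below level 1 a short step along u would stay in the body, against the choice
      of p.\<close>
    have Fp: "?F p = 1"
    proof (rule ccontr)
      assume "?F p \<noteq> 1"
      then have d: "0 < 1 - ?F p" using p(1) by (auto simp: smooth_body_def)
      define s where "s = min 1 ((1 - ?F p) / (\<bar>g \<bullet> u\<bar> + m))"
      have gm: "0 < \<bar>g \<bullet> u\<bar> + m" using m by simp
      have s: "0 < s" "s \<le> 1" "s * (\<bar>g \<bullet> u\<bar> + m) \<le> 1 - ?F p"
        using d gm by (auto simp: s_def min_def pos_le_divide_eq)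
      have "s * (g \<bullet> u) \<le> s * \<bar>g \<bullet> u\<bar>" "m * (s * s) \<le> m * s"
        using s m by (auto intro!: mult_left_mono mult_left_le)
      then have "?F p + g \<bullet> (s *\<^sub>R u) + m * ((s *\<^sub>R u) \<bullet> (s *\<^sub>R u)) \<le> 1"
        using s(3) uu by (simp add: algebra_simps)
      from uy[OF this] show False using s(1) uu by simp
    qed
    have pk: "norm p \<le> 1 / sqrt k" using B(3) p(1) by auto
    have "?F p + g \<bullet> (0 - p) + k * ((0 - p) \<bullet> (0 - p)) \<le> ?F (p + (0 - p))"
      unfolding g_def by (rule penalty_bounds(1)[OF b])
    moreover have "0 \<le> k * (p \<bullet> p)" using k by simp
    ultimately have "1 \<le> g \<bullet> p" using Fp F0 by simp
    also have "\<dots> \<le> norm g * norm p" by (rule norm_cauchy_schwarz)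
    also have "\<dots> \<le> norm g * (1 / sqrt k)" using pk by (intro mult_left_mono) auto
    finally have gk: "sqrt k \<le> norm g" using k by (simp add: pos_le_divide_eq)
    then have g0: "0 < norm g" using k real_sqrt_gt_zero[OF k] by linarith
    define w where "w = (1 / norm g) *\<^sub>R g"
    have w: "norm w = 1" "g = norm g *\<^sub>R w" using g0 by (auto simp: w_def)
    have ww: "w \<bullet> w = 1" using w(1) by (simp add: norm_eq_1)
    \<comment> \<open>In place of a multiplier rule: the step s (u - w) stays in the body by the
      upper quadratic bound, and it moves further in direction u unless w = u.\<close>
    have "w = u"
    proof -
      define s where "s = norm g / (2 * m)"
      have s: "0 < s" "2 * m * s = norm g" using g0 m by (auto simp: s_def)
      define y where "y = s *\<^sub>R (u - w)"
      have d: "(u - w) \<bullet> (u - w) = 2 * (1 - w \<bullet> u)"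
        using uu ww by (simp add: inner_diff_left inner_diff_right inner_commute[of u w])
      have "g \<bullet> y = norm g * (w \<bullet> y)" by (subst w(2)) (simp add: inner_scaleR_left)
      also have "\<dots> = - (norm g * s * (1 - w \<bullet> u))"
        using ww by (simp add: y_def inner_diff_right algebra_simps)
      finally have gy: "g \<bullet> y = - (norm g * s * (1 - w \<bullet> u))" .
      have "m * (y \<bullet> y) = (2 * m * s) * s * (1 - w \<bullet> u)"
        unfolding y_def using d by simp
      then have "?F p + g \<bullet> y + m * (y \<bullet> y) \<le> 1" using gy s(2) Fp by simp
      from uy[OF this] have "s * (1 - w \<bullet> u) \<le> 0"
        using uu by (simp add: y_def inner_diff_right inner_commute[of u w])
      then have "1 - w \<bullet> u \<le> 0" using s(1) by (simp add: mult_le_0_iff)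
      then have "(norm (u - w))\<^sup>2 \<le> 0" using d by (simp add: power2_norm_eq_inner)
      then show ?thesis by simp
    qed
    then have gu: "g = norm g *\<^sub>R u" using w by simp
    have "cball (p - (norm g / (2 * m)) *\<^sub>R u) (norm g / (2 * m)) \<subseteq> ?B"
    proof
      define s where "s = norm g / (2 * m)"
      have s: "0 < s" "norm g = 2 * m * s" using g0 m by (auto simp: s_def)
      fix z assume "z \<in> cball (p - (norm g / (2 * m)) *\<^sub>R u) (norm g / (2 * m))"
      then have "norm ((z - p) + s *\<^sub>R u) \<le> s"
        by (simp add: dist_norm norm_minus_commute s_def algebra_simps)
      then have "(norm ((z - p) + s *\<^sub>R u))\<^sup>2 \<le> s\<^sup>2" by (intro power_mono) auto
      then have "(z - p) \<bullet> (z - p) + 2 * s * (u \<bullet> (z - p)) \<le> 0"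
        unfolding power2_norm_eq_inner using uu
        by (simp add: inner_add_left inner_add_right inner_commute[of "z - p" u] power2_eq_square distrib_left)
      then have "m * ((z - p) \<bullet> (z - p) + 2 * s * (u \<bullet> (z - p))) \<le> 0" using m by (simp add: mult_le_0_iff)
      moreover have "g \<bullet> (z - p) = 2 * m * s * (u \<bullet> (z - p))" by (subst gu) (simp add: s(2))
      ultimately have "?F p + g \<bullet> (z - p) + m * ((z - p) \<bullet> (z - p)) \<le> 1"
        using Fp by (simp add: algebra_simps)
      from inB[OF this] show "z \<in> ?B" by simp
    qed
    moreover have "r \<le> norm g / (2 * m)" unfolding r_def using gk m by (intro divide_right_mono) auto
    ultimately have "cball (p - r *\<^sub>R u) r \<subseteq> ?B" using tangent_balls_mono[OF u, of r "norm g / (2 * m)" p] by blast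
    moreover have "?B \<subseteq> cball (p - (norm g / (2 * k)) *\<^sub>R u) (norm g / (2 * k))"
    proof
      define s where "s = norm g / (2 * k)"
      have s: "0 < s" "norm g = 2 * k * s" using g0 k by (auto simp: s_def)
      fix z assume "z \<in> ?B"
      then have "?F p + g \<bullet> (z - p) + k * ((z - p) \<bullet> (z - p)) \<le> 1"
        using penalty_bounds(1)[OF b, of H k p "z - p"] by (simp add: smooth_body_def g_def)
      moreover have "g \<bullet> (z - p) = 2 * k * s * (u \<bullet> (z - p))" by (subst gu) (simp add: s(2))
      ultimately have "k * ((z - p) \<bullet> (z - p) + 2 * s * (u \<bullet> (z - p))) \<le> 0"
        using Fp by (simp add: algebra_simps)
      then have "(z - p) \<bullet> (z - p) + 2 * s * (u \<bullet> (z - p)) \<le> 0" using k by (simp add: mult_le_0_iff)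
      then have "(norm ((z - p) + s *\<^sub>R u))\<^sup>2 \<le> s\<^sup>2"
        unfolding power2_norm_eq_inner using uu
        by (simp add: inner_add_left inner_add_right inner_commute[of "z - p" u] power2_eq_square distrib_left)
      then have "norm ((z - p) + s *\<^sub>R u) \<le> s" using s(1) by (simp add: power2_le_iff_abs_le)
      then show "z \<in> cball (p - (norm g / (2 * k)) *\<^sub>R u) (norm g / (2 * k))"
        unfolding s_def[symmetric] by (simp add: dist_norm norm_minus_commute algebra_simps)
    qed
    moreover have "norm g / (2 * k) \<le> R"
    proof -
      have "norm g \<le> \<bar>M\<bar> + sqrt k" using M[OF p(1)] k by (simp add: g_def add_increasing2)
      then show ?thesis unfolding R_def using k by (intro divide_right_mono) auto
    qed
    ultimately have "?B \<subseteq> cball (p - R *\<^sub>R u) R" "cball (p - r *\<^sub>R u) r \<subseteq> ?B"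
      using tangent_balls_mono[OF u, of "norm g / (2 * k)" R p] by blast+
    then show "\<exists>p. cball (p - r *\<^sub>R u) r \<subseteq> ?B \<and> ?B \<subseteq> cball (p - R *\<^sub>R u) R" by blast
  qed
  then show thesis using that r rR by blast
qed

section \<open>Approximation of convex bodies\<close>

lemma scale_iff:
  fixes D :: "(real \<times> real) set"
  assumes "0 < c"
  shows "z \<in> (*\<^sub>R) c ` D \<longleftrightarrow> (1 / c) *\<^sub>R z \<in> D"
proof
  assume "(1 / c) *\<^sub>R z \<in> D"
  then have "c *\<^sub>R ((1 / c) *\<^sub>R z) \<in> (*\<^sub>R) c ` D" by (rule imageI)
  then show "z \<in> (*\<^sub>R) c ` D" using assms by simp
qed (use assms in auto)

lemma star_shaped_scale:
  fixes D :: "(real \<times> real) set"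
  assumes "convex D" "0 \<in> D" "0 < c" "c \<le> c'"
  shows "(*\<^sub>R) c ` D \<subseteq> (*\<^sub>R) c' ` D"
proof
  fix z assume "z \<in> (*\<^sub>R) c ` D"
  then have z: "(1 / c) *\<^sub>R z \<in> D" using assms by (simp add: scale_iff)
  have "(c / c') *\<^sub>R ((1 / c) *\<^sub>R z) + (1 - c / c') *\<^sub>R 0 \<in> D"
    using assms by (intro convexD[OF assms(1) z assms(2)]) auto
  then have "(1 / c') *\<^sub>R z \<in> D" using assms by simp
  then show "z \<in> (*\<^sub>R) c' ` D" using assms by (simp add: scale_iff)
qed

section \<open>Polygonal hulls with slopes from a net\<close>

definition supp :: "(real \<times> real) set \<Rightarrow> real \<times> real \<Rightarrow> real" where
  "supp C w = Sup ((\<bullet>) w ` C)"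

lemma supp_attained:
  assumes "compact C" "C \<noteq> {}"
  shows "\<exists>x\<in>C. supp C w = w \<bullet> x \<and> (\<forall>z\<in>C. w \<bullet> z \<le> supp C w)"
proof -
  have "continuous_on C (\<lambda>z. w \<bullet> z)" by (intro continuous_intros)
  then obtain x where x: "x \<in> C" "\<forall>z\<in>C. w \<bullet> z \<le> w \<bullet> x"
    using continuous_attains_sup[OF assms] by blast
  then have "supp C w = w \<bullet> x" unfolding supp_def by (intro cSup_eq_maximum) auto
  then show ?thesis using x by auto
qed

text \<open>Slopes from about -b to b with spacing 1/b, with the common denominator b and the shift
  \<open>theta h\<close> required by the floor sums. Their number and size are bounded in terms of b
  alone.\<close>

definition slopes :: "nat \<Rightarrow> nat \<Rightarrow> real set" where
  "slopes b h = (\<lambda>a::int. (of_int a + theta h) / real b) ` {- (int b)\<^sup>2..(int b)\<^sup>2}"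

text \<open>The smallest polygon with these slopes that contains C: its sides lie on supporting
  lines of C.\<close>

definition hull_poly :: "nat \<Rightarrow> nat \<Rightarrow> (real \<times> real) set \<Rightarrow> (real \<times> real) set" where
  "hull_poly b h C = poly_body (slopes b h) (\<lambda>s. supp C (- s, 1)) (\<lambda>s. supp C (- s, - 1))"

lemma hull_poly_iff:
  "z \<in> hull_poly b h C \<longleftrightarrow> (\<forall>w\<in>(\<lambda>s. (- s, 1)) ` slopes b h \<union> (\<lambda>s. (- s, - 1)) ` slopes b h. w \<bullet> z \<le> supp C w)"
  by (simp add: hull_poly_def poly_body_def ball_Un inner_prod_def ball_conj_distrib
      minus_diff_commute[of "snd z"])

lemma theta_bounds:
  assumes "h > 0"
  shows "0 < theta h" "theta h \<le> 2"
proof -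
  have h: "1 \<le> real h" using assms by simp
  show "0 < theta h" using h by (simp add: theta_def)
  have "real h * 1 \<le> real h * real h" using h by (intro mult_left_mono) auto
  then have "real h + 1 \<le> 2 * (real h)\<^sup>2" using h unfolding power2_eq_square by linarith
  then show "theta h \<le> 2" using h by (simp add: theta_def pos_divide_le_eq)
qed

lemma slopes_facts:
  assumes b: "b > 0" and h: "h > 0"
  shows "finite (slopes b h)" "slopes b h \<noteq> {}" "real (card (slopes b h)) \<le> 2 * (real b)\<^sup>2 + 1"
    "s \<in> slopes b h \<Longrightarrow> \<exists>a::int. s = (of_int a + theta h) / real b"
    "s \<in> slopes b h \<Longrightarrow> \<bar>s\<bar> \<le> real b + 2"
proof -
  let ?I = "{- (int b)\<^sup>2..(int b)\<^sup>2}"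
  show "finite (slopes b h)" by (simp add: slopes_def)
  have "(0::int) \<in> ?I" by simp
  then show "slopes b h \<noteq> {}" unfolding slopes_def by blast
  have "card (slopes b h) \<le> card ?I" unfolding slopes_def by (rule card_image_le) simp
  moreover have "real (card ?I) = 2 * (real b)\<^sup>2 + 1"
  proof -
    have "int (card ?I) = 2 * (int b)\<^sup>2 + 1" by simp
    then have "real_of_int (int (card ?I)) = real_of_int (2 * (int b)\<^sup>2 + 1)" by (rule arg_cong)
    then show ?thesis by simp
  qed
  ultimately show "real (card (slopes b h)) \<le> 2 * (real b)\<^sup>2 + 1" by (metis of_nat_mono)
  assume s: "s \<in> slopes b h"
  then show "\<exists>a::int. s = (of_int a + theta h) / real b" by (auto simp: slopes_def)
  obtain a :: int where a: "a \<in> ?I" "s = (of_int a + theta h) / real b" using s by (auto simp: slopes_def)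
  have "\<bar>a\<bar> \<le> (int b)\<^sup>2" using a(1) by auto
  then have "real_of_int \<bar>a\<bar> \<le> real_of_int ((int b)\<^sup>2)" by (simp only: of_int_le_iff)
  then have "\<bar>of_int a + theta h\<bar> \<le> (real b)\<^sup>2 + 2" using theta_bounds[OF h] by simp
  then have "\<bar>s\<bar> \<le> ((real b)\<^sup>2 + 2) / real b" unfolding a(2) abs_divide using b by (simp add: divide_right_mono)
  also have "\<dots> = real b + 2 / real b" using b by (simp add: add_divide_distrib power2_eq_square)
  also have "\<dots> \<le> real b + 2" using b by (simp add: divide_le_eq)
  finally show "\<bar>s\<bar> \<le> real b + 2" .
qed

text \<open>If |fst v| \<le> b |snd v|, the ideal slope lies in [-b, b]; rounding it down and
  shifting by \<open>theta h\<close> \<le> 2 costs at most 3/b. Otherwise v is nearly horizontal,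
  and an extreme slope serves with error at most 2/b in each coordinate.\<close>

lemma slope_net:
  fixes v :: "real \<times> real"
  assumes b: "b > 0" and h: "h > 0" and v: "norm v = 1"
  obtains c w where "0 \<le> c" "w \<in> (\<lambda>s. (- s, 1)) ` slopes b h \<union> (\<lambda>s. (- s, - 1)) ` slopes b h"
    "norm (v - c *\<^sub>R w) \<le> 4 / real b"
proof -
  have b1: "1 \<le> real b" using b by simp
  note th = theta_bounds[OF h]
  have v1: "\<bar>fst v\<bar> \<le> 1" "\<bar>snd v\<bar> \<le> 1"
    using norm_fst_le[of "fst v" "snd v"] norm_snd_le[of "snd v" "fst v"] v by auto
  define \<sigma> :: real where "\<sigma> = (if 0 \<le> snd v then 1 else - 1)"
  have \<sigma>: "snd v = \<bar>snd v\<bar> * \<sigma>" "\<bar>\<sigma>\<bar> = 1" by (auto simp: \<sigma>_def)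
  have inW: "(- s, \<sigma>) \<in> (\<lambda>s. (- s, 1)) ` slopes b h \<union> (\<lambda>s. (- s, - 1)) ` slopes b h" if "s \<in> slopes b h" for s
    using that by (auto simp: \<sigma>_def)
  show thesis
  proof (cases "\<bar>fst v\<bar> \<le> \<bar>snd v\<bar> * real b")
    case True
    have s0: "snd v \<noteq> 0"
    proof
      assume "snd v = 0"
      then have "v = 0" using True by (simp add: prod_eq_iff)
      then show False using v by simp
    qed
    define t where "t = - fst v / \<bar>snd v\<bar>"
    have t: "\<bar>t\<bar> \<le> real b" "\<bar>snd v\<bar> * t = - fst v" using True s0 by (auto simp: t_def abs_divide divide_le_eq mult.commute)
    define a where "a = \<lfloor>t * real b\<rfloor>"
    define s where "s = (of_int a + theta h) / real b"
    have "\<bar>t * real b\<bar> \<le> real b * real b" unfolding abs_mult using t b1 by (intro mult_mono) auto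
    then have tb: "- (real b * real b) \<le> t * real b" "t * real b \<le> real b * real b" by linarith+
    have "- (int b * int b) \<le> a" unfolding a_def le_floor_iff using tb by simp
    moreover have "real_of_int a \<le> real b * real b" unfolding a_def using tb of_int_floor_le[of "t * real b"] by linarith
    then have "real_of_int a \<le> real_of_int (int b * int b)" by simp
    then have "a \<le> int b * int b" by (simp only: of_int_le_iff)
    ultimately have "a \<in> {- (int b)\<^sup>2..(int b)\<^sup>2}" by (simp add: power2_eq_square)
    then have s: "s \<in> slopes b h" by (auto simp: slopes_def s_def)
    have "\<bar>of_int a + theta h - t * real b\<bar> \<le> 3" unfolding a_def abs_le_iff using th by linarith
    then have "\<bar>(of_int a + theta h - t * real b) / real b\<bar> \<le> 3 / real b"
      unfolding abs_divide using b1 by (simp add: divide_right_mono)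
    moreover have "(of_int a + theta h - t * real b) / real b = s - t" using b1 by (simp add: s_def diff_divide_distrib)
    ultimately have st: "\<bar>s - t\<bar> \<le> 3 / real b" by simp
    have "v - \<bar>snd v\<bar> *\<^sub>R (- s, \<sigma>) = (fst v + \<bar>snd v\<bar> * s, 0)"
      using \<sigma>(1) by (simp add: prod_eq_iff)
    also have "fst v + \<bar>snd v\<bar> * s = \<bar>snd v\<bar> * (s - t)" using t(2) by (simp add: algebra_simps)
    finally have "norm (v - \<bar>snd v\<bar> *\<^sub>R (- s, \<sigma>)) = \<bar>snd v\<bar> * \<bar>s - t\<bar>" by (simp add: norm_Pair abs_mult)
    also have "\<dots> \<le> 1 * (3 / real b)" using v1 st by (intro mult_mono) auto
    also have "\<dots> \<le> 4 / real b" using b1 by (simp add: divide_right_mono)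
    finally show thesis using that[OF _ inW[OF s], of "\<bar>snd v\<bar>"] by simp
  next
    case False
    define a where "a = (if 0 \<le> fst v then - (int b)\<^sup>2 else (int b)\<^sup>2)"
    define s where "s = (of_int a + theta h) / real b"
    define c where "c = \<bar>fst v\<bar> / real b"
    have c: "0 \<le> c" "c \<le> 1 / real b" using v1 b1 by (auto simp: c_def divide_right_mono)
    have "a \<in> {- (int b)\<^sup>2..(int b)\<^sup>2}" by (simp add: a_def)
    then have s: "s \<in> slopes b h" unfolding slopes_def s_def by (rule imageI)
    have "c * of_int a = - (fst v * real b)" using b1 by (auto simp: c_def a_def power2_eq_square)
    then have "c * s = - fst v + c * theta h / real b" using b1 by (simp add: s_def field_simps)
    then have f: "fst v + c * s = c * (theta h / real b)" by simp
    have "theta h / real b \<le> 2 / 1" using th b1 by (intro frac_le) auto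
    then have "c * (theta h / real b) \<le> (1 / real b) * 2" using c th b1 by (intro mult_mono) auto
    moreover have "0 \<le> c * (theta h / real b)" using c th by simp
    ultimately have 1: "\<bar>fst v + c * s\<bar> \<le> 2 / real b" unfolding f by simp
    have "\<bar>snd v\<bar> \<le> 1 / real b" using False v1 b1 by (simp add: pos_le_divide_eq)
    moreover have "\<bar>snd v - c * \<sigma>\<bar> \<le> \<bar>snd v\<bar> + c" using \<sigma>(2) c abs_triangle_ineq4[of "snd v" "c * \<sigma>"] by (simp add: abs_mult)
    ultimately have 2: "\<bar>snd v - c * \<sigma>\<bar> \<le> 2 / real b" using c by (simp add: field_simps)
    have "v - c *\<^sub>R (- s, \<sigma>) = (fst v + c * s, snd v - c * \<sigma>)" by (simp add: prod_eq_iff)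
    then have "norm (v - c *\<^sub>R (- s, \<sigma>)) \<le> \<bar>fst v + c * s\<bar> + \<bar>snd v - c * \<sigma>\<bar>"
      using norm_Pair_le[of "fst v + c * s" "snd v - c * \<sigma>"] by simp
    also have "\<dots> \<le> 4 / real b" using 1 2 by simp
    finally show thesis using that[OF c(1) inW[OF s]] by simp
  qed
qed

text \<open>In each unit direction a point z of the polygon exceeds some point of C by at most e
  (|z| + R), with e = 4/b. The direction of z itself gives |z| \<le> 3 R; a direction separating z
  from (1 + \<eta>) C then leads to a contradiction. The condition on b does not involve h, so one
  net serves all h.\<close>

lemma hull_poly_near:
  assumes C: "compact C" "convex C" "cball 0 \<rho> \<subseteq> C" "C \<subseteq> cball 0 R" and \<rho>: "0 < \<rho>" and \<eta>: "0 < \<eta>"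
    and b: "8 \<le> b" "16 * R \<le> \<eta> * \<rho> * real b" and h: "h > 0"
  shows "C \<subseteq> hull_poly b h C" "hull_poly b h C \<subseteq> (*\<^sub>R) (1 + \<eta>) ` C"
proof -
  have ne: "C \<noteq> {}" using C(3) \<rho> by auto
  have b0: "b > 0" using b by simp
  show "C \<subseteq> hull_poly b h C"
    unfolding hull_poly_iff subset_iff using supp_attained[OF C(1) ne] by blast
  define e where "e = 4 / real b"
  have e: "0 < e" "e \<le> 1 / 2" "4 * R * e \<le> \<eta> * \<rho>"
    using b by (auto simp: e_def field_simps)
  have z0: "(0 :: real \<times> real) \<in> cball 0 \<rho>" using \<rho> by simp
  then have "(0 :: real \<times> real) \<in> cball 0 R" using C(3,4) by blast
  then have R0: "0 \<le> R" by simp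
  show "hull_poly b h C \<subseteq> (*\<^sub>R) (1 + \<eta>) ` C"
  proof
    fix z assume z: "z \<in> hull_poly b h C"
    have key: "\<exists>x\<in>C. v \<bullet> z \<le> v \<bullet> x + e * (norm z + R)" if v: "norm v = 1" for v
    proof -
      obtain c w where cw: "0 \<le> c" "w \<in> (\<lambda>s. (- s, 1)) ` slopes b h \<union> (\<lambda>s. (- s, - 1)) ` slopes b h"
        "norm (v - c *\<^sub>R w) \<le> e"
        using slope_net[OF b0 h v] unfolding e_def by blast
      obtain x where x: "x \<in> C" "supp C w = w \<bullet> x" using supp_attained[OF C(1) ne] by blast
      have "w \<bullet> z \<le> w \<bullet> x" using z cw(2) x unfolding hull_poly_iff by metis
      then have "c * (w \<bullet> z) \<le> c * (w \<bullet> x)" using cw(1) by (rule mult_left_mono)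
      moreover have "v \<bullet> z = (v - c *\<^sub>R w) \<bullet> z + c * (w \<bullet> z)" by (simp add: inner_diff_left)
      moreover have "c * (w \<bullet> x) = v \<bullet> x - (v - c *\<^sub>R w) \<bullet> x" by (simp add: inner_diff_left)
      moreover have "(v - c *\<^sub>R w) \<bullet> z \<le> e * norm z"
        using norm_cauchy_schwarz[of "v - c *\<^sub>R w" z] mult_right_mono[OF cw(3), of "norm z"] by simp
      moreover have "- ((v - c *\<^sub>R w) \<bullet> x) \<le> e * R"
      proof -
        have "\<bar>(v - c *\<^sub>R w) \<bullet> x\<bar> \<le> norm (v - c *\<^sub>R w) * norm x" by (rule Cauchy_Schwarz_ineq2)
        also have "\<dots> \<le> e * R" using cw(3) x(1) C(4) e(1) by (intro mult_mono) auto
        finally show ?thesis by simp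
      qed
      ultimately have "v \<bullet> z \<le> v \<bullet> x + e * (norm z + R)" by (simp add: distrib_left)
      then show ?thesis using x(1) by blast
    qed
    have nz: "norm z \<le> 3 * R"
    proof (cases "z = 0")
      case False
      define v where "v = (1 / norm z) *\<^sub>R z"
      have v: "norm v = 1" using False by (simp add: v_def)
      obtain x where x: "x \<in> C" "v \<bullet> z \<le> v \<bullet> x + e * (norm z + R)" using key[OF v] by blast
      have "v \<bullet> z = norm z" using False by (simp add: v_def power2_norm_eq_inner[symmetric] power2_eq_square)
      moreover have "v \<bullet> x \<le> R" using norm_cauchy_schwarz[of v x] v x(1) C(4) by auto
      moreover have "e * (norm z + R) \<le> (1 / 2) * (norm z + R)" using e R0 by (intro mult_right_mono) auto
      ultimately show ?thesis using x(2) by simp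
    qed (use R0 in simp)
    show "z \<in> (*\<^sub>R) (1 + \<eta>) ` C"
    proof (rule ccontr)
      assume nz': "z \<notin> (*\<^sub>R) (1 + \<eta>) ` C"
      have "convex ((*\<^sub>R) (1 + \<eta>) ` C)" "closed ((*\<^sub>R) (1 + \<eta>) ` C)"
        using C by (auto intro: convex_scaling compact_imp_closed compact_scaling)
      then obtain a d where a: "a \<bullet> z < d" "\<And>x. x \<in> (*\<^sub>R) (1 + \<eta>) ` C \<Longrightarrow> d < a \<bullet> x"
        using separating_hyperplane_closed_point[OF _ _ nz'] by blast
      have "(0 :: real \<times> real) \<in> C" using z0 C(3) by blast
      then have "d < a \<bullet> ((1 + \<eta>) *\<^sub>R 0)" by (intro a(2) imageI)
      then have a0: "a \<noteq> 0" using a(1) by auto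
      define v where "v = (- 1 / norm a) *\<^sub>R a"
      have v: "norm v = 1" using a0 by (simp add: v_def)
      have sep: "(1 + \<eta>) * (v \<bullet> x) < v \<bullet> z" if "x \<in> C" for x
      proof -
        have "a \<bullet> z < a \<bullet> ((1 + \<eta>) *\<^sub>R x)" using a(1) a(2)[of "(1 + \<eta>) *\<^sub>R x"] that by force
        then have "a \<bullet> z / norm a < (1 + \<eta>) * (a \<bullet> x) / norm a" using a0 by (simp add: divide_strict_right_mono)
        then show ?thesis by (simp add: v_def)
      qed
      obtain x where x: "x \<in> C" "v \<bullet> z \<le> v \<bullet> x + e * (norm z + R)" using key[OF v] by blast
      have "e * (norm z + R) \<le> e * (4 * R)" using e nz by (intro mult_left_mono) auto
      then have vz: "v \<bullet> z \<le> v \<bullet> x + \<eta> * \<rho>" using x(2) e(3) by (simp add: mult_ac)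
      \<comment> \<open>The inner ball turns the absolute error \<eta> \<rho> into a relative one:
        separation from the point \<rho> v forces the v-component of x above \<rho>, so 1 + \<eta>
        times that component exceeds the upper bound for z.\<close>
      have "\<rho> *\<^sub>R v \<in> C" using C(3) v \<rho> by auto
      from sep[OF this] have "(1 + \<eta>) * \<rho> < v \<bullet> z" using v by (simp add: norm_eq_1)
      then have "\<rho> < v \<bullet> x" using vz by (simp add: algebra_simps)
      then have "\<eta> * \<rho> < \<eta> * (v \<bullet> x)" using \<eta> by simp
      then show False using sep[OF x(1)] vz by (simp add: algebra_simps)
    qed
  qed
qed

text \<open>Dividing each constraint by its support value, positive because of the inner ball,
  brings the polygon to the form that \<open>penalty\<close> smooths. Points of the smoothed body
  violate each normalized constraint by at most \<eta>.\<close>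

lemma smooth_approximation:
  assumes C: "compact C" "convex C" "cball 0 \<rho> \<subseteq> C" and \<rho>: "0 < \<rho>" and b: "0 < b" and h: "0 < h"
    and Q: "hull_poly b h C \<subseteq> cball 0 (real K)" and K: "0 < K" and \<eta>: "0 < \<eta>"
  obtains B r R where "compact B" "convex B" "0 < r" "r \<le> R" "round_body r R B"
    "hull_poly b h C \<subseteq> B" "B \<subseteq> (*\<^sub>R) (1 + \<eta>) ` hull_poly b h C"
proof -
  let ?W = "(\<lambda>s. (- s, 1)) ` slopes b h \<union> (\<lambda>s. (- s, - 1)) ` slopes b h"
  have ne: "C \<noteq> {}" using C(3) \<rho> by auto
  have pos: "0 < supp C w" if "w \<in> ?W" for w
  proof -
    have w0: "w \<noteq> 0" using that by (auto simp: zero_prod_def)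
    have "(\<rho> / norm w) *\<^sub>R w \<in> C" using C(3) \<rho> w0 by auto
    then have "w \<bullet> ((\<rho> / norm w) *\<^sub>R w) \<le> supp C w" using supp_attained[OF C(1) ne] by blast
    moreover have "w \<bullet> ((\<rho> / norm w) *\<^sub>R w) = \<rho> * norm w"
      using w0 by (simp add: power2_norm_eq_inner[symmetric] power2_eq_square)
    moreover have "0 < \<rho> * norm w" using \<rho> w0 by simp
    ultimately show ?thesis by linarith
  qed
  define H where "H = (\<lambda>w. (1 / supp C w) *\<^sub>R w) ` ?W"
  have H: "finite H" using slopes_facts(1)[OF b h] by (simp add: H_def)
  have Qiff: "z \<in> hull_poly b h C \<longleftrightarrow> (\<forall>a\<in>H. a \<bullet> z \<le> 1)" for z
  proof -
    have "(\<forall>a\<in>H. a \<bullet> z \<le> 1) \<longleftrightarrow> (\<forall>w\<in>?W. ((1 / supp C w) *\<^sub>R w) \<bullet> z \<le> 1)"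
      unfolding H_def by (rule ball_simps(9))
    also have "\<dots> \<longleftrightarrow> (\<forall>w\<in>?W. w \<bullet> z \<le> supp C w)"
      using pos by (intro ball_cong refl) (simp add: divide_le_eq)
    finally show ?thesis unfolding hull_poly_iff by simp
  qed
  \<comment> \<open>With k = 1/K^2 the quadratic term is at most 1 on the polygon, where the hinges
    vanish; with weight 1/\<eta>^2 a total of 1 allows no hinge above \<eta>.\<close>
  define k where "k = 1 / (real K)\<^sup>2"
  define \<beta> where "\<beta> = 1 / \<eta>\<^sup>2"
  have kb: "0 < k" "0 < \<beta>" using K \<eta> by (auto simp: k_def \<beta>_def)
  obtain r R where r: "0 < r" "r \<le> R" "round_body r R (smooth_body H k \<beta>)"
    using smooth_body_round[OF H kb(1) less_imp_le[OF kb(2)]] by blast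
  show thesis
  proof (rule that[OF _ _ r])
    show "compact (smooth_body H k \<beta>)" "convex (smooth_body H k \<beta>)"
      using smooth_body_compact_convex kb by auto
    show "hull_poly b h C \<subseteq> smooth_body H k \<beta>"
    proof
      fix z assume z: "z \<in> hull_poly b h C"
      then have "(\<Sum>a\<in>H. (max 0 (a \<bullet> z - 1))\<^sup>2) = (\<Sum>a\<in>H. 0)"
        by (intro sum.cong refl) (simp add: Qiff max_absorb1)
      moreover have "norm z \<le> real K" using z Q by auto
      then have "z \<bullet> z \<le> (real K)\<^sup>2" using power_mono[of "norm z" "real K" 2] by (simp add: power2_norm_eq_inner)
      then have "k * (z \<bullet> z) \<le> 1" using K by (simp add: k_def divide_le_eq)
      ultimately show "z \<in> smooth_body H k \<beta>" by (simp add: smooth_body_def penalty_def)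
    qed
    show "smooth_body H k \<beta> \<subseteq> (*\<^sub>R) (1 + \<eta>) ` hull_poly b h C"
    proof
      fix z assume "z \<in> smooth_body H k \<beta>"
      then have le: "k * (z \<bullet> z) + \<beta> * (\<Sum>a\<in>H. (max 0 (a \<bullet> z - 1))\<^sup>2) \<le> 1" by (simp add: smooth_body_def penalty_def)
      have "a \<bullet> z \<le> 1 + \<eta>" if a: "a \<in> H" for a
      proof -
        have "(max 0 (a \<bullet> z - 1))\<^sup>2 \<le> (\<Sum>a\<in>H. (max 0 (a \<bullet> z - 1))\<^sup>2)"
          by (rule member_le_sum[OF a]) (use H in auto)
        then have "\<beta> * (max 0 (a \<bullet> z - 1))\<^sup>2 \<le> \<beta> * (\<Sum>a\<in>H. (max 0 (a \<bullet> z - 1))\<^sup>2)"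
          using kb by simp
        moreover have "0 \<le> k * (z \<bullet> z)" using kb by simp
        ultimately have "\<beta> * (max 0 (a \<bullet> z - 1))\<^sup>2 \<le> 1" using le by linarith
        then have "(max 0 (a \<bullet> z - 1))\<^sup>2 \<le> \<eta>\<^sup>2" using \<eta> by (simp add: \<beta>_def divide_le_eq)
        then have "max 0 (a \<bullet> z - 1) \<le> \<eta>" using \<eta> by (simp add: power2_le_iff_abs_le)
        then show ?thesis by simp
      qed
      then have "\<forall>a\<in>H. a \<bullet> ((1 / (1 + \<eta>)) *\<^sub>R z) \<le> 1" using \<eta> by (simp add: divide_le_eq)
      then have "(1 / (1 + \<eta>)) *\<^sub>R z \<in> hull_poly b h C" by (simp only: Qiff)
      then show "z \<in> (*\<^sub>R) (1 + \<eta>) ` hull_poly b h C" using \<eta> by (simp add: scale_iff)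
    qed
  qed
qed

section \<open>Prescribing the discrepancy\<close>

lemma measure_body_mono:
  assumes "compact (C :: (real \<times> real) set)" "compact C'" "C \<subseteq> C'"
  shows "measure lborel C \<le> measure lborel C'"
  using assms compact_emeasure_finite[OF assms(2)]
  by (intro measure_mono_fmeasurable fmeasurableI) (auto intro!: borel_closed compact_imp_closed)

text \<open>When A lies in B, the intersections with c A start from A at c = 1 and grow towards B
  through nested bodies. The body for c, dilated by d/c, covers the one for d; so the area, and by
  \<open>min_quad_diff\<close> the minimal discrepancy, is Lipschitz in c.\<close>

lemma min_quad_scaling_continuous:
  assumes B: "compact B" "B \<subseteq> cball 0 (real K)" and A: "compact A" "convex A" "0 \<in> A"
    and Bst: "convex B" "0 \<in> B" and t: "1 \<le> t"
  shows "continuous_on {1..t} (\<lambda>c. min_quad_discrepancy (B \<inter> (*\<^sub>R) c ` A) N)"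
proof -
  let ?C = "\<lambda>c. B \<inter> (*\<^sub>R) c ` A"
  let ?f = "\<lambda>c. min_quad_discrepancy (?C c) N"
  define M where "M = 4 * (real N)\<^sup>2 * count_bound K * (2 * t * count_bound K)"
  have M0: "0 \<le> M" using count_bound_ge_1[of K] t by (simp add: M_def)
  have cC: "compact (?C c)" for c
    using B(1) A(1) by (intro compact_Int compact_scaling)
  have sub: "?C c \<subseteq> cball 0 (real K)" for c using B(2) by auto
  have le: "\<bar>?f d - ?f c\<bar> \<le> M * (d - c)" if cd: "1 \<le> c" "c \<le> d" "d \<le> t" for c d
  proof -
    have mono: "?C c \<subseteq> ?C d" using star_shaped_scale[OF A(2,3), of c d] cd by auto
    define q where "q = d / c"
    have q: "1 \<le> q" using cd by (simp add: q_def)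
    have "?C d \<subseteq> (*\<^sub>R) q ` ?C c"
    proof
      fix z assume z: "z \<in> ?C d"
      have "(1 / q) *\<^sub>R z \<in> B"
        using star_shaped_scale[OF Bst, of 1 q] q z scale_iff[of q z B] by auto
      moreover have "(1 / d) *\<^sub>R z \<in> A" using z cd by (simp add: scale_iff)
      then have "(1 / q) *\<^sub>R z \<in> (*\<^sub>R) c ` A" using cd by (simp add: scale_iff q_def)
      ultimately show "z \<in> (*\<^sub>R) q ` ?C c" using q by (simp add: scale_iff)
    qed
    then have "measure lborel (?C d) \<le> measure lborel ((*\<^sub>R) q ` ?C c)"
      by (intro measure_body_mono cC compact_scaling)
    also have "\<dots> = q\<^sup>2 * measure lborel (?C c)" by (rule measure_dilate[OF cC])
    finally have "measure lborel (?C d) - measure lborel (?C c) \<le> (q\<^sup>2 - 1) * measure lborel (?C c)"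
      by (simp add: algebra_simps)
    also have "\<dots> \<le> (2 * t * (d - c)) * count_bound K"
    proof (rule mult_mono)
      have "q\<^sup>2 - 1 = (d - c) * (d + c) / (c * c)" using cd by (simp add: q_def field_simps power2_eq_square)
      also have "\<dots> \<le> (d - c) * (d + c) / 1"
        using cd mult_mono[of 1 c 1 c] by (intro divide_left_mono mult_nonneg_nonneg) auto
      also have "\<dots> \<le> (d - c) * (2 * t)" using cd by (simp add: mult_left_mono)
      finally show "q\<^sup>2 - 1 \<le> 2 * t * (d - c)" by (simp add: mult.commute)
    qed (use measure_le_count_bound[OF cC sub] cd t in auto)
    finally have "4 * (real N)\<^sup>2 * count_bound K * (measure lborel (?C d) - measure lborel (?C c))
        \<le> 4 * (real N)\<^sup>2 * count_bound K * ((2 * t * (d - c)) * count_bound K)"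
      using count_bound_ge_1[of K] by (intro mult_left_mono) auto
    also have "\<dots> = M * (d - c)" by (simp add: M_def)
    finally show ?thesis
      using min_quad_diff[OF cC sub cC sub mono, of N] by linarith
  qed
  show ?thesis
  proof (rule lipschitz_on_continuous_on[of M], rule lipschitz_onI[OF _ M0])
    fix c d assume cd: "c \<in> {1..t}" "d \<in> {1..t}"
    show "dist (?f c) (?f d) \<le> M * dist c d"
    proof (cases "c \<le> d")
      case True
      then show ?thesis using le[of c d] cd by (auto simp: dist_real_def abs_minus_commute)
    next
      case False
      then show ?thesis using le[of d c] cd by (auto simp: dist_real_def)
    qed
  qed
qed

lemma eventually_powr_large:
  assumes "0 < e"
  shows "\<forall>\<^sub>F n::nat in sequentially. M < real n powr e"
proof -
  have "((\<lambda>n. real n powr (- e)) \<longlongrightarrow> 0) sequentially"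
    using assms by (intro tendsto_neg_powr filterlim_real_sequentially) auto
  then have "\<forall>\<^sub>F n in sequentially. real n powr (- e) < 1 / (\<bar>M\<bar> + 1)"
    by (rule order_tendstoD) simp
  then show ?thesis
    using eventually_gt_at_top[of 0]
  proof eventually_elim
    case (elim n)
    then have p: "0 < real n powr e" by simp
    have "1 / real n powr e < 1 / (\<bar>M\<bar> + 1)" using elim by (simp add: powr_minus_divide)
    then have "\<bar>M\<bar> + 1 < real n powr e" using p by (simp add: divide_simps split: if_splits)
    then show ?case by linarith
  qed
qed

text \<open>With t = t1^3 slightly above 1 there is a chain C/t \<subseteq> \<open>A h\<close>
  \<subseteq> t1 C/t \<subseteq> Q \<subseteq> B \<subseteq> C: one factor t1 pays for the tuned
  polygon \<open>A h\<close>, one for the polygon Q, one for smoothing Q to B. Q and B do not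
  involve h, so their constants are fixed before h is chosen. The predicate \<open>good\<close>
  carries further demands on N.\<close>

lemma prescribed_discrepancy:
  assumes C: "compact C" "convex C" "cball 0 r \<subseteq> C" "C \<subseteq> cball 0 (real K)"
    and r: "4 \<le> r'" "r' < r" and \<eta>: "0 < \<eta>" and \<alpha>: "2 / 5 < \<alpha>" "\<alpha> < 1 / 2"
    and ev: "\<forall>\<^sub>F N in sequentially. good N"
  obtains C' N where "compact C'" "convex C'" "cball 0 r' \<subseteq> C'" "C' \<subseteq> C"
    "measure lborel C - measure lborel C' \<le> \<eta>" "N0 < N" "good N"
    "min_quad_discrepancy C' N = real N powr \<alpha>"
proof -
  have r0: "0 < r'" "0 < r" using r by auto
  have rK: "r \<le> real K"
  proof -
    have "(r, 0::real) \<in> cball 0 r" using r0 by (simp add: norm_Pair)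
    then have "(r, 0::real) \<in> cball 0 (real K)" using C(3,4) by blast
    then show ?thesis using r0 by (simp add: norm_Pair)
  qed
  have K: "0 < K" using rK r0 by simp
  define m where "m = measure lborel C"
  have m: "0 \<le> m" by (simp add: m_def)
  \<comment> \<open>The bound r / r' - 1 leaves room for the ball of radius r' after shrinking by t;
    the bound \<eta> / (3 (m + 1)) controls the loss of area, since t^2 - 1 \<le> 3 \<tau>.\<close>
  define \<tau> where "\<tau> = min 1 (min (r / r' - 1) (\<eta> / (3 * (m + 1))))"
  have \<tau>: "0 < \<tau>" "\<tau> \<le> 1" "\<tau> \<le> r / r' - 1" "\<tau> \<le> \<eta> / (3 * (m + 1))"
    using r r0 \<eta> m by (auto simp: \<tau>_def)
  define t where "t = 1 + \<tau>"
  have t: "1 < t" "t \<le> r / r'" using \<tau> by (auto simp: t_def)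
  define t1 where "t1 = root 3 t"
  have t1: "1 < t1" "t1 ^ 3 = t" using t by (auto simp: t1_def)
  have t1t: "t1 * t1 * t1 = t" using t1 by (simp add: power3_eq_cube)
  define \<eta>1 where "\<eta>1 = t1 - 1"
  have \<eta>1: "0 < \<eta>1" "1 + \<eta>1 = t1" using t1 by (auto simp: \<eta>1_def)
  define C1 where "C1 = (*\<^sub>R) (1 / t) ` C"
  define Cq where "Cq = (*\<^sub>R) t1 ` C1"
  have tC1: "(*\<^sub>R) t ` C1 = C" using t by (simp add: C1_def image_image)
  have C1: "compact C1" "convex C1" "cball 0 r' \<subseteq> C1" "0 \<in> C1"
  proof -
    show "compact C1" "convex C1" using C by (auto simp: C1_def intro: compact_scaling convex_scaling)
    show "cball 0 r' \<subseteq> C1"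
    proof
      fix z :: "real \<times> real" assume "z \<in> cball 0 r'"
      then have "t * norm z \<le> (r / r') * r'" using t r0 by (intro mult_mono) auto
      then have "t *\<^sub>R z \<in> C" using C(3) t r0 by auto
      then show "z \<in> C1" using t by (simp add: C1_def scale_iff)
    qed
    then show "0 \<in> C1" using r0 by auto
  qed
  have Cq: "compact Cq" "convex Cq" "0 \<in> Cq"
    using C1 by (auto simp: Cq_def intro: compact_scaling convex_scaling image_eqI[of _ _ 0])
  have C1q: "C1 \<subseteq> Cq" using star_shaped_scale[OF C1(2,4), of 1 t1] t1 by (simp add: Cq_def)
  have "(*\<^sub>R) (t1 * t1) ` Cq = (*\<^sub>R) t ` C1" by (simp add: Cq_def image_image t1t[symmetric] mult_ac)
  then have ttq: "(*\<^sub>R) t1 ` (*\<^sub>R) t1 ` Cq = C" using tC1 by (simp add: image_image)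
  have CqC: "Cq \<subseteq> C"
    using star_shaped_scale[OF Cq(2,3), of 1 "t1 * t1"] t1 mult_mono[of 1 t1 1 t1] ttq
    by (simp add: image_image)
  have CqK: "Cq \<subseteq> cball 0 (real K)" "C1 \<subseteq> cball 0 (real K)" using CqC C1q C(4) by auto
  obtain b :: nat where b: "8 \<le> b" "16 * real K \<le> \<eta>1 * r' * real b"
  proof -
    obtain b0 :: nat where "16 * real K / (\<eta>1 * r') \<le> real b0" using real_arch_simple by blast
    then have "16 * real K \<le> \<eta>1 * r' * real b0" using \<eta>1 r0 by (simp add: pos_divide_le_eq mult.commute)
    also have "\<dots> \<le> \<eta>1 * r' * real (max 8 b0)" using \<eta>1 r0 by (intro mult_left_mono) auto
    finally show thesis using that[of "max 8 b0"] by simp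
  qed
  have b0: "0 < b" using b by simp
  \<comment> \<open>Q only carries the smoothing, so its slope parameter is frozen at 1; the tuned
    slopes belong to \<open>A h\<close>.\<close>
  define Q where "Q = hull_poly b 1 Cq"
  have rq: "cball 0 r' \<subseteq> Cq" using C1 C1q by blast
  have Q: "Cq \<subseteq> Q" "Q \<subseteq> (*\<^sub>R) t1 ` Cq"
    using hull_poly_near[OF Cq(1,2) rq CqK(1) r0(1) \<eta>1(1) b, of 1] by (simp_all add: Q_def \<eta>1(2))
  have "(*\<^sub>R) t1 ` Cq \<subseteq> (*\<^sub>R) (t1 * t1) ` Cq"
    using star_shaped_scale[OF Cq(2,3), of t1 "t1 * t1"] t1 mult_mono[of 1 t1 t1 t1] by simp
  then have QC: "Q \<subseteq> C" using Q(2) ttq by (simp add: image_image)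
  have QK: "hull_poly b 1 Cq \<subseteq> cball 0 (real K)" using QC C(4) unfolding Q_def by blast
  obtain B s R where B': "compact B" "convex B" "0 < s" "s \<le> R" "round_body s R B"
    "hull_poly b 1 Cq \<subseteq> B" "B \<subseteq> (*\<^sub>R) (1 + \<eta>1) ` hull_poly b 1 Cq"
    using smooth_approximation[OF Cq(1,2) rq r0(1) b0 zero_less_one QK K \<eta>1(1)] .
  note B = B'[folded Q_def, unfolded \<eta>1(2)]
  have BC: "B \<subseteq> C" using B(7) image_mono[OF Q(2), of "(*\<^sub>R) t1"] ttq by blast
  have C1B: "C1 \<subseteq> B" using C1q Q(1) B(6) by blast
  have zB: "0 \<in> B" using C1(4) C1B by blast
  have BK: "B \<subseteq> cball 0 (real K)" using BC C(4) by blast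
  have B4: "cball 0 4 \<subseteq> B" using C1(3) C1B r(1) subset_cball[OF r(1), of 0] by blast
  obtain cB where cB: "0 < cB" "\<And>N. 1 \<le> N \<Longrightarrow> cB * sqrt (real N) \<le> min_quad_discrepancy B N"
    using round_body_min_quad[OF B(1,2) BK B4 B(3-5)] by blast
  \<comment> \<open>The constants of \<open>min_quad_poly_body\<close> for at most 2 b^2 + 1 slopes
    of size at most b + 2; h does not occur.\<close>
  define cA where "cA = 2 * (2 * (real b)\<^sup>2 + 1) * (2 * real K + 1 + 3 * real b) + 8 * (real b + 2)"
  define A where "A h = hull_poly b h C1" for h
  have A: "C1 \<subseteq> A h" "A h \<subseteq> Cq" "compact (A h)" "convex (A h)"
    "min_quad_discrepancy (A h) (h ^ 6) \<le> (cA * real h)\<^sup>2" if h: "0 < h" for h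
  proof -
    show "C1 \<subseteq> A h" and sub: "A h \<subseteq> Cq"
      using hull_poly_near[OF C1(1-3) CqK(2) r0(1) \<eta>1(1) b h] by (simp_all add: A_def Cq_def \<eta>1(2))
    then have AK: "A h \<subseteq> cball 0 (real K)" using CqK by blast
    have "closed (A h)" unfolding A_def hull_poly_def by (rule closed_poly_body)
    then show "compact (A h)" using AK bounded_subset[OF bounded_cball] compact_eq_bounded_closed by blast
    show "convex (A h)"
    proof (rule convexI)
      fix x y u v assume xy: "x \<in> A h" "y \<in> A h" and uv: "0 \<le> u" "0 \<le> v" "u + v = (1::real)"
      show "u *\<^sub>R x + v *\<^sub>R y \<in> A h"
        unfolding A_def hull_poly_iff
      proof
        fix w :: "real \<times> real" assume w: "w \<in> (\<lambda>s. (- s, 1)) ` slopes b h \<union> (\<lambda>s. (- s, - 1)) ` slopes b h"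
        have "w \<bullet> x \<le> supp C1 w" "w \<bullet> y \<le> supp C1 w" using xy w unfolding A_def hull_poly_iff by blast+
        then have "u * (w \<bullet> x) + v * (w \<bullet> y) \<le> u * supp C1 w + v * supp C1 w"
          using uv by (intro add_mono mult_left_mono)
        then show "w \<bullet> (u *\<^sub>R x + v *\<^sub>R y) \<le> supp C1 w"
          using uv by (simp add: inner_add_right distrib_right[symmetric])
      qed
    qed
    show "min_quad_discrepancy (A h) (h ^ 6) \<le> (cA * real h)\<^sup>2"
      unfolding A_def hull_poly_def cA_def
      by (rule min_quad_poly_body)
        (use slopes_facts[OF b0 h] AK b0 h in \<open>auto simp: A_def hull_poly_def\<close>)
  qed
  \<comment> \<open>With N = h^6 the polygon gives at most cA^2 h^2, the target is h^(6 \<alpha>),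
    and the round body gives at least cB h^3. Both gaps are positive powers of h and absorb the
    constants.\<close>
  have 2: "0 < 6 * \<alpha> - 2" "0 < 3 - 6 * \<alpha>" using \<alpha> by auto
  have pow6: "filterlim (\<lambda>h::nat. h ^ 6) sequentially sequentially"
    by (rule filterlim_at_top_mono[OF filterlim_ident])
      (auto intro!: eventually_at_top_linorderI[of 1] self_le_power)
  have "\<forall>\<^sub>F h::nat in sequentially. 0 < h \<and> cA\<^sup>2 < real h powr (6 * \<alpha> - 2)
      \<and> 1 / cB < real h powr (3 - 6 * \<alpha>) \<and> good (h ^ 6) \<and> N0 < h ^ 6"
    by (intro eventually_conj eventually_gt_at_top eventually_powr_large 2
        eventually_compose_filterlim[OF ev pow6]
        eventually_compose_filterlim[OF eventually_gt_at_top[of N0] pow6])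
  from eventually_happens'[OF sequentially_bot this]
  obtain h :: nat where h: "0 < h" "cA\<^sup>2 < real h powr (6 * \<alpha> - 2)"
      "1 / cB < real h powr (3 - 6 * \<alpha>)" "good (h ^ 6)" "N0 < h ^ 6"
    by (elim exE conjE)
  define N where "N = h ^ 6"
  have hr: "0 < real h" using h by simp
  have Np: "real N powr \<alpha> = real h powr (6 * \<alpha>)"
  proof -
    have "real N = real h powr 6" using hr by (simp add: N_def)
    then show ?thesis by (simp only: powr_powr)
  qed
  have sq: "sqrt (real N) = real h ^ 3"
  proof -
    have "(real h ^ 3)\<^sup>2 = real N" by (simp add: N_def flip: power_mult)
    then show ?thesis by (rule real_sqrt_unique) (use hr in simp)
  qed
  have low: "min_quad_discrepancy (A h) N \<le> real N powr \<alpha>"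
  proof -
    have "min_quad_discrepancy (A h) N \<le> cA\<^sup>2 * real h ^ 2"
      using A(5)[OF h(1)] by (simp add: N_def power_mult_distrib)
    also have "\<dots> \<le> real h powr (6 * \<alpha> - 2) * real h ^ 2" using h by (intro mult_right_mono) auto
    also have "\<dots> = real h powr (6 * \<alpha> - 2) * real h powr 2" using hr by simp
    also have "\<dots> = real h powr (6 * \<alpha>)" unfolding powr_add[symmetric] by simp
    finally show ?thesis by (simp add: Np)
  qed
  have high: "real N powr \<alpha> \<le> min_quad_discrepancy B N"
  proof -
    have "real h powr (3 - 6 * \<alpha>) * real h powr (6 * \<alpha>) = real h powr 3"
      unfolding powr_add[symmetric] by simp
    then have p: "real h powr (3 - 6 * \<alpha>) * real h powr (6 * \<alpha>) = real h ^ 3" using hr by simp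
    have "1 \<le> cB * real h powr (3 - 6 * \<alpha>)" using h(3) cB(1) by (simp add: pos_divide_less_eq mult.commute)
    then have "1 * real h powr (6 * \<alpha>) \<le> (cB * real h powr (3 - 6 * \<alpha>)) * real h powr (6 * \<alpha>)"
      by (intro mult_right_mono) auto
    also have "\<dots> = cB * sqrt (real N)" by (simp only: mult.assoc p sq)
    also have "\<dots> \<le> min_quad_discrepancy B N" using h by (intro cB(2)) (simp add: N_def)
    finally show ?thesis by (simp add: Np)
  qed
  let ?C = "\<lambda>c. B \<inter> (*\<^sub>R) c ` A h"
  have AB: "A h \<subseteq> B" using A(2)[OF h(1)] Q(1) B(6) by blast
  have zA: "0 \<in> A h" using A(1)[OF h(1)] C1(4) by blast
  have "C \<subseteq> (*\<^sub>R) t ` A h" using image_mono[OF A(1)[OF h(1)], of "(*\<^sub>R) t"] tC1 by simp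
  \<comment> \<open>At c = t the dilate of \<open>A h\<close> contains C, hence B, and the
    intersection is all of B.\<close>
  then have Ct: "?C t = B" using BC by blast
  have "?C 1 = A h" using AB by auto
  then have "\<exists>c\<ge>1. c \<le> t \<and> min_quad_discrepancy (?C c) N = real N powr \<alpha>"
    using low high t Ct
    by (intro IVT' min_quad_scaling_continuous[OF B(1) BK A(3,4)[OF h(1)] zA B(2) zB]) auto
  then obtain c where c: "1 \<le> c" "c \<le> t" "min_quad_discrepancy (?C c) N = real N powr \<alpha>" by blast
  have C1c: "C1 \<subseteq> ?C c"
    using C1B A(1)[OF h(1)] star_shaped_scale[OF A(4)[OF h(1)] zA, of 1 c] c by auto
  have comp: "compact (?C c)" using B(1) A(3)[OF h(1)] by (intro compact_Int compact_scaling)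
  show thesis
  proof (rule that[OF comp _ _ _ _ _ _ c(3)])
    show "convex (?C c)" using B(2) A(4)[OF h(1)] by (intro convex_Int convex_scaling)
    show "cball 0 r' \<subseteq> ?C c" using C1(3) C1c by blast
    show "?C c \<subseteq> C" using BC by blast
    show "N0 < N" "good N" using h by (auto simp: N_def)
    have "measure lborel C1 \<le> measure lborel (?C c)" by (rule measure_body_mono[OF C1(1) comp C1c])
    moreover have "m = t\<^sup>2 * measure lborel C1"
      unfolding m_def tC1[symmetric] by (rule measure_dilate[OF C1(1)])
    moreover have "(t\<^sup>2 - 1) * measure lborel C1 \<le> \<eta>"
    proof -
      have "t\<^sup>2 - 1 \<le> 3 * \<tau>" using \<tau> mult_left_le[of \<tau> \<tau>] by (simp add: t_def power2_eq_square algebra_simps)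
      moreover have "measure lborel C1 \<le> m"
        unfolding m_def using measure_body_mono[OF C1(1) C(1)] C1q CqC by blast
      ultimately have "(t\<^sup>2 - 1) * measure lborel C1 \<le> 3 * \<tau> * (m + 1)"
        using \<tau> m by (intro mult_mono) auto
      also have "\<dots> \<le> \<eta>" using \<tau>(4) m by (simp add: pos_le_divide_eq mult_ac)
      finally show ?thesis .
    qed
    ultimately show "measure lborel C - measure lborel (?C c) \<le> \<eta>"
      by (simp add: m_def[symmetric] algebra_simps)
  qed
qed


text \<open>What a small exponent e has to absorb: the factor 2 and the additive M from changing the
  number of points, an error 1 from later losses of area, doubled in the upper bound, and the base 2
  N in place of N when at most N points are added.\<close>

lemma eventually_exponent_margins:
  fixes M :: real
  assumes \<alpha>: "0 < \<alpha>" and e: "0 < e" "e \<le> \<alpha>" "\<alpha> \<le> 1"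
  shows "\<forall>\<^sub>F N in sequentially. q \<le> N \<and> 2 * real N powr \<alpha> + 2 + M \<le> real N powr (\<alpha> + e)
    \<and> 2 * (2 * real N) powr (\<alpha> - e) + 1 + M \<le> real N powr \<alpha>"
proof -
  have "\<forall>\<^sub>F N in sequentially. q \<le> N \<and> 0 < N \<and> 8 < real N powr e \<and> 2 * \<bar>M\<bar> + 2 < real N powr \<alpha>"
    by (intro eventually_conj eventually_ge_at_top eventually_gt_at_top eventually_powr_large \<alpha> e)
  then show ?thesis
  proof (rule eventually_mono)
    fix N assume N: "q \<le> N \<and> 0 < N \<and> 8 < real N powr e \<and> 2 * \<bar>M\<bar> + 2 < real N powr \<alpha>"
    define x where "x = real N powr \<alpha>"
    have x: "2 * \<bar>M\<bar> + 2 < x" using N by (simp add: x_def)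
    have "real N powr (\<alpha> + e) = x * real N powr e" by (simp add: x_def powr_add)
    moreover have "x * 8 \<le> x * real N powr e" using N by (intro mult_left_mono) (auto simp: x_def)
    ultimately have 1: "8 * x \<le> real N powr (\<alpha> + e)" by simp
    have y0: "0 \<le> real N powr (\<alpha> - e)" by simp
    have "x = real N powr (\<alpha> - e) * real N powr e" unfolding x_def powr_add[symmetric] by simp
    moreover have "real N powr (\<alpha> - e) * 8 \<le> real N powr (\<alpha> - e) * real N powr e"
      using N y0 by (intro mult_left_mono) auto
    ultimately have 2: "8 * real N powr (\<alpha> - e) \<le> x" by simp
    have "(2 * real N) powr (\<alpha> - e) = 2 powr (\<alpha> - e) * real N powr (\<alpha> - e)" by (simp add: powr_mult)
    also have "\<dots> \<le> 2 * real N powr (\<alpha> - e)"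
    proof (rule mult_right_mono)
      have "(2::real) powr (\<alpha> - e) \<le> 2 powr 1" using e by (intro powr_mono) auto
      then show "(2::real) powr (\<alpha> - e) \<le> 2" by simp
    qed simp
    finally have 3: "(2 * real N) powr (\<alpha> - e) \<le> 2 * real N powr (\<alpha> - e)" .
    show "q \<le> N \<and> 2 * real N powr \<alpha> + 2 + M \<le> real N powr (\<alpha> + e)
      \<and> 2 * (2 * real N) powr (\<alpha> - e) + 1 + M \<le> real N powr \<alpha>"
      unfolding x_def[symmetric]
    proof (intro conjI)
      have "M \<le> \<bar>M\<bar>" "0 \<le> \<bar>M\<bar>" by simp_all
      then show "2 * x + 2 + M \<le> real N powr (\<alpha> + e)"
        "2 * (2 * real N) powr (\<alpha> - e) + 1 + M \<le> x"
        using x 1 2 3 by linarith+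
    qed (use N in blast)
  qed
qed

section \<open>The decreasing sequence of bodies and its limit\<close>

theorem theorem1p5:
  shows "\<exists>\<epsilon>>0. \<forall>(\<alpha> :: nat \<Rightarrow> real) (\<epsilon>s :: nat \<Rightarrow> real) (q :: nat \<Rightarrow> nat).
           (\<forall>i. 2/5 < \<alpha> i \<and> \<alpha> i < 1/2) \<longrightarrow>
           (\<forall>i. 0 < \<epsilon>s i \<and> \<epsilon>s i \<le> \<epsilon>) \<longrightarrow>
           (\<forall>i. 0 < q i) \<longrightarrow>
           (\<exists>C (Ns :: nat \<Rightarrow> nat). planar_convex_body C \<and> strict_mono Ns \<and>
              (\<forall>i. \<forall>N. Ns i \<le> N \<and> N \<le> Ns i + q i \<longrightarrow>
                 real N powr (\<alpha> i - \<epsilon>s i) \<le> min_quad_discrepancy C N \<and>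
                 min_quad_discrepancy C N \<le> real N powr (\<alpha> i + \<epsilon>s i)))"
proof (intro exI[of _ "1/5::real"] conjI allI impI)
  fix \<alpha> \<epsilon>s :: "nat \<Rightarrow> real" and q :: "nat \<Rightarrow> nat"
  assume \<alpha>: "\<forall>i. 2/5 < \<alpha> i \<and> \<alpha> i < 1/2" and \<epsilon>: "\<forall>i. 0 < \<epsilon>s i \<and> \<epsilon>s i \<le> 1/5"
  \<comment> \<open>Radius of the starting ball. It contains all later bodies, so one value of
    \<open>count_bound\<close> serves throughout, and it contains the first inner ball, of radius
    5.\<close>
  define K :: nat where "K = 8"
  define M where "M = 4 * count_bound K"
  have M: "0 < M" using count_bound_ge_1[of K] by (simp add: M_def)
  define S where "S i = 2 * (real (q i) * count_bound K)\<^sup>2" for i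
  define good where "good i N \<longleftrightarrow> q i \<le> N \<and> 2 * real N powr \<alpha> i + 2 + S i \<le> real N powr (\<alpha> i + \<epsilon>s i)
    \<and> 2 * (2 * real N) powr (\<alpha> i - \<epsilon>s i) + 1 + S i \<le> real N powr \<alpha> i" for i N
  have good: "\<forall>\<^sub>F N in sequentially. good i N" for i
    unfolding good_def using \<alpha>[rule_format, of i] \<epsilon>[rule_format, of i]
    by (intro eventually_exponent_margins) auto
  \<comment> \<open>Each step consumes some room around the inner ball, so its radius decreases
    strictly, but never below 4.\<close>
  define P where "P n x \<longleftrightarrow> compact (fst x) \<and> convex (fst x)
    \<and> cball 0 (4 + 1 / (real n + 1)) \<subseteq> fst x \<and> fst x \<subseteq> cball 0 (real K)" for n and x :: "(real \<times> real) set \<times> nat"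
  \<comment> \<open>A loss of area that moves the minimal discrepancy at N by less than 1. The
    powers of 2 in \<open>Q\<close> let infinitely many later losses share it.\<close>
  define a where "a N = 1 / (M * ((real N)\<^sup>2 + 1))" for N :: nat
  define Q where "Q n x y \<longleftrightarrow> fst y \<subseteq> fst x \<and> snd x < snd y
    \<and> measure lborel (fst x) - measure lborel (fst y) \<le> a (snd x) / 2 ^ (n + 1)
    \<and> good n (snd y) \<and> min_quad_discrepancy (fst y) (snd y) = real (snd y) powr \<alpha> n"
    for n and x y :: "(real \<times> real) set \<times> nat"
  have a0: "0 < a N" for N using M by (simp add: a_def add_nonneg_pos)
  have "\<exists>f. \<forall>n. P n (f n) \<and> Q n (f n) (f (Suc n))"
  proof (rule dependent_nat_choice)
    show "\<exists>x. P 0 x" by (rule exI[of _ "(cball 0 (real K), 0)"]) (auto simp: P_def K_def)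
    fix x n assume "P n x"
    then have x: "compact (fst x)" "convex (fst x)" "cball 0 (4 + 1 / (real n + 1)) \<subseteq> fst x" "fst x \<subseteq> cball 0 (real K)"
      by (auto simp: P_def)
    have r: "4 \<le> 4 + 1 / (real (Suc n) + 1)" "4 + 1 / (real (Suc n) + 1) < 4 + 1 / (real n + 1)"
      by (auto intro!: divide_strict_left_mono)
    have e: "0 < a (snd x) / 2 ^ (n + 1)" using a0 by simp
    obtain C' N where "compact C'" "convex C'" "cball 0 (4 + 1 / (real (Suc n) + 1)) \<subseteq> C'" "C' \<subseteq> fst x"
      "measure lborel (fst x) - measure lborel C' \<le> a (snd x) / 2 ^ (n + 1)" "snd x < N" "good n N"
      "min_quad_discrepancy C' N = real N powr \<alpha> n"
      by (rule prescribed_discrepancy[OF x r e _ _ good[of n], of "\<alpha> n" "snd x"])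
        (use \<alpha>[rule_format, of n] in auto)
    then show "\<exists>y. P (Suc n) y \<and> Q n x y"
      using x(4) by (intro exI[of _ "(C', N)"]) (auto simp: P_def Q_def)
  qed
  then obtain f where f: "\<And>n. P n (f n)" "\<And>n. Q n (f n) (f (Suc n))" by blast
  define B where "B n = fst (f n)" for n
  \<comment> \<open>Shifted by one: the starting body carries a dummy number, and step i produces
    \<open>B (Suc i)\<close> together with \<open>Ns i\<close>.\<close>
  define Ns where "Ns n = snd (f (Suc n))" for n
  have B: "compact (B n)" "convex (B n)" "cball 0 4 \<subseteq> B n" "B n \<subseteq> cball 0 (real K)" for n
  proof -
    have "cball 0 4 \<subseteq> cball (0 :: real \<times> real) (4 + 1 / (real n + 1))" by (rule subset_cball) simp
    then show "compact (B n)" "convex (B n)" "cball 0 4 \<subseteq> B n" "B n \<subseteq> cball 0 (real K)"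
      using f(1)[of n] by (auto simp: P_def B_def)
  qed
  have dec: "B (Suc n) \<subseteq> B n" for n using f(2)[of n] by (simp add: Q_def B_def)
  have decseq: "decseq B" using dec by (simp add: decseq_Suc_iff)
  have Nmono: "snd (f n) < snd (f (Suc n))" for n using f(2)[of n] by (simp add: Q_def)
  have sm: "strict_mono (\<lambda>n. snd (f n))" using Nmono by (simp add: strict_mono_Suc_iff)
  define C where "C = (\<Inter>n. B n)"
  have C: "compact C" "convex C" "cball 0 4 \<subseteq> C" "C \<subseteq> cball 0 (real K)"
  proof -
    have "closed C" unfolding C_def using B(1) by (intro closed_INT ballI compact_imp_closed) auto
    moreover show "C \<subseteq> cball 0 (real K)" using B(4)[of 0] by (auto simp: C_def)
    ultimately show "compact C" using bounded_subset[OF bounded_cball] compact_eq_bounded_closed by blast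
    show "convex C" unfolding C_def using B(2) by (intro convex_INT) auto
    show "cball 0 4 \<subseteq> C" unfolding C_def using B(3) by (intro INT_greatest)
  qed
  have CB: "C \<subseteq> B n" for n by (auto simp: C_def)
  have lim: "(\<lambda>n. measure lborel (B n)) \<longlonglongrightarrow> measure lborel C"
    unfolding C_def
  proof (rule Lim_measure_decseq[OF _ decseq])
    show "range B \<subseteq> sets lborel" using B(1) by (auto intro!: borel_closed compact_imp_closed)
    show "emeasure lborel (B i) \<noteq> \<infinity>" for i using compact_emeasure_finite[OF B(1)[of i]] by simp
  qed
  have area: "measure lborel (B (Suc i)) - measure lborel C \<le> a (Ns i)" for i
  proof -
    \<comment> \<open>Losses after step i are measured by later, larger numbers, where
      \<open>a\<close> is smaller, so each is at most \<open>a (Ns i)\<close> times a power of 1/2,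
      and the geometric sum stays below \<open>a (Ns i)\<close>.\<close>
    have step: "measure lborel (B (Suc i)) - measure lborel (B (Suc i + m)) \<le> a (Ns i) * (1 - 1 / 2 ^ m)" for m
    proof (induction m)
      case (Suc m)
      let ?n = "Suc i + m"
      have "Ns i \<le> snd (f ?n)" unfolding Ns_def using strict_mono_mono[OF sm] by (simp add: mono_def)
      then have "(real (Ns i))\<^sup>2 \<le> (real (snd (f ?n)))\<^sup>2" by (intro power_mono) auto
      then have "a (snd (f ?n)) \<le> a (Ns i)"
        unfolding a_def using M by (intro divide_left_mono mult_left_mono mult_pos_pos) (auto intro: add_nonneg_pos)
      moreover have "measure lborel (B ?n) - measure lborel (B (Suc ?n)) \<le> a (snd (f ?n)) / 2 ^ (?n + 1)"
        using f(2)[of ?n] by (simp add: Q_def B_def)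
      moreover have "a (snd (f ?n)) / 2 ^ (?n + 1) \<le> a (snd (f ?n)) / 2 ^ (m + 1)"
        using a0[of "snd (f ?n)"] by (intro divide_left_mono power_increasing) auto
      moreover have "a (snd (f ?n)) / 2 ^ (m + 1) \<le> a (Ns i) / 2 ^ (m + 1)"
        using calculation(1) by (intro divide_right_mono) auto
      ultimately have "measure lborel (B ?n) - measure lborel (B (Suc ?n)) \<le> a (Ns i) / 2 ^ (m + 1)" by linarith
      then show ?case using Suc by (simp add: field_simps)
    qed simp
    have "measure lborel (B (Suc i)) - a (Ns i) \<le> measure lborel C"
    proof (rule LIMSEQ_le_const[OF lim], intro exI[of _ "Suc i"] allI impI)
      fix n assume "Suc i \<le> n"
      then obtain m where n: "n = Suc i + m" using le_Suc_ex by blast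
      have "a (Ns i) * (1 - 1 / 2 ^ m) \<le> a (Ns i) * 1" using a0[of "Ns i"] by (intro mult_left_mono) auto
      then show "measure lborel (B (Suc i)) - a (Ns i) \<le> measure lborel (B n)" using step[of m] unfolding n by linarith
    qed
    then show ?thesis by simp
  qed
  have near: "\<bar>min_quad_discrepancy C (Ns i) - real (Ns i) powr \<alpha> i\<bar> \<le> 1" for i
  proof -
    have "\<bar>min_quad_discrepancy (B (Suc i)) (Ns i) - min_quad_discrepancy C (Ns i)\<bar>
        \<le> 4 * (real (Ns i))\<^sup>2 * count_bound K * (measure lborel (B (Suc i)) - measure lborel C)"
      by (rule min_quad_diff[OF C(1,4) B(1,4) CB])
    also have "\<dots> \<le> 4 * (real (Ns i))\<^sup>2 * count_bound K * a (Ns i)"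
      using count_bound_ge_1[of K] by (intro mult_left_mono area) auto
    also have "\<dots> = M * (real (Ns i))\<^sup>2 / (M * ((real (Ns i))\<^sup>2 + 1))" by (simp add: a_def M_def)
    also have "\<dots> \<le> 1" using M by (simp add: divide_le_eq_1 add_nonneg_pos)
    finally show ?thesis using f(2)[of i] by (simp add: Q_def B_def Ns_def abs_minus_commute)
  qed
  show "\<exists>C (Ns :: nat \<Rightarrow> nat). planar_convex_body C \<and> strict_mono Ns \<and>
              (\<forall>i. \<forall>N. Ns i \<le> N \<and> N \<le> Ns i + q i \<longrightarrow>
                 real N powr (\<alpha> i - \<epsilon>s i) \<le> min_quad_discrepancy C N \<and>
                 min_quad_discrepancy C N \<le> real N powr (\<alpha> i + \<epsilon>s i))"
  proof (intro exI[of _ C] exI[of _ Ns] conjI allI impI)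
    have "ball 0 4 \<subseteq> interior C" using C(3) by (intro interior_maximal) (auto simp: subset_iff)
    moreover have "(0 :: real \<times> real) \<in> ball 0 4" by simp
    ultimately have "interior C \<noteq> {}" by blast
    then show "planar_convex_body C" using C by (simp add: planar_convex_body_def)
    show "strict_mono Ns" using Nmono by (simp add: strict_mono_Suc_iff Ns_def)
    fix i N assume N: "Ns i \<le> N \<and> N \<le> Ns i + q i"
    have g: "q i \<le> Ns i" "2 * real (Ns i) powr \<alpha> i + 2 + S i \<le> real (Ns i) powr (\<alpha> i + \<epsilon>s i)"
      "2 * (2 * real (Ns i)) powr (\<alpha> i - \<epsilon>s i) + 1 + S i \<le> real (Ns i) powr \<alpha> i"
      using f(2)[of i] by (auto simp: Q_def good_def Ns_def)
    \<comment> \<open>The bound 1/5 on \<epsilon>s keeps both exponents positive, so the powers are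
      monotone in the base.\<close>
    have ae: "0 \<le> \<alpha> i - \<epsilon>s i" "0 \<le> \<alpha> i + \<epsilon>s i"
      using \<alpha>[rule_format, of i] \<epsilon>[rule_format, of i] by auto
    have t: "min_quad_discrepancy C (Ns i) \<le> 2 * min_quad_discrepancy C N + S i"
      "min_quad_discrepancy C N \<le> 2 * min_quad_discrepancy C (Ns i) + S i"
      using min_quad_add_points[OF C(1,4), of "Ns i" N "q i"] N by (auto simp: S_def)
    have n: "min_quad_discrepancy C (Ns i) \<le> real (Ns i) powr \<alpha> i + 1"
      "real (Ns i) powr \<alpha> i - 1 \<le> min_quad_discrepancy C (Ns i)"
      using near[of i] by (simp_all add: abs_le_iff)
    \<comment> \<open>N is at most \<open>Ns i + q i\<close>, hence at most twice
      \<open>Ns i\<close>.\<close>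
    have "real N powr (\<alpha> i - \<epsilon>s i) \<le> (2 * real (Ns i)) powr (\<alpha> i - \<epsilon>s i)"
      using N g(1) ae by (intro powr_mono2) auto
    then show "real N powr (\<alpha> i - \<epsilon>s i) \<le> min_quad_discrepancy C N"
      using t n g by linarith
    have "real (Ns i) powr (\<alpha> i + \<epsilon>s i) \<le> real N powr (\<alpha> i + \<epsilon>s i)"
      using N ae by (intro powr_mono2) auto
    then show "min_quad_discrepancy C N \<le> real N powr (\<alpha> i + \<epsilon>s i)"
      using t n g by linarith
  qed
qed simp

end
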